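(* Let $k$ be a field of characteristic zero. For $G=S_5$ and each nontrivial conjugacy class $\mathcal{C}$, the flat connections $\alpha=\phi-\theta$ with $\phi\ne0$ having constant coefficients in $\{0,1\}$ are organised by cardinality into strata $F_n$ as follows (strata not listed, $n\ge1$, are empty; $\theta_i$ denotes the sum of all $e_a$, $a\in\mathcal{C}$, with $a$ a cycle containing $i$), and the representation $V_n$ associated to the submaximal stratum (the one of largest cardinality below $|\mathcal{C}|$) is as stated. (1) Class of $(12)$, $|\mathcal{C}|=10$: $F_{10}=\{\theta\}$; $F_6=\{\theta-\theta_i\mid i=1,\dots,5\}$; $|F_4|=10$, $|F_3|=10$, $|F_2|=15$; $F_1=\{e_a\}_{a\in\mathcal{C}}$. $V_6\cong$ fund. (2) Class of $(12)(34)$, $|\mathcal{C}|=15$: $F_{15}=\{\theta\}$; $F_5$ consists of the six elements $e_{14,23}+e_{12,35}+e_{13,45}+e_{25,34}+e_{15,24}$, $e_{14,23}+e_{13,25}+e_{24,35}+e_{15,34}+e_{12,45}$, $e_{13,24}+e_{12,35}+e_{23,45}+e_{15,34}+e_{14,25}$, $e_{13,24}+e_{15,23}+e_{25,34}+e_{12,45}+e_{14,35}$, $e_{12,34}+e_{13,25}+e_{23,45}+e_{15,24}+e_{14,35}$, $e_{12,34}+e_{15,23}+e_{24,35}+e_{14,25}+e_{13,45}$; $|F_3|=15$, $|F_2|=15$; $F_1=\{e_a\}_{a\in\mathcal{C}}$. $V_5\cong\bar{5}$. (3) Class of $(123)$, $|\mathcal{C}|=20$: $F_{20}=\{\theta\}$;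 $F_8=\{\theta-\theta_i\mid i=1,\dots,5\}$; $|F_4|=10$, $|F_2|=10$; $F_1=\{e_a\}_{a\in\mathcal{C}}$. $V_8\cong$ fund. (4) Class of $(123)(45)$, $|\mathcal{C}|=20$: $F_{20}=\{\theta\}$; $F_2=\{e_{(xyz)(ij)}+e_{(xzy)(ij)}\}$, one element for each 2-cycle $(ij)$, with $\{x,y,z\}$ the complement of $\{i,j\}$; $F_1=\{e_a\}_{a\in\mathcal{C}}$. $V_2\cong$ fund $\oplus\,5$. (5) Class of $(1234)$, $|\mathcal{C}|=30$: $F_{30}=\{\theta\}$; $F_{10}$ consists of the six elements $e_{1234}+e_{1523}+e_{2435}+e_{2534}+e_{1245}+e_{1542}+e_{1354}+e_{1453}+e_{1432}+e_{1325}$, $e_{1234}+e_{1253}+e_{2453}+e_{2354}+e_{1524}+e_{1425}+e_{1345}+e_{1543}+e_{1432}+e_{1352}$, $e_{1243}+e_{1342}+e_{1532}+e_{1235}+e_{2345}+e_{2543}+e_{1524}+e_{1425}+e_{1354}+e_{1453}$, $e_{1523}+e_{2453}+e_{2354}+e_{1243}+e_{1452}+e_{1254}+e_{1534}+e_{1435}+e_{1342}+e_{1325}$, $e_{1532}+e_{2435}+e_{2534}+e_{1452}+e_{1254}+e_{1345}+e_{1324}+e_{1543}+e_{1423}+e_{1235}$, $e_{1253}+e_{2345}+e_{2543}+e_{1245}+e_{1542}+e_{1534}+e_{1435}+e_{1324}+e_{1423}+e_{1352}$; $F_6=\{\theta-\theta_i\mid i=1,\dots,5\}$; $|F_5|=12$,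 $|F_2|=15$; $F_1=\{e_a\}_{a\in\mathcal{C}}$. $V_{10}\cong\bar{5}$. (6) Class of $(12345)$, $|\mathcal{C}|=24$: $F_{24}=\{\theta\}$; $F_{12}$ consists of two elements, the sum of $e_a$ over all $a=(\sigma(1)\sigma(2)\sigma(3)\sigma(4)\sigma(5))$ with $\sigma$ an even permutation, and the sum of $e_a$ over all such $a$ with $\sigma$ odd; $|F_4|=6$, $|F_3|=24$, $|F_2|=36$; $F_1=\{e_a\}_{a\in\mathcal{C}}$. $V_{12}\cong$ sign. Here fund is the standard 4-dimensional irreducible representation of $S_5$, and $5$ (respectively $\bar 5$) is the 5-dimensional irreducible representation of $S_5$ whose character at $(12)$ is positive (respectively negative).
   Context: For a finite group $G$ and nontrivial conjugacy class $\mathcal{C}$, let $\Lambda^1=k\mathcal{C}$ with basis $\{e_a\}_{a\in\mathcal{C}}$, $\Psi(e_a\otimes e_b)=e_{aba^{-1}}\otimes e_a$, $\Lambda_{quad}=T\Lambda^1/\langle\ker(\mathrm{id}-\Psi)\rangle$, and $\theta=\sum_{a\in\mathcal{C}}e_a$. On $\Lambda_{quad}$ the differential satisfies $\mathrm{d}e_a=\theta e_a+e_a\theta$. A connection with constant coefficients is $\alpha\in\Lambda^1$; its curvature is $F(\alpha)=\mathrm{d}\alpha+\alpha^2$ and it is flat if $F(\alpha)=0$. Writing $\phi=\alpha+\theta=\sum_a\phi^ae_a$ one has $F(\alpha)=\phi^2$, so flatness means $\phi^2=0$ in $\Lambda_{quad}$. "Coefficients in $\{0,1\}$" means $\phi^a\in\{0,1\}$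 for all $a$. The cardinality of $\alpha$ is the number of $a\in\mathcal{C}$ with $\phi^a\neq0$; $F_n$ denotes the set of such flat connections (represented by $\phi$) of cardinality $n$. $G$ acts on $\Lambda^1$ by $g\cdot e_a=e_{gag^{-1}}$, and $V_n=kF_n/k\theta$, where $kF_n\subset\Lambda^1$ is the span of $F_n$. Brackets on cycle labels are omitted: $e_{1234}=e_{(1234)}$, $e_{12,34}=e_{(12)(34)}$, etc. *)

theory Defs
  imports
    "HOL-Algebra.Sym_Groups"
    "HOL-Algebra.QuotRing"
    "HOL-Algebra.Module"
    "HOL-Analysis.Determinants"
    "HOL-Library.Numeral_Type"
    "HOL-Library.Poly_Mapping"
begin

section \<open>The tensor algebra on a set of generators\<close>

text \<open>Words form a monoid under concatenation, so that finitely supported functions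
  on words form, with the convolution product of \<^theory>\<open>HOL-Library.Poly_Mapping\<close>, the free
  associative algebra; the word \<open>[a\<^sub>1, \<dots>, a\<^sub>n]\<close> stands for the tensor
  \<open>e\<^bsub>a\<^sub>1\<^esub> \<otimes> \<dots> \<otimes> e\<^bsub>a\<^sub>n\<^esub>\<close>.\<close>

instantiation list :: (type) monoid_add
begin

definition zero_list :: "'a list" where "zero_list = []"

definition plus_list :: "'a list \<Rightarrow> 'a list \<Rightarrow> 'a list" where "plus_list = (@)"

instance by standard (simp_all add: zero_list_def plus_list_def)

end

type_synonym ('g, 'k) tensor = "'g list \<Rightarrow>\<^sub>0 'k"

definition scale :: "'k::field \<Rightarrow> ('g, 'k) tensor \<Rightarrow> ('g, 'k) tensor"
  where "scale c p = Poly_Mapping.map ((*) c) p"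

definition basis_elt :: "'g \<Rightarrow> ('g, 'k::field) tensor"
  where "basis_elt a = Poly_Mapping.single [a] 1"

definition coeff1 :: "('g, 'k::field) tensor \<Rightarrow> 'g \<Rightarrow> 'k"
  where "coeff1 \<phi> a = Poly_Mapping.lookup \<phi> [a]"

definition tensor_algebra :: "'g set \<Rightarrow> ('g, 'k::field) tensor ring"
  where "tensor_algebra C =
    \<lparr>carrier = {p. Poly_Mapping.keys p \<subseteq> lists C}, mult = (*), one = 1, zero = 0, add = (+)\<rparr>"

definition Lambda1 :: "'g set \<Rightarrow> ('g, 'k::field) tensor set"
  where "Lambda1 C = {p. Poly_Mapping.keys p \<subseteq> {[a] | a. a \<in> C}}"

definition Lambda1_tensor_Lambda1 :: "'g set \<Rightarrow> ('g, 'k::field) tensor set"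
  where "Lambda1_tensor_Lambda1 C =
    {p. Poly_Mapping.keys p \<subseteq> {[a, b] | a b. a \<in> C \<and> b \<in> C}}"

lemma lookup_scale: "Poly_Mapping.lookup (scale c p) w = c * Poly_Mapping.lookup p w"
  by (simp add: scale_def map.rep_eq when_def)

lemma vector_space_scale: "vector_space (scale :: 'k::field \<Rightarrow> ('g, 'k) tensor \<Rightarrow> _)"
  by unfold_locales
    (auto intro!: poly_mapping_eqI simp: lookup_scale lookup_add algebra_simps)

lemma ring_tensor_algebra: "ring (tensor_algebra C :: ('g, 'k::field) tensor ring)"
proof (rule ringI)
  show "abelian_group (tensor_algebra C :: ('g, 'k) tensor ring)"
  proof (rule abelian_groupI)
    fix x :: "('g, 'k) tensor" assume "x \<in> carrier (tensor_algebra C)"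
    then show "\<exists>y\<in>carrier (tensor_algebra C). y \<oplus>\<^bsub>tensor_algebra C\<^esub> x = \<zero>\<^bsub>tensor_algebra C\<^esub>"
      by (intro bexI[of _ "- x"]) (auto simp: tensor_algebra_def in_keys_iff subset_iff)
  qed (use keys_add in \<open>fastforce simp: tensor_algebra_def algebra_simps\<close>)+
  show "Group.monoid (tensor_algebra C :: ('g, 'k) tensor ring)"
  proof (rule monoidI)
    fix x y :: "('g, 'k) tensor"
    assume "x \<in> carrier (tensor_algebra C)" "y \<in> carrier (tensor_algebra C)"
    then show "x \<otimes>\<^bsub>tensor_algebra C\<^esub> y \<in> carrier (tensor_algebra C)"
      using keys_mult[of x y] by (fastforce simp: tensor_algebra_def plus_list_def)
  qed (auto simp: tensor_algebra_def zero_list_def algebra_simps)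
qed (auto simp: tensor_algebra_def algebra_simps)


section \<open>The quadratic algebra of a conjugacy class and flat connections\<close>

definition conj_class :: "('g, 'm) monoid_scheme \<Rightarrow> 'g \<Rightarrow> 'g set"
  where "conj_class G x = {g \<otimes>\<^bsub>G\<^esub> x \<otimes>\<^bsub>G\<^esub> inv\<^bsub>G\<^esub> g | g. g \<in> carrier G}"

definition braiding :: "('g, 'm) monoid_scheme \<Rightarrow> 'g set \<Rightarrow> ('g, 'k::field) tensor \<Rightarrow> ('g, 'k) tensor"
  where "braiding G C p = (\<Sum>a\<in>C. \<Sum>b\<in>C.
    scale (Poly_Mapping.lookup p [a, b]) (basis_elt (a \<otimes>\<^bsub>G\<^esub> b \<otimes>\<^bsub>G\<^esub> inv\<^bsub>G\<^esub> a) * basis_elt a))"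

definition quad_relations :: "('g, 'm) monoid_scheme \<Rightarrow> 'g set \<Rightarrow> ('g, 'k::field) tensor set"
  where "quad_relations G C = {p \<in> Lambda1_tensor_Lambda1 C. p - braiding G C p = 0}"

definition quad_ideal :: "('g, 'm) monoid_scheme \<Rightarrow> 'g set \<Rightarrow> ('g, 'k::field) tensor set"
  where "quad_ideal G C = Idl\<^bsub>tensor_algebra C\<^esub> (quad_relations G C)"

definition Lambda_quad :: "('g, 'm) monoid_scheme \<Rightarrow> 'g set \<Rightarrow> ('g, 'k::field) tensor set ring"
  where "Lambda_quad G C = tensor_algebra C Quot quad_ideal G C"

definition quad_proj :: "('g, 'm) monoid_scheme \<Rightarrow> 'g set \<Rightarrow> ('g, 'k::field) tensor \<Rightarrow> ('g, 'k) tensor set"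
  where "quad_proj G C p = quad_ideal G C +>\<^bsub>tensor_algebra C\<^esub> p"

definition theta :: "'g set \<Rightarrow> ('g, 'k::field) tensor"
  where "theta C = (\<Sum>a\<in>C. basis_elt a)"

text \<open>The differential on one-forms, extended linearly from \<open>d e\<^sub>a = \<theta> e\<^sub>a + e\<^sub>a \<theta>\<close>.\<close>

definition differential1 ::
    "('g, 'm) monoid_scheme \<Rightarrow> 'g set \<Rightarrow> ('g, 'k::field) tensor \<Rightarrow> ('g, 'k) tensor set"
  where "differential1 G C \<alpha> = quad_proj G C
    (\<Sum>a\<in>C. scale (coeff1 \<alpha> a) (theta C * basis_elt a + basis_elt a * theta C))"

definition curvature ::
    "('g, 'm) monoid_scheme \<Rightarrow> 'g set \<Rightarrow> ('g, 'k::field) tensor \<Rightarrow> ('g, 'k) tensor set"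
  where "curvature G C \<alpha> =
    differential1 G C \<alpha> \<oplus>\<^bsub>Lambda_quad G C\<^esub> (quad_proj G C \<alpha> \<otimes>\<^bsub>Lambda_quad G C\<^esub> quad_proj G C \<alpha>)"

definition flat :: "('g, 'm) monoid_scheme \<Rightarrow> 'g set \<Rightarrow> ('g, 'k::field) tensor \<Rightarrow> bool"
  where "flat G C \<alpha> \<longleftrightarrow> \<alpha> \<in> Lambda1 C \<and> curvature G C \<alpha> = \<zero>\<^bsub>Lambda_quad G C\<^esub>"

text \<open>The stratum of cardinality \<open>n\<close>; a connection \<open>\<alpha>\<close> is represented by \<open>\<phi> = \<alpha> + \<theta>\<close>.\<close>

definition flat_stratum ::
    "('g, 'm) monoid_scheme \<Rightarrow> 'g set \<Rightarrow> nat \<Rightarrow> ('g, 'k::field) tensor set"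
  where "flat_stratum G C n =
    {\<phi> \<in> Lambda1 C. (\<forall>a\<in>C. coeff1 \<phi> a \<in> {0, 1}) \<and> flat G C (\<phi> - theta C)
       \<and> card {a \<in> C. coeff1 \<phi> a \<noteq> 0} = n}"


section \<open>Representations\<close>

text \<open>A representation is a module record together with a group action. The ring
  multiplication and unit that every module record carries play no role.\<close>

record ('k, 'v, 'g) rep = "('k, 'v) module" +
  act :: "'g \<Rightarrow> 'v \<Rightarrow> 'v"

definition mk_rep ::
    "'v set \<Rightarrow> 'v \<Rightarrow> ('v \<Rightarrow> 'v \<Rightarrow> 'v) \<Rightarrow> ('k \<Rightarrow> 'v \<Rightarrow> 'v) \<Rightarrow> ('g \<Rightarrow> 'v \<Rightarrow> 'v) \<Rightarrow> ('k, 'v, 'g) rep"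
  where "mk_rep V z p s \<rho> =
    \<lparr>carrier = V, mult = undefined, one = undefined, zero = z, add = p, smult = s, act = \<rho>\<rparr>"

definition rep_iso ::
    "('g, 'm) monoid_scheme \<Rightarrow> ('k, 'v, 'g) rep \<Rightarrow> ('k, 'w, 'g) rep \<Rightarrow> bool"
  where "rep_iso G V W \<longleftrightarrow> (\<exists>T. bij_betw T (carrier V) (carrier W)
    \<and> (\<forall>x\<in>carrier V. \<forall>y\<in>carrier V. T (x \<oplus>\<^bsub>V\<^esub> y) = T x \<oplus>\<^bsub>W\<^esub> T y)
    \<and> (\<forall>c. \<forall>x\<in>carrier V. T (c \<odot>\<^bsub>V\<^esub> x) = c \<odot>\<^bsub>W\<^esub> T x)
    \<and> (\<forall>g\<in>carrier G. \<forall>x\<in>carrier V. T (act V g x) = act W g (T x)))"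

definition rep_sum :: "('k, 'v, 'g) rep \<Rightarrow> ('k, 'w, 'g) rep \<Rightarrow> ('k, 'v \<times> 'w, 'g) rep"
  where "rep_sum V W = mk_rep (carrier V \<times> carrier W) (\<zero>\<^bsub>V\<^esub>, \<zero>\<^bsub>W\<^esub>)
    (\<lambda>(x, y) (x', y'). (x \<oplus>\<^bsub>V\<^esub> x', y \<oplus>\<^bsub>W\<^esub> y'))
    (\<lambda>c (x, y). (c \<odot>\<^bsub>V\<^esub> x, c \<odot>\<^bsub>W\<^esub> y))
    (\<lambda>g (x, y). (act V g x, act W g y))"

text \<open>The quotient by a subrepresentation \<open>N\<close>. Scaling a coset by \<open>0\<close> elementwise gives
  \<open>{0}\<close>, hence the \<open>N\<close> added back in the scalar multiplication.\<close>

definition rep_quot :: "('k, 'v, 'g) rep \<Rightarrow> 'v set \<Rightarrow> ('k, 'v set, 'g) rep"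
  where "rep_quot V N = mk_rep (a_rcosets\<^bsub>V\<^esub> N) N (\<lambda>X Y. X <+>\<^bsub>V\<^esub> Y)
    (\<lambda>c X. N <+>\<^bsub>V\<^esub> ((\<lambda>x. c \<odot>\<^bsub>V\<^esub> x) ` X)) (\<lambda>g X. act V g ` X)"

definition span_k :: "('g, 'k::field) tensor set \<Rightarrow> ('g, 'k) tensor set"
  where "span_k = Modules.module.span scale"

definition Lambda1_act ::
    "('g, 'm) monoid_scheme \<Rightarrow> 'g set \<Rightarrow> 'g \<Rightarrow> ('g, 'k::field) tensor \<Rightarrow> ('g, 'k) tensor"
  where "Lambda1_act G C g p =
    (\<Sum>a\<in>C. scale (coeff1 p a) (basis_elt (g \<otimes>\<^bsub>G\<^esub> a \<otimes>\<^bsub>G\<^esub> inv\<^bsub>G\<^esub> g)))"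

definition Lambda1_rep ::
    "('g, 'm) monoid_scheme \<Rightarrow> 'g set \<Rightarrow> ('k::field, ('g, 'k) tensor, 'g) rep"
  where "Lambda1_rep G C = mk_rep (Lambda1 C) 0 (+) scale (Lambda1_act G C)"

text \<open>\<open>V\<^sub>n = kF\<^sub>n / k\<theta>\<close>, meaningful when \<open>\<theta> \<in> kF\<^sub>n\<close>.\<close>

definition stratum_rep ::
    "('g, 'm) monoid_scheme \<Rightarrow> 'g set \<Rightarrow> nat \<Rightarrow> ('k::field, ('g, 'k) tensor set, 'g) rep"
  where "stratum_rep G C n =
    rep_quot ((Lambda1_rep G C)\<lparr>carrier := span_k (flat_stratum G C n)\<rparr>) (span_k {theta C})"

definition matrix_rep ::
    "('g, 'm) monoid_scheme \<Rightarrow> ('g \<Rightarrow> 'k::field ^ 'n ^ 'n) \<Rightarrow> bool"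
  where "matrix_rep G \<rho> \<longleftrightarrow> \<rho> \<one>\<^bsub>G\<^esub> = mat 1
    \<and> (\<forall>g\<in>carrier G. \<forall>h\<in>carrier G. \<rho> (g \<otimes>\<^bsub>G\<^esub> h) = \<rho> g ** \<rho> h)"

definition rep_of_matrices :: "('g \<Rightarrow> 'k::field ^ 'n ^ 'n) \<Rightarrow> ('k, 'k ^ 'n, 'g) rep"
  where "rep_of_matrices \<rho> = mk_rep UNIV 0 (+) (*s) (\<lambda>g x. \<rho> g *v x)"

definition irreducible_matrix_rep ::
    "('g, 'm) monoid_scheme \<Rightarrow> ('g \<Rightarrow> 'k::field ^ 'n ^ 'n) \<Rightarrow> bool"
  where "irreducible_matrix_rep G \<rho> \<longleftrightarrow> matrix_rep G \<rho>
    \<and> (\<forall>U. vec.subspace U \<and> (\<forall>g\<in>carrier G. \<forall>x\<in>U. \<rho> g *v x \<in> U) \<longrightarrow> U = {0} \<or> U = UNIV)"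


section \<open>The symmetric group on five letters\<close>

abbreviation S5 :: "(nat \<Rightarrow> nat) monoid"
  where "S5 \<equiv> sym_group 5"

text \<open>\<open>cyc [[1,2,3],[4,5]]\<close> is the permutation \<open>(1 2 3)(4 5)\<close>.\<close>

definition cyc :: "nat list list \<Rightarrow> nat \<Rightarrow> nat"
  where "cyc css = foldr (\<lambda>cs p. cycle_of_list cs \<circ> p) css id"

definition theta_through :: "(nat \<Rightarrow> nat) set \<Rightarrow> nat \<Rightarrow> (nat \<Rightarrow> nat, 'k::field) tensor"
  where "theta_through C i =
    (\<Sum>a | a \<in> C \<and> (\<exists>cs. cycle cs \<and> i \<in> set cs \<and> a = cycle_of_list cs). basis_elt a)"

text \<open>The four-dimensional standard representation: vectors of coordinate sum zero, with
  \<open>g\<close> sending the \<open>i\<close>-th unit vector to the \<open>g i\<close>-th.\<close>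

definition fund_rep :: "('k::field, nat \<Rightarrow> 'k, nat \<Rightarrow> nat) rep"
  where "fund_rep = mk_rep {x. (\<forall>i. i \<notin> {1..5} \<longrightarrow> x i = 0) \<and> (\<Sum>i=1..5. x i) = 0}
    (\<lambda>i. 0) (\<lambda>x y i. x i + y i) (\<lambda>c x i. c * x i) (\<lambda>g x i. x ((inv\<^bsub>S5\<^esub> g) i))"

definition sign_rep :: "('k::field, 'k, nat \<Rightarrow> nat) rep"
  where "sign_rep = mk_rep UNIV 0 (+) (*) (\<lambda>g x. of_int (sign g) * x)"

text \<open>Five-dimensional irreducible representations, distinguished by the sign of the
  character at \<open>(1 2)\<close>. Characters of \<open>S\<^sub>5\<close> take integer values, so the sign
  makes sense in any field of characteristic zero.\<close>

definition is_rep5 :: "((nat \<Rightarrow> nat) \<Rightarrow> 'k::field_char_0 ^ 5 ^ 5) \<Rightarrow> bool"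
  where "is_rep5 \<rho> \<longleftrightarrow> irreducible_matrix_rep S5 \<rho>
    \<and> (\<exists>m::int. m > 0 \<and> trace (\<rho> (cyc [[1, 2]])) = of_int m)"

definition is_rep5bar :: "((nat \<Rightarrow> nat) \<Rightarrow> 'k::field_char_0 ^ 5 ^ 5) \<Rightarrow> bool"
  where "is_rep5bar \<rho> \<longleftrightarrow> irreducible_matrix_rep S5 \<rho>
    \<and> (\<exists>m::int. m < 0 \<and> trace (\<rho> (cyc [[1, 2]])) = of_int m)"

end

theory Submission
  imports Defs
begin

text \<open>In degree two the quadratic ideal is just the kernel of \<open>id - \<Psi>\<close>, so \<open>\<phi>\<^sup>2 = 0\<close> says that
  \<open>\<phi>\<^sup>a \<phi>\<^sup>b = \<phi>\<^sup>a \<phi>\<^sup>c\<close> with \<open>c = a b a\<^sup>-\<^sup>1\<close>: for coefficients in \<open>{0,1}\<close>, flat connections are exactly the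
  indicator vectors of subracks, the subsets of the class closed under conjugation by their own
  elements. There are at most 94 of them in each class of \<open>S\<^sub>5\<close>, and a branching search finds all.

  For the submaximal stratum, pair its span with weight functions that an element of \<open>S\<^sub>5\<close>
  permutes up to sign. The Gram matrix with the indicator vectors has the form \<open>K (m \<delta>\<^sub>i\<^sub>j - 1)\<close>, so the pairings
  identify the quotient by \<open>\<theta>\<close> with the sum-zero families on which \<open>S\<^sub>5\<close> acts by permutation. The
  five-dimensional representations come from the six Sylow 5-subgroups: adding up the translates of a
  vector under a 5-cycle leaves a multiple of one fixed vector, and its images span, which gives
  irreducibility over any field of characteristic zero. The two are told apart by a sign twist.\<close>

section \<open>Flat connections as subracks\<close>

text \<open>In all classes but one, \<open>S5\<close> permutes the submaximal flat connections like
  five points, like the six Sylow 5-subgroups, or like the two A_5-classes of 5-cycles, and any two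
  distinct ones meet in equally many elements; this is why a Gram matrix has only two distinct
  entries. The class of (123)(45) is the obstacle: its submaximal stratum consists of ten disjoint
  pairs, permuted like the 2-cycles, and the quotient has dimension nine. There two families of
  weights are combined, one labelled by the five letters and one by six pentagons.

  A Sylow 5-subgroup fixes a pentagon on the letters only up to exchange with the pentagon of its
  diagonals. Weight 1 on sides and -1 on diagonals turns this ambiguity into a sign, picked up by
  odd permutations: the origin of the sign twist.

  The two values of each weight are integers chosen so that the weight sums to 0 over the class. The
  pairings then vanish on \<theta>, and one evaluation of the integer tables serves every field of
  characteristic zero.\<close>

lemma lookup_times_word:
  fixes p q :: "('g, 'k::field) tensor"
  shows "Poly_Mapping.lookup (p * q) w =
    (\<Sum>i\<le>length w. Poly_Mapping.lookup p (take i w) * Poly_Mapping.lookup q (drop i w))"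
proof -
  let ?f = "\<lambda>(a, b). Poly_Mapping.lookup p a * Poly_Mapping.lookup q b"
  let ?A = "(\<lambda>i. (take i w, drop i w)) ` {..length w}"
  have A: "(a, b) \<in> ?A \<longleftrightarrow> w = a + b" for a b
    by (auto simp: plus_list_def image_iff intro!: bexI[of _ "length a"])
  have "Poly_Mapping.lookup (p * q) w = (\<Sum>ab. ?f ab when ab \<in> ?A)"
    by (simp add: times_poly_mapping.rep_eq prod_fun_unfold_prod A case_prod_unfold flip: A)
  also have "\<dots> = sum ?f ?A"
    by (subst Sum_any.expand_superset[of ?A]) (auto simp: when_def)
  also have "\<dots> = (\<Sum>i\<le>length w. Poly_Mapping.lookup p (take i w) * Poly_Mapping.lookup q (drop i w))"
    by (subst sum.reindex) (auto simp: inj_on_def o_def dest!: arg_cong[of "take _ _" _ length])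
  finally show ?thesis .
qed

lemma lookup_times_Nil:
  "Poly_Mapping.lookup ((p :: ('g, 'k::field) tensor) * q) [] =
    Poly_Mapping.lookup p [] * Poly_Mapping.lookup q []"
  by (simp add: lookup_times_word)

lemma lookup_times_1:
  "Poly_Mapping.lookup ((p :: ('g, 'k::field) tensor) * q) [a] =
    Poly_Mapping.lookup p [] * Poly_Mapping.lookup q [a] + Poly_Mapping.lookup p [a] * Poly_Mapping.lookup q []"
  by (simp add: lookup_times_word)

lemma lookup_times_2:
  "Poly_Mapping.lookup ((p :: ('g, 'k::field) tensor) * q) [a, b] =
    Poly_Mapping.lookup p [] * Poly_Mapping.lookup q [a, b]
    + Poly_Mapping.lookup p [a] * Poly_Mapping.lookup q [b]
    + Poly_Mapping.lookup p [a, b] * Poly_Mapping.lookup q []"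
  by (simp add: lookup_times_word numeral_2_eq_2)

lemma basis_elt_times: "basis_elt a * basis_elt b = (Poly_Mapping.single [a, b] 1 :: ('g, 'k::field) tensor)"
  by (simp add: basis_elt_def mult_single plus_list_def)

section \<open>Degree two of the quadratic ideal\<close>

locale finite_conj_class = group G for G :: "('g, 'm) monoid_scheme" (structure) +
  fixes C :: "'g set"
  assumes finite_C: "finite C"
    and C_sub: "C \<subseteq> carrier G"
    and conj_C: "\<lbrakk>g \<in> carrier G; a \<in> C\<rbrakk> \<Longrightarrow> g \<otimes> a \<otimes> inv g \<in> C"
begin

lemma C_carrier [simp]: "a \<in> C \<Longrightarrow> a \<in> carrier G"
  using C_sub by auto

lemma conj_eq_iff:
  assumes "g \<in> carrier G" "a \<in> carrier G" "b \<in> carrier G"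
  shows "g \<otimes> a \<otimes> inv g = b \<longleftrightarrow> a = inv g \<otimes> b \<otimes> g"
proof
  assume "g \<otimes> a \<otimes> inv g = b"
  then show "a = inv g \<otimes> b \<otimes> g" using assms by (auto simp: m_assoc inv_solve_left)
next
  assume "a = inv g \<otimes> b \<otimes> g"
  then have "g \<otimes> a \<otimes> inv g = (g \<otimes> inv g) \<otimes> b \<otimes> (g \<otimes> inv g)"
    using assms by (simp only: m_assoc inv_closed m_closed)
  then show "g \<otimes> a \<otimes> inv g = b" using assms by simp
qed

lemma conj_inv_C: "g \<in> carrier G \<Longrightarrow> a \<in> C \<Longrightarrow> inv g \<otimes> a \<otimes> g \<in> C"
  using conj_C[of "inv g" a] by simp

lemma lookup_braiding:
  "Poly_Mapping.lookup (braiding G C p) w = (\<Sum>a\<in>C. \<Sum>b\<in>C.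
    Poly_Mapping.lookup p [a, b] * (if [a \<otimes> b \<otimes> inv a, a] = w then 1 else 0))"
  by (simp only: braiding_def lookup_sum lookup_scale basis_elt_times lookup_single when_def)

text \<open>The map from \<open>(a, b)\<close> to the pair of a b a^-1 and a is injective, so a
  single term of the double sum survives.\<close>

lemma lookup_braiding_conj:
  assumes "a \<in> C" "b \<in> C"
  shows "Poly_Mapping.lookup (braiding G C p) [a \<otimes> b \<otimes> inv a, a] = Poly_Mapping.lookup p [a, b]"
proof -
  have eq: "a \<otimes> b' \<otimes> inv a = a \<otimes> b \<otimes> inv a \<longleftrightarrow> b' = b" if "b' \<in> C" for b'
    using that assms by simp
  have "Poly_Mapping.lookup (braiding G C p) [a \<otimes> b \<otimes> inv a, a] =
    (\<Sum>a'\<in>C. if a' = a then \<Sum>b'\<in>C. if b' = b then Poly_Mapping.lookup p [a, b] else 0 else 0)"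
    unfolding lookup_braiding
    by (intro sum.cong refl) (auto simp: eq intro!: sum.cong)
  then show ?thesis using assms finite_C by simp
qed

lemma lookup_braiding_outside:
  assumes "w \<notin> {[a, b] | a b. a \<in> C \<and> b \<in> C}"
  shows "Poly_Mapping.lookup (braiding G C p) w = 0"
proof -
  have "[a \<otimes> b \<otimes> inv a, a] \<noteq> w" if "a \<in> C" "b \<in> C" for a b
    using assms that conj_C[of a b] by auto
  then show ?thesis unfolding lookup_braiding by (intro sum.neutral ballI) simp
qed

text \<open>This ideal contains the defining relations and is cut out in degree two by linear conditions
  on coefficients, so it shows that the quadratic ideal acquires nothing new in degree two.\<close>

definition braided_ideal :: "('g, 'k::field) tensor set" where
  "braided_ideal = {p. Poly_Mapping.keys p \<subseteq> lists C \<and> Poly_Mapping.lookup p [] = 0 \<and>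
    (\<forall>a. Poly_Mapping.lookup p [a] = 0) \<and>
    (\<forall>a\<in>C. \<forall>b\<in>C. Poly_Mapping.lookup p [a \<otimes> b \<otimes> inv a, a] = Poly_Mapping.lookup p [a, b])}"

text \<open>An element of this set has no part in degrees 0 and 1. Multiplying it by
  \<open>q\<close> from either side therefore changes its degree-two part only by the constant
  coefficient of \<open>q\<close>, a scalar, which respects the linear conditions.\<close>

lemma ideal_braided_ideal: "ideal (braided_ideal :: ('g, 'k::field) tensor set) (tensor_algebra C)"
proof (rule idealI)
  interpret R: ring "tensor_algebra C :: ('g, 'k) tensor ring" by (rule ring_tensor_algebra)
  show "ring (tensor_algebra C :: ('g, 'k) tensor ring)" by (rule ring_tensor_algebra)
  have minus: "\<ominus>\<^bsub>tensor_algebra C\<^esub> p = - p" if "Poly_Mapping.keys p \<subseteq> lists C" for p :: "('g, 'k) tensor"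
    using that by (intro R.minus_equality) (auto simp: tensor_algebra_def in_keys_iff subset_iff)
  show "subgroup (braided_ideal :: ('g, 'k) tensor set) (add_monoid (tensor_algebra C))"
  proof (rule R.add.subgroupI)
    show "braided_ideal \<subseteq> carrier (tensor_algebra C :: ('g, 'k) tensor ring)"
      by (auto simp: braided_ideal_def tensor_algebra_def)
    have "(0 :: ('g, 'k) tensor) \<in> braided_ideal" by (auto simp: braided_ideal_def)
    then show "(braided_ideal :: ('g, 'k) tensor set) \<noteq> {}" by blast
  next
    fix p :: "('g, 'k) tensor" assume p: "p \<in> braided_ideal"
    then have "\<ominus>\<^bsub>tensor_algebra C\<^esub> p = - p" by (intro minus) (auto simp: braided_ideal_def)
    moreover have "- p \<in> braided_ideal"
      using p by (auto simp: braided_ideal_def in_keys_iff subset_iff)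
    ultimately show "\<ominus>\<^bsub>tensor_algebra C\<^esub> p \<in> braided_ideal" by simp
  next
    fix p q :: "('g, 'k) tensor" assume "p \<in> braided_ideal" "q \<in> braided_ideal"
    then show "p \<oplus>\<^bsub>tensor_algebra C\<^esub> q \<in> braided_ideal"
      using keys_add[of p q] by (auto simp: braided_ideal_def tensor_algebra_def lookup_add)
  qed
next
  interpret R: ring "tensor_algebra C :: ('g, 'k) tensor ring" by (rule ring_tensor_algebra)
  fix p q :: "('g, 'k) tensor" assume p: "p \<in> braided_ideal" and q: "q \<in> carrier (tensor_algebra C)"
  have pc: "p \<in> carrier (tensor_algebra C)" using p by (auto simp: braided_ideal_def tensor_algebra_def)
  have "Poly_Mapping.keys (q * p) \<subseteq> lists C" "Poly_Mapping.keys (p * q) \<subseteq> lists C"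
    using R.m_closed[OF q pc] R.m_closed[OF pc q] by (simp_all add: tensor_algebra_def)
  then show "q \<otimes>\<^bsub>tensor_algebra C\<^esub> p \<in> braided_ideal" "p \<otimes>\<^bsub>tensor_algebra C\<^esub> q \<in> braided_ideal"
    using p by (auto simp: braided_ideal_def tensor_algebra_def lookup_times_Nil lookup_times_1 lookup_times_2)
qed

lemma quad_relations_sub_braided_ideal:
  "(quad_relations G C :: ('g, 'k::field) tensor set) \<subseteq> braided_ideal"
proof
  fix p :: "('g, 'k) tensor" assume p: "p \<in> quad_relations G C"
  then have "p = braiding G C p" by (simp add: quad_relations_def)
  then have 1: "Poly_Mapping.lookup p [a \<otimes> b \<otimes> inv a, a] = Poly_Mapping.lookup p [a, b]"
    if "a \<in> C" "b \<in> C" for a b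
    using lookup_braiding_conj[OF that, of p] by simp
  have K: "Poly_Mapping.keys p \<subseteq> {[a, b] | a b. a \<in> C \<and> b \<in> C}"
    using p by (simp add: quad_relations_def Lambda1_tensor_Lambda1_def)
  then have "[] \<notin> Poly_Mapping.keys p" "[a] \<notin> Poly_Mapping.keys p" for a by auto
  then show "p \<in> braided_ideal" using K 1 by (auto simp: braided_ideal_def in_keys_iff)
qed

lemma quad_relations_sub_carrier:
  "(quad_relations G C :: ('g, 'k::field) tensor set) \<subseteq> carrier (tensor_algebra C)"
  by (auto simp: quad_relations_def Lambda1_tensor_Lambda1_def tensor_algebra_def subset_iff)

lemma ideal_quad_ideal: "ideal (quad_ideal G C :: ('g, 'k::field) tensor set) (tensor_algebra C)"
  unfolding quad_ideal_def
  by (rule ring.genideal_ideal[OF ring_tensor_algebra quad_relations_sub_carrier])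

lemma Lambda1_lookup:
  assumes "p \<in> Lambda1 C"
  shows "w \<notin> {[a] | a. a \<in> C} \<Longrightarrow> Poly_Mapping.lookup p w = 0"
  using assms by (auto simp: Lambda1_def in_keys_iff subset_iff)

lemma Lambda1_sub_carrier: "(Lambda1 C :: ('g, 'k::field) tensor set) \<subseteq> carrier (tensor_algebra C)"
  by (auto simp: Lambda1_def tensor_algebra_def subset_iff)

text \<open>Necessity comes from \<open>braided_ideal\<close>, which contains the generated ideal
  and constrains degree-two coefficients. For sufficiency, \<open>p * p\<close> is homogeneous of
  degree two and fixed by the braiding, hence is itself one of the generating relations.\<close>

lemma square_in_quad_ideal_iff:
  fixes p :: "('g, 'k::field) tensor"
  assumes p: "p \<in> Lambda1 C"
  shows "p * p \<in> quad_ideal G C \<longleftrightarrow>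
    (\<forall>a\<in>C. \<forall>b\<in>C. coeff1 p (a \<otimes> b \<otimes> inv a) * coeff1 p a = coeff1 p a * coeff1 p b)"
    (is "_ \<longleftrightarrow> ?R")
proof
  have sq: "Poly_Mapping.lookup (p * p) [a, b] = coeff1 p a * coeff1 p b" for a b
    using Lambda1_lookup[OF p] by (simp add: lookup_times_2 coeff1_def)
  {
    assume "p * p \<in> quad_ideal G C"
    then have "p * p \<in> braided_ideal"
      using ring.genideal_minimal[OF ring_tensor_algebra ideal_braided_ideal quad_relations_sub_braided_ideal]
      by (auto simp: quad_ideal_def)
    then show ?R by (auto simp: braided_ideal_def sq)
  next
    assume R: ?R
    \<comment> \<open>\<open>p\<close> lives on one-letter words, so a nonzero term of the
      convolution forces both parts of the word to have length one.\<close>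
    have sq0: "Poly_Mapping.lookup (p * p) w = 0" if "w \<notin> {[a, b] | a b. a \<in> C \<and> b \<in> C}" for w
    proof -
      have "Poly_Mapping.lookup p (take i w) * Poly_Mapping.lookup p (drop i w) = 0" for i
      proof (rule ccontr)
        assume "\<not> ?thesis"
        then have "take i w \<in> {[a] | a. a \<in> C}" "drop i w \<in> {[a] | a. a \<in> C}"
          using Lambda1_lookup[OF p, of "take i w"] Lambda1_lookup[OF p, of "drop i w"] by auto
        then obtain a b where ab: "a \<in> C" "b \<in> C" "take i w = [a]" "drop i w = [b]"
          by (simp only: mem_Collect_eq) blast
        then have "w = [a, b]" using append_take_drop_id[of i w] by simp
        then show False using that ab by simp
      qed
      then show ?thesis unfolding lookup_times_word by (intro sum.neutral ballI)
    qed
    have "p * p = braiding G C (p * p)"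
    proof (rule poly_mapping_eqI)
      fix w
      show "Poly_Mapping.lookup (p * p) w = Poly_Mapping.lookup (braiding G C (p * p)) w"
      proof (cases "w \<in> {[a, b] | a b. a \<in> C \<and> b \<in> C}")
        case True
        then obtain c a where w: "w = [c, a]" "a \<in> C" "c \<in> C" by auto
        \<comment> \<open>The pair \<open>[a, b]\<close> is the one that the braiding sends to
          \<open>[c, a]\<close>.\<close>
        define b where "b = inv a \<otimes> c \<otimes> a"
        have b: "b \<in> C" unfolding b_def using w conj_inv_C by simp
        have c: "c = a \<otimes> b \<otimes> inv a"
          using conj_eq_iff[of a b c] w b by (simp add: b_def)
        have "Poly_Mapping.lookup (p * p) [a \<otimes> b \<otimes> inv a, a] = Poly_Mapping.lookup (p * p) [a, b]"
          unfolding sq using R w b by blast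
        then show ?thesis using w b lookup_braiding_conj[of a b "p * p"] unfolding w(1) c by simp
      next
        case False
        then show ?thesis by (simp add: sq0 lookup_braiding_outside)
      qed
    qed
    moreover have "p * p \<in> Lambda1_tensor_Lambda1 C"
      unfolding Lambda1_tensor_Lambda1_def mem_Collect_eq[of "p * p"]
    proof
      fix w assume "w \<in> Poly_Mapping.keys (p * p)"
      then show "w \<in> {[a, b] | a b. a \<in> C \<and> b \<in> C}"
        using sq0[of w] unfolding in_keys_iff by (rule contrapos_np)
    qed
    ultimately have "p * p \<in> quad_relations G C" by (simp add: quad_relations_def)
    then show "p * p \<in> quad_ideal G C"
      using ring.genideal_self[OF ring_tensor_algebra quad_relations_sub_carrier]
      by (auto simp: quad_ideal_def)
  }
qed

lemma coeff1_sum: "coeff1 (sum f A) a = (\<Sum>x\<in>A. coeff1 (f x) a)"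
  by (simp add: coeff1_def lookup_sum)

lemma coeff1_basis_elt: "coeff1 (basis_elt b) a = (if a = b then 1 else 0)"
  by (auto simp: coeff1_def basis_elt_def lookup_single when_def)

end

section \<open>Indicator forms and subracks\<close>

definition indicator_form :: "'g set \<Rightarrow> ('g, 'k::field) tensor" where
  "indicator_form S = (\<Sum>a\<in>S. basis_elt a)"

lemma coeff1_indicator_form: "finite S \<Longrightarrow> coeff1 (indicator_form S) a = (if a \<in> S then 1 else 0)"
  by (simp add: indicator_form_def coeff1_def lookup_sum basis_elt_def lookup_single when_def)

lemma Lambda1_eqI:
  assumes "p \<in> Lambda1 C" "q \<in> Lambda1 C" "\<And>a. a \<in> C \<Longrightarrow> coeff1 p a = coeff1 q a"
  shows "p = q"
proof (rule poly_mapping_eqI)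
  fix w
  show "Poly_Mapping.lookup p w = Poly_Mapping.lookup q w"
  proof (cases "w \<in> {[a] | a. a \<in> C}")
    case True
    then show ?thesis using assms(3) by (auto simp: coeff1_def)
  next
    case False
    then have "w \<notin> Poly_Mapping.keys p" "w \<notin> Poly_Mapping.keys q" using assms(1,2) by (auto simp: Lambda1_def)
    then show ?thesis by (simp add: in_keys_iff)
  qed
qed

lemma indicator_form_Lambda1: "S \<subseteq> C \<Longrightarrow> (indicator_form S :: ('g, 'k::field) tensor) \<in> Lambda1 C"
  unfolding Lambda1_def indicator_form_def mem_Collect_eq
  by (rule order_trans[OF keys_sum]) (auto simp: basis_elt_def)

lemma theta_indicator: "theta C = indicator_form C"
  by (simp add: theta_def indicator_form_def)

definition is_subrack :: "('g, 'm) monoid_scheme \<Rightarrow> 'g set \<Rightarrow> bool" where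
  "is_subrack G S \<longleftrightarrow> (\<forall>a\<in>S. \<forall>b\<in>S. a \<otimes>\<^bsub>G\<^esub> b \<otimes>\<^bsub>G\<^esub> inv\<^bsub>G\<^esub> a \<in> S)"

context finite_conj_class
begin

lemma Lambda1_diff: "p \<in> Lambda1 C \<Longrightarrow> q \<in> Lambda1 C \<Longrightarrow> p - q \<in> Lambda1 C"
  using keys_diff[of p q] by (auto simp: Lambda1_def)

lemma coeff1_scale: "coeff1 (scale c p) a = c * coeff1 p a"
  by (simp add: coeff1_def lookup_scale)

lemma sum_basis_Lambda1: "(\<Sum>a\<in>C. scale (f a) (basis_elt a)) \<in> Lambda1 C"
  unfolding Lambda1_def mem_Collect_eq
  by (rule order_trans[OF keys_sum]) (auto simp: basis_elt_def in_keys_iff lookup_scale lookup_single when_def split: if_splits)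

lemma Lambda1_expand: "p \<in> Lambda1 C \<Longrightarrow> (\<Sum>a\<in>C. scale (coeff1 p a) (basis_elt a)) = p"
  by (rule Lambda1_eqI[OF sum_basis_Lambda1])
    (simp_all add: coeff1_sum coeff1_scale coeff1_basis_elt finite_C if_distrib cong: if_cong)

lemma scale_mult: "scale c p * q = scale c (p * q)" "q * scale c p = scale c (q * p)"
  for p q :: "('g, 'k::field) tensor"
  by (rule poly_mapping_eqI, simp add: lookup_times_word lookup_scale sum_distrib_left mult_ac)+

text \<open>Completing the square: with q = p - \<theta> one has \<theta> q + q \<theta> + q^2 = p^2
  - \<theta>^2, and \<theta>^2 lies in the ideal because all coefficients of \<theta> are 1.
  Flatness thus reduces to the criterion for \<open>p * p\<close>.\<close>

lemma flat_iff:
  fixes p :: "('g, 'k::field) tensor"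
  assumes p: "p \<in> Lambda1 C"
  shows "flat G C (p - theta C) \<longleftrightarrow>
    (\<forall>a\<in>C. \<forall>b\<in>C. coeff1 p (a \<otimes> b \<otimes> inv a) * coeff1 p a = coeff1 p a * coeff1 p b)"
proof -
  interpret I: ideal "quad_ideal G C :: ('g, 'k) tensor set" "tensor_algebra C"
    by (rule ideal_quad_ideal)
  interpret H: ring_hom_ring "tensor_algebra C" "Lambda_quad G C" "quad_proj G C :: ('g, 'k) tensor \<Rightarrow> _"
    using I.rcos_ring_hom_ring unfolding Lambda_quad_def quad_proj_def[abs_def] .
  let ?q = "p - theta C" and ?\<theta> = "theta C :: ('g, 'k) tensor"
  have th: "?\<theta> \<in> Lambda1 C" by (simp add: theta_indicator indicator_form_Lambda1)
  have q: "?q \<in> Lambda1 C" by (intro Lambda1_diff p th)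
  have car: "?\<theta> \<in> carrier (tensor_algebra C)" "?q \<in> carrier (tensor_algebra C)" "p \<in> carrier (tensor_algebra C)"
    using Lambda1_sub_carrier p q th by auto
  note R = I.m_closed I.a_closed car
  have [simp]: "x \<otimes>\<^bsub>tensor_algebra C\<^esub> y = x * y" "x \<oplus>\<^bsub>tensor_algebra C\<^esub> y = x + y" for x y :: "('g, 'k) tensor"
    by (simp_all add: tensor_algebra_def)
  have "(\<Sum>a\<in>C. scale (coeff1 ?q a) (?\<theta> * basis_elt a + basis_elt a * ?\<theta>))
     = ?\<theta> * (\<Sum>a\<in>C. scale (coeff1 ?q a) (basis_elt a)) + (\<Sum>a\<in>C. scale (coeff1 ?q a) (basis_elt a)) * ?\<theta>"
    unfolding sum_distrib_left sum_distrib_right sum.distrib[symmetric] scale_mult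
    by (intro sum.cong refl vector_space.vector_space_assms(1)[OF vector_space_scale])
  also have "\<dots> = ?\<theta> * ?q + ?q * ?\<theta>" by (simp only: Lambda1_expand[OF q])
  finally have "curvature G C ?q = quad_proj G C (?\<theta> * ?q + ?q * ?\<theta>) \<oplus>\<^bsub>Lambda_quad G C\<^esub>
       (quad_proj G C ?q \<otimes>\<^bsub>Lambda_quad G C\<^esub> quad_proj G C ?q)"
    unfolding curvature_def differential1_def by (simp only:)
  also have "\<dots> = quad_proj G C (?\<theta> * ?q + ?q * ?\<theta> + ?q * ?q)"
    using H.hom_mult[OF car(2) car(2)]
      H.hom_add[OF I.add.m_closed[OF I.m_closed[OF car(1,2)] I.m_closed[OF car(2,1)]] I.m_closed[OF car(2,2)]]
    by simp
  also have "?\<theta> * ?q + ?q * ?\<theta> + ?q * ?q = p * p - ?\<theta> * ?\<theta>"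
    by (simp add: algebra_simps)
  finally have curv: "curvature G C ?q = quad_proj G C (p * p - ?\<theta> * ?\<theta>)" .
  have th2: "?\<theta> * ?\<theta> \<in> quad_ideal G C"
    by (subst square_in_quad_ideal_iff[OF th])
      (auto simp: theta_indicator coeff1_indicator_form finite_C conj_C)
  have pp: "p * p \<in> carrier (tensor_algebra C)" using I.m_closed[OF car(3,3)] by simp
  have min: "\<ominus>\<^bsub>tensor_algebra C\<^esub> x = - x" if "x \<in> carrier (tensor_algebra C)" for x :: "('g, 'k) tensor"
    using that by (intro I.minus_equality) (auto simp: tensor_algebra_def in_keys_iff subset_iff)
  have dd: "p * p - ?\<theta> * ?\<theta> \<in> carrier (tensor_algebra C)"
    using I.minus_closed[OF pp I.Icarr[OF th2]] min[OF I.Icarr[OF th2]] by (simp add: a_minus_def)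
  have "flat G C ?q \<longleftrightarrow> quad_proj G C (p * p - ?\<theta> * ?\<theta>) = quad_ideal G C"
    using q curv by (simp add: flat_def Lambda_quad_def FactRing_def)
  also have "\<dots> \<longleftrightarrow> p * p - ?\<theta> * ?\<theta> \<in> quad_ideal G C"
    unfolding quad_proj_def
  proof
    assume "quad_ideal G C +>\<^bsub>tensor_algebra C\<^esub> (p * p - ?\<theta> * ?\<theta>) = quad_ideal G C"
    then show "p * p - ?\<theta> * ?\<theta> \<in> quad_ideal G C" using I.a_rcos_self[OF dd] by simp
  next
    assume "p * p - ?\<theta> * ?\<theta> \<in> quad_ideal G C"
    then show "quad_ideal G C +>\<^bsub>tensor_algebra C\<^esub> (p * p - ?\<theta> * ?\<theta>) = quad_ideal G C"
      by (rule I.a_rcos_const)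
  qed
  also have "\<dots> \<longleftrightarrow> p * p \<in> quad_ideal G C"
  proof
    assume "p * p - ?\<theta> * ?\<theta> \<in> quad_ideal G C"
    from additive_subgroup.a_closed[OF I.additive_subgroup_axioms this th2] show "p * p \<in> quad_ideal G C" by simp
  next
    assume "p * p \<in> quad_ideal G C"
    from additive_subgroup.a_closed[OF I.additive_subgroup_axioms this additive_subgroup.a_inv_closed[OF I.additive_subgroup_axioms th2]] show "p * p - ?\<theta> * ?\<theta> \<in> quad_ideal G C"
      by (simp add: min I.Icarr[OF th2])
  qed
  finally show ?thesis using square_in_quad_ideal_iff[OF p] by simp
qed

text \<open>Flatness asks that conjugation by an element of the support preserve both membership and
  non-membership, whereas a subrack asks only for the former. Finiteness closes the gap: conjugation
  by \<open>a\<close> is an injection of \<open>S\<close> into itself, hence onto.\<close>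

lemma flat_stratum_eq:
  "(flat_stratum G C n :: ('g, 'k::field) tensor set) =
     indicator_form ` {S. S \<subseteq> C \<and> is_subrack G S \<and> card S = n}"
proof (intro equalityI subsetI)
  fix p :: "('g, 'k) tensor" assume p: "p \<in> flat_stratum G C n"
  then have pL: "p \<in> Lambda1 C" and c: "\<forall>a\<in>C. coeff1 p a \<in> {0, 1}"
    and fl: "flat G C (p - theta C)" and n: "card {a \<in> C. coeff1 p a \<noteq> 0} = n"
    by (auto simp: flat_stratum_def)
  let ?S = "{a \<in> C. coeff1 p a \<noteq> 0}"
  have "p = indicator_form ?S"
    using c finite_C by (intro Lambda1_eqI[OF pL indicator_form_Lambda1]) (auto simp: coeff1_indicator_form)
  moreover have "is_subrack G ?S"
    unfolding is_subrack_def
  proof (intro ballI)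
    fix a b assume "a \<in> ?S" "b \<in> ?S"
    then show "a \<otimes> b \<otimes> inv a \<in> ?S"
      using fl[unfolded flat_iff[OF pL], rule_format, of a b] conj_C[of a b] by auto
  qed
  ultimately show "p \<in> indicator_form ` {S. S \<subseteq> C \<and> is_subrack G S \<and> card S = n}"
    using n by blast
next
  fix p :: "('g, 'k) tensor" assume "p \<in> indicator_form ` {S. S \<subseteq> C \<and> is_subrack G S \<and> card S = n}"
  then obtain S where S: "p = indicator_form S" "S \<subseteq> C" "is_subrack G S" "card S = n" by auto
  have fS: "finite S" using S(2) finite_C finite_subset by auto
  have pL: "p \<in> Lambda1 C" using S by (simp add: indicator_form_Lambda1)
  have inS: "b \<in> S" if a: "a \<in> S" and b: "b \<in> C" and ab: "a \<otimes> b \<otimes> inv a \<in> S" for a b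
  proof -
    have "inj_on (\<lambda>b. a \<otimes> b \<otimes> inv a) S"
      using subsetD[OF S(2)] a by (auto intro!: inj_onI)
    moreover have "(\<lambda>b. a \<otimes> b \<otimes> inv a) ` S \<subseteq> S" using S(3) a by (auto simp: is_subrack_def)
    ultimately have "(\<lambda>b. a \<otimes> b \<otimes> inv a) ` S = S" using fS by (simp add: endo_inj_surj)
    then have "a \<otimes> b \<otimes> inv a \<in> (\<lambda>b. a \<otimes> b \<otimes> inv a) ` S" using ab by simp
    then obtain b' where "a \<otimes> b \<otimes> inv a = a \<otimes> b' \<otimes> inv a" "b' \<in> S" by (rule imageE)
    moreover have "a \<in> carrier G" "b \<in> carrier G" "b' \<in> carrier G" using a b S(2) \<open>b' \<in> S\<close> by auto
    ultimately have "b' = b" by simp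
    then show "b \<in> S" using \<open>b' \<in> S\<close> by simp
  qed
  have "flat G C (p - theta C)"
    unfolding flat_iff[OF pL]
  proof (intro ballI)
    fix a b assume "a \<in> C" "b \<in> C"
    moreover have "a \<otimes> b \<otimes> inv a \<in> S" if "a \<in> S" "b \<in> S"
      using S(3) that by (simp add: is_subrack_def)
    ultimately show "coeff1 p (a \<otimes> b \<otimes> inv a) * coeff1 p a = coeff1 p a * coeff1 p b"
      using inS[of a b] by (auto simp: S(1) coeff1_indicator_form fS)
  qed
  moreover have "{a \<in> C. coeff1 p a \<noteq> 0} = S" using S by (auto simp: coeff1_indicator_form fS)
  ultimately show "p \<in> flat_stratum G C n" using S pL by (auto simp: flat_stratum_def coeff1_indicator_form fS)
qed

lemma inj_on_indicator_form: "inj_on (indicator_form :: _ \<Rightarrow> ('g, 'k::field) tensor) {S. S \<subseteq> C}"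
proof (rule inj_onI)
  fix S T assume ST: "S \<in> {S. S \<subseteq> C}" "T \<in> {S. S \<subseteq> C}"
    and eq: "indicator_form S = (indicator_form T :: ('g, 'k) tensor)"
  then have fin: "finite S" "finite T" using finite_C finite_subset by auto
  have "a \<in> S \<longleftrightarrow> a \<in> T" for a
    using arg_cong[OF eq, of "\<lambda>p. coeff1 p a"] fin by (simp add: coeff1_indicator_form split: if_splits)
  then show "S = T" by blast
qed
end

section \<open>Permutations of five letters as data\<close>

text \<open>Functions on \<open>nat\<close> cannot be compared by evaluation. A permutation stored
  as its five values has decidable equality, so the finite searches run by \<open>code_simp\<close>,
  and \<open>perm_of\<close> carries their results back to \<open>S5\<close>.\<close>

datatype letter = L1 | L2 | L3 | L4 | L5
datatype perm5 = P5 letter letter letter letter letter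

primrec num_of :: "letter \<Rightarrow> nat" where
  "num_of L1 = 1" | "num_of L2 = 2" | "num_of L3 = 3" | "num_of L4 = 4" | "num_of L5 = 5"

fun app :: "perm5 \<Rightarrow> letter \<Rightarrow> letter" where
  "app (P5 a b c d e) L1 = a"
| "app (P5 a b c d e) L2 = b"
| "app (P5 a b c d e) L3 = c"
| "app (P5 a b c d e) L4 = d"
| "app (P5 a b c d e) L5 = e"

definition tabulate :: "(letter \<Rightarrow> letter) \<Rightarrow> perm5" where
  "tabulate f = P5 (f L1) (f L2) (f L3) (f L4) (f L5)"

text \<open>The last branch answers \<open>L5\<close> without a test, which is correct by
  elimination when the tuple is a permutation.\<close>

fun preimage :: "perm5 \<Rightarrow> letter \<Rightarrow> letter" where
  "preimage (P5 a b c d e) l =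
    (if a = l then L1 else if b = l then L2 else if c = l then L3 else if d = l then L4 else L5)"

definition mul5 :: "perm5 \<Rightarrow> perm5 \<Rightarrow> perm5" where "mul5 p q = tabulate (\<lambda>l. app p (app q l))"

definition conj5 :: "perm5 \<Rightarrow> perm5 \<Rightarrow> perm5" where
  "conj5 g x = tabulate (\<lambda>l. app g (app x (preimage g l)))"

definition letters :: "letter list" where "letters = [L1, L2, L3, L4, L5]"

definition all_perms :: "perm5 list" where
  "all_perms = [P5 a b c d e. a \<leftarrow> letters, b \<leftarrow> removeAll a letters,
     c \<leftarrow> removeAll a (removeAll b letters), d \<leftarrow> removeAll a (removeAll b (removeAll c letters)),
     e \<leftarrow> removeAll a (removeAll b (removeAll c (removeAll d letters)))]"

definition perm_of :: "perm5 \<Rightarrow> nat \<Rightarrow> nat" where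
  "perm_of p n = (if n = 1 then num_of (app p L1) else if n = 2 then num_of (app p L2)
     else if n = 3 then num_of (app p L3) else if n = 4 then num_of (app p L4)
     else if n = 5 then num_of (app p L5) else n)"

lemma UNIV_letter: "UNIV = {L1, L2, L3, L4, L5}"
proof -
  have "l \<in> {L1, L2, L3, L4, L5}" for l by (cases l) simp_all
  then show ?thesis by blast
qed

lemma set_letters: "set letters = UNIV"
  by (simp add: letters_def UNIV_letter)

instance letter :: finite
  by standard (simp add: UNIV_letter)

lemma app_tabulate [simp]: "app (tabulate f) l = f l"
  by (cases l) (simp_all add: tabulate_def)

lemma tabulate_app: "tabulate (app p) = p"
  by (cases p) (simp add: tabulate_def)

lemma perm5_eqI:
  assumes "\<And>l. app p l = app q l" shows "p = q"
proof -
  have "tabulate (app p) = tabulate (app q)" by (simp only: tabulate_def assms)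
  then show ?thesis by (simp only: tabulate_app)
qed

lemma inj_num_of: "inj num_of"
proof (rule injI)
  fix x y show "num_of x = num_of y \<Longrightarrow> x = y" by (cases x; cases y) simp_all
qed

lemma num_of_eq_iff [simp]: "num_of x = num_of y \<longleftrightarrow> x = y"
  using inj_num_of by (auto dest: injD)

lemma num_of_range: "num_of l \<in> {1..5}"
  by (cases l) simp_all

lemma range_num_of: "range num_of = {1..5}"
proof -
  have "{1..5} = {1, 2, 3, 4, 5 :: nat}" by auto
  then show ?thesis unfolding UNIV_letter by simp
qed

lemma num_of_cases:
  assumes "n \<in> {1..5}" obtains l where "n = num_of l"
  using assms unfolding range_num_of[symmetric] by auto

lemma perm_of_num_of [simp]: "perm_of p (num_of l) = num_of (app p l)"
  by (cases l) (simp_all add: perm_of_def)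

lemma perm_of_outside: "n \<notin> {1..5} \<Longrightarrow> perm_of p n = n"
  by (auto simp: perm_of_def)

lemma perm_of_eqI:
  assumes "\<And>l. f (num_of l) = num_of (app p l)" "\<And>n. n \<notin> {1..5} \<Longrightarrow> f n = n"
  shows "f = perm_of p"
proof
  fix n show "f n = perm_of p n"
  proof (cases "n \<in> {1..5}")
    case True
    then obtain l where "n = num_of l" by (rule num_of_cases)
    then show ?thesis by (simp add: assms(1))
  next
    case False
    show ?thesis unfolding assms(2)[OF False] perm_of_outside[OF False] ..
  qed
qed

lemma perm_of_mul5: "perm_of (mul5 p q) = perm_of p \<circ> perm_of q"
  by (rule perm_of_eqI[symmetric]) (simp_all add: mul5_def perm_of_outside)

lemma inj_perm_of: "inj perm_of"
proof (rule injI)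
  fix p q assume "perm_of p = perm_of q"
  then have "num_of (app p l) = num_of (app q l)" for l unfolding perm_of_num_of[symmetric] by simp
  then show "p = q" by (intro perm5_eqI) simp
qed

lemma perm_of_eq_iff [simp]: "perm_of p = perm_of q \<longleftrightarrow> p = q"
  using inj_perm_of by (auto dest: injD)

lemma in_all_perms_iff: "p \<in> set all_perms \<longleftrightarrow> inj (app p)"
proof -
  obtain a b c d e where p: "p = P5 a b c d e" by (cases p)
  have "p \<in> set all_perms \<longleftrightarrow> distinct [a, b, c, d, e]"
    unfolding p all_perms_def by (auto simp: set_letters image_iff)
  moreover have "inj (app p) \<longleftrightarrow> distinct [app p L1, app p L2, app p L3, app p L4, app p L5]"
    using distinct_map[of "app p" "[L1, L2, L3, L4, L5]"] by (simp add: UNIV_letter)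
  ultimately show ?thesis by (simp add: p)
qed

lemma bij_app: "p \<in> set all_perms \<Longrightarrow> bij (app p)"
  unfolding in_all_perms_iff bij_def using finite_UNIV_inj_surj[of "app p"] by simp

lemma app_preimage:
  assumes "p \<in> set all_perms" shows "app p (preimage p l) = l"
proof -
  obtain l' where l: "l = app p l'" using bij_is_surj[OF bij_app[OF assms]] by (rule surjE)
  obtain a b c d e where p: "p = P5 a b c d e" by (cases p)
  show ?thesis unfolding l p by (cases l') auto
qed

lemma preimage_app: "p \<in> set all_perms \<Longrightarrow> preimage p (app p l) = l"
  using app_preimage[of p "app p l"] by (simp add: in_all_perms_iff inj_eq)

lemma perm_of_permutes: "p \<in> set all_perms \<Longrightarrow> perm_of p permutes {1..5}"
proof (rule bij_imp_permutes)
  assume p: "p \<in> set all_perms"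
  have "inj_on (perm_of p) (range num_of)"
    using p by (auto simp: in_all_perms_iff inj_def intro!: inj_onI)
  moreover have "perm_of p ` range num_of = range num_of"
    using bij_is_surj[OF bij_app[OF p]] by (simp add: image_image flip: image_image[of num_of "app p"])
  ultimately show "bij_betw (perm_of p) {1..5} {1..5}"
    unfolding range_num_of by (simp add: bij_betw_def)
qed (rule perm_of_outside)

lemma carrier_S5: "carrier S5 = perm_of ` set all_perms"
proof (intro equalityI subsetI)
  fix f assume "f \<in> carrier S5"
  then have f: "f permutes {1..5}" by (simp add: sym_group_carrier)
  define p where "p = tabulate (\<lambda>l. SOME m. f (num_of l) = num_of m)"
  have 1: "f (num_of l) = num_of (app p l)" for l
  proof -
    have "f (num_of l) \<in> range num_of"
      using permutes_in_image[OF f] num_of_range range_num_of by metis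
    then show ?thesis unfolding p_def app_tabulate by (auto intro: someI)
  qed
  then have "f = perm_of p" using permutes_not_in[OF f] by (intro perm_of_eqI) auto
  moreover have "inj (app p)"
  proof (rule injI)
    fix x y assume "app p x = app p y"
    then have "f (num_of x) = f (num_of y)" by (simp add: 1)
    then show "x = y" using permutes_inj[OF f] by (simp add: inj_eq)
  qed
  ultimately show "f \<in> perm_of ` set all_perms" by (auto simp: in_all_perms_iff)
qed (auto simp: sym_group_carrier simp del: One_nat_def intro: perm_of_permutes)

lemma perm_of_carrier: "p \<in> set all_perms \<Longrightarrow> perm_of p \<in> carrier S5"
  by (simp add: carrier_S5)

section \<open>Conjugation and conjugacy classes of encoded permutations\<close>

interpretation S5: group S5 by (rule sym_group_is_group)

lemma mult_S5: "p \<otimes>\<^bsub>S5\<^esub> q = p \<circ> q"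
  by (simp add: sym_group_mult)

abbreviation "conj_by g a \<equiv> g \<otimes>\<^bsub>S5\<^esub> a \<otimes>\<^bsub>S5\<^esub> inv\<^bsub>S5\<^esub> g"

abbreviation "class5_of r \<equiv> conj_class S5 (perm_of r)"

lemma perm_of_conj5:
  assumes "g \<in> set all_perms" "x \<in> set all_perms"
  shows "perm_of g \<otimes>\<^bsub>S5\<^esub> perm_of x \<otimes>\<^bsub>S5\<^esub> inv\<^bsub>S5\<^esub> perm_of g = perm_of (conj5 g x)"
    and "conj5 g x \<in> set all_perms"
proof -
  have "inj (preimage g)" using app_preimage[OF assms(1)] by (rule inj_on_inverseI)
  moreover have "app (conj5 g x) = app g \<circ> app x \<circ> preimage g" by (rule ext) (simp add: conj5_def)
  ultimately show 1: "conj5 g x \<in> set all_perms"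
    using assms unfolding in_all_perms_iff by (auto intro: inj_compose)
  \<comment> \<open>The identity is proved in the form x' g = g x and then cancelled on the right,
    so that the inverse in \<open>S5\<close> never has to be matched with
    \<open>preimage\<close>.\<close>
  have "mul5 (conj5 g x) g = mul5 g x"
    by (rule perm5_eqI) (simp add: mul5_def conj5_def preimage_app assms)
  then have "perm_of (conj5 g x) \<otimes>\<^bsub>S5\<^esub> perm_of g = perm_of g \<otimes>\<^bsub>S5\<^esub> perm_of x"
    by (simp add: mult_S5 flip: perm_of_mul5)
  then show "perm_of g \<otimes>\<^bsub>S5\<^esub> perm_of x \<otimes>\<^bsub>S5\<^esub> inv\<^bsub>S5\<^esub> perm_of g = perm_of (conj5 g x)"
    using S5.inv_solve_right[of "perm_of (conj5 g x)" "perm_of g \<otimes>\<^bsub>S5\<^esub> perm_of x" "perm_of g"] assms 1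
    by (simp add: perm_of_carrier del: sym_group_inv_equality)
qed

definition class5 :: "perm5 \<Rightarrow> perm5 list" where
  "class5 r = remdups (map (\<lambda>g. conj5 g r) all_perms)"

lemma conj_class_code: "r \<in> set all_perms \<Longrightarrow> class5_of r = perm_of ` set (class5 r)"
  unfolding conj_class_def carrier_S5 class5_def set_remdups set_map image_image Setcompr_eq_image
  by (intro image_cong refl perm_of_conj5(1))

lemma class5_sub: "r \<in> set all_perms \<Longrightarrow> set (class5 r) \<subseteq> set all_perms"
  by (auto simp: class5_def perm_of_conj5)

lemma finite_conj_class_S5:
  assumes "x \<in> carrier S5" shows "finite_conj_class S5 (conj_class S5 x)"
proof unfold_locales
  show "finite (conj_class S5 x)" using assms conj_class_code by (auto simp: carrier_S5)
  show "conj_class S5 x \<subseteq> carrier S5" using assms by (auto simp: conj_class_def)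
next
  fix g a assume g: "g \<in> carrier S5" and "a \<in> conj_class S5 x"
  then obtain h where h: "h \<in> carrier S5" "a = conj_by h x" by (auto simp: conj_class_def)
  have "conj_by g a = (g \<otimes>\<^bsub>S5\<^esub> h) \<otimes>\<^bsub>S5\<^esub> x \<otimes>\<^bsub>S5\<^esub> inv\<^bsub>S5\<^esub> (g \<otimes>\<^bsub>S5\<^esub> h)"
    using g h assms by (simp add: S5.inv_mult_group S5.m_assoc del: sym_group_inv_equality)
  then show "conj_by g a \<in> conj_class S5 x"
    using g h(1) S5.m_closed unfolding conj_class_def by blast
qed

section \<open>Enumerating subracks\<close>

text \<open>A finite set that is stable under conjugation by generators of a rack is stable under the whole
  rack, so only the chosen generators act. The search below uses only that a rack containing \<open>S\<close>
  contains the closure; the closure property itself is tested afterwards in \<open>subracks\<close>.\<close>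

fun orbit_closure :: "nat \<Rightarrow> perm5 list \<Rightarrow> perm5 list \<Rightarrow> perm5 list \<Rightarrow> perm5 list \<Rightarrow> perm5 list option" where
  "orbit_closure 0 gens S w E = Some S"
| "orbit_closure (Suc n) gens S [] E = Some S"
| "orbit_closure (Suc n) gens S (y # w) E =
   (let N = filter (\<lambda>c. \<not> List.member S c) (remdups (map (\<lambda>g. conj5 g y) gens)) in
     if list_ex (List.member E) N then None else orbit_closure n gens (N @ S) (N @ w) E)"

text \<open>Each class element \<open>x\<close> in \<open>R\<close> either joins, and the set is
  closed up again, or goes to the excluded list \<open>E\<close>; a branch dies when a closure meets
  \<open>E\<close>. The bound 30 is the size of the largest class, and each element is processed
  once, so every closure can finish. A truncated closure would still be sound and would merely prune
  less.\<close>

fun subrack_search :: "perm5 list \<Rightarrow> perm5 list \<Rightarrow> perm5 list \<Rightarrow> perm5 list \<Rightarrow> perm5 list list" where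
  "subrack_search gens S E [] = [S]"
| "subrack_search gens S E (x # R) = (if List.member S x then subrack_search gens S E R else
   (case orbit_closure 30 (x # gens) (x # S) (x # S) E of None \<Rightarrow> [] | Some S' \<Rightarrow> subrack_search (x # gens) S' E R)
    @ subrack_search gens S (x # E) R)"

definition rack5 :: "perm5 set \<Rightarrow> bool" where
  "rack5 S \<longleftrightarrow> (\<forall>a\<in>S. \<forall>b\<in>S. conj5 a b \<in> S)"

text \<open>Lists the members of \<open>S\<close> in the order of \<open>C\<close>. This normal form
  makes equal sets equal lists, so that \<open>remdups\<close> and \<open>length\<close> count
  sets.\<close>

definition sublist_of :: "perm5 list \<Rightarrow> perm5 list \<Rightarrow> perm5 list" where
  "sublist_of C S = filter (List.member S) C"

definition subracks :: "perm5 \<Rightarrow> perm5 list list" where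
  "subracks r = (let C = class5 r in remdups (filter (\<lambda>l. list_all (\<lambda>a. list_all (\<lambda>b. List.member l (conj5 a b)) l) l)
     (map (sublist_of C) (subrack_search [] [] [] C))))"

definition strata :: "perm5 \<Rightarrow> nat \<Rightarrow> perm5 list list" where
  "strata r n = filter (\<lambda>l. length l = n) (subracks r)"

text \<open>Every added element is a conjugate of an element of \<open>T\<close> by an element of
  \<open>T\<close>. The closure therefore stays inside \<open>T\<close> and cannot meet
  \<open>E\<close>.\<close>

lemma orbit_closure_sound:
  assumes "rack5 T" "set gens \<subseteq> T" "set S \<subseteq> T" "set w \<subseteq> T" "set E \<inter> T = {}"
  shows "\<exists>S'. orbit_closure n gens S w E = Some S' \<and> set S \<subseteq> set S' \<and> set S' \<subseteq> T"
  using assms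
proof (induction n gens S w E rule: orbit_closure.induct)
  case (3 n gens S y w E)
  let ?N = "filter (\<lambda>c. \<not> List.member S c) (remdups (map (\<lambda>g. conj5 g y) gens))"
  have N: "set ?N \<subseteq> T" using 3(2,3,5) by (auto simp: rack5_def)
  then have "\<not> list_ex (List.member E) ?N" using 3(6) by (auto simp: list_ex_iff)
  with N 3 show ?case by (auto simp: Let_def)
qed auto

text \<open>Follow the branch that decides each \<open>x\<close> according to its membership in
  \<open>T\<close>; no closure on this branch can kill it.\<close>

lemma subrack_search_sound:
  assumes "rack5 T" "set gens \<subseteq> T" "set S \<subseteq> T" "set E \<inter> T = {}" "T \<subseteq> set S \<union> set E \<union> set R"
  shows "\<exists>S'\<in>set (subrack_search gens S E R). set S' = T"
  using assms
proof (induction R arbitrary: gens S E)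
  case Nil
  then show ?case by auto
next
  case (Cons x R)
  show ?case
  proof (cases "x \<in> T")
    case True
    show ?thesis
    proof (cases "List.member S x")
      case True
      then have "T \<subseteq> set S \<union> set E \<union> set R" using Cons.prems by auto
      then show ?thesis using Cons.IH[of gens S E] Cons.prems True by auto
    next
      case False
      obtain S' where S': "orbit_closure 30 (x # gens) (x # S) (x # S) E = Some S'"
          "set (x # S) \<subseteq> set S'" "set S' \<subseteq> T"
        using orbit_closure_sound[of T "x # gens" "x # S" "x # S" E 30] Cons.prems True by auto
      have "T \<subseteq> set S' \<union> set E \<union> set R" "set (x # gens) \<subseteq> T" using Cons.prems True S' by auto
      then show ?thesis using Cons.IH[of "x # gens" S' E] Cons.prems True False S' by auto
    qed
  next
    case False
    then have "\<not> List.member S x" using Cons.prems by auto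
    then show ?thesis using Cons.IH[of gens S "x # E"] Cons.prems False by auto
  qed
qed


lemma is_subrack_perm_of:
  assumes "S \<subseteq> set all_perms" shows "is_subrack S5 (perm_of ` S) \<longleftrightarrow> rack5 S"
proof -
  have "perm_of a \<otimes>\<^bsub>S5\<^esub> perm_of b \<otimes>\<^bsub>S5\<^esub> inv\<^bsub>S5\<^esub> perm_of a = perm_of (conj5 a b)" if "a \<in> S" "b \<in> S" for a b
    using that assms by (intro perm_of_conj5) auto
  then show ?thesis using inj_perm_of by (auto simp: is_subrack_def rack5_def inj_image_mem_iff)
qed

text \<open>One inclusion is the completeness of the search, the other is the closure test built
  into \<open>subracks\<close>.\<close>

lemma set_subracks: "set ` set (subracks r) = {S. S \<subseteq> set (class5 r) \<and> rack5 S}"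
proof (intro equalityI subsetI)
  fix S assume "S \<in> {S. S \<subseteq> set (class5 r) \<and> rack5 S}"
  then have S: "S \<subseteq> set (class5 r)" "rack5 S" by auto
  obtain S' where S': "S' \<in> set (subrack_search [] [] [] (class5 r))" "set S' = S"
    using subrack_search_sound[of S "[]" "[]" "[]" "class5 r"] S by auto
  have "set (sublist_of (class5 r) S') = S" using S S' by (auto simp: sublist_of_def)
  moreover have "sublist_of (class5 r) S' \<in> set (subracks r)"
    using S S' calculation by (auto simp: subracks_def Let_def list_all_iff rack5_def)
  ultimately show "S \<in> set ` set (subracks r)" by blast
qed (auto simp: subracks_def Let_def list_all_iff rack5_def sublist_of_def)

lemma subracks_normal:
  assumes "l \<in> set (subracks r)" shows "sublist_of (class5 r) l = l" "distinct l"
proof -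
  obtain S where l: "l = sublist_of (class5 r) S" using assms by (auto simp: subracks_def Let_def)
  show "sublist_of (class5 r) l = l" unfolding l by (auto simp: sublist_of_def intro!: filter_cong)
  show "distinct l" unfolding l by (simp add: sublist_of_def class5_def)
qed

lemma inj_on_set_subracks: "inj_on set (set (subracks r))"
proof (rule inj_onI)
  fix k l assume "k \<in> set (subracks r)" "l \<in> set (subracks r)" and eq: "set k = set l"
  then have "k = sublist_of (class5 r) k" "l = sublist_of (class5 r) l" by (simp_all add: subracks_normal)
  moreover have "sublist_of (class5 r) k = sublist_of (class5 r) l"
    unfolding sublist_of_def using eq by (intro filter_cong) simp_all
  ultimately show "k = l" by simp
qed

lemma subrack_sub: "l \<in> set (subracks r) \<Longrightarrow> set l \<subseteq> set (class5 r)"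
  using set_subracks by blast

lemma distinct_strata: "distinct (strata r n)"
  by (simp add: strata_def subracks_def Let_def)

text \<open>The bridge from algebra to evaluation: counting flat connections becomes measuring the
  length of a computed list. No two list entries collapse, since the indicator form determines the
  set and the set determines its normal-form list.\<close>

lemma flat_stratum_code:
  assumes r: "r \<in> set all_perms"
  shows "(flat_stratum S5 (class5_of r) n :: (_, 'k::field) tensor set) =
      (\<lambda>l. indicator_form (perm_of ` set l)) ` set (strata r n)"
    and "card (flat_stratum S5 (class5_of r) n :: (_, 'k::field) tensor set) = length (strata r n)"
proof -
  interpret finite_conj_class S5 "class5_of r"
    using r by (intro finite_conj_class_S5 perm_of_carrier)
  let ?C = "perm_of ` set (class5 r)"
  have "{S. S \<subseteq> ?C \<and> is_subrack S5 S \<and> card S = n} = (`) perm_of ` {S. S \<subseteq> set (class5 r) \<and> rack5 S \<and> card S = n}"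
    (is "?A = ?B")
  proof (intro equalityI subsetI)
    fix S assume "S \<in> ?A"
    then obtain S' where "S = perm_of ` S'" "S' \<subseteq> set (class5 r)" "is_subrack S5 S" "card S = n"
      by (auto simp: subset_image_iff)
    then show "S \<in> ?B"
      using is_subrack_perm_of[of S'] class5_sub[OF r] inj_perm_of by (auto simp: card_image inj_on_subset)
  next
    fix S assume "S \<in> ?B"
    then obtain S' where "S = perm_of ` S'" "S' \<subseteq> set (class5 r)" "rack5 S'" "card S' = n" by auto
    then show "S \<in> ?A"
      using is_subrack_perm_of[of S'] class5_sub[OF r] inj_perm_of by (auto simp: card_image inj_on_subset)
  qed
  also have "{S. S \<subseteq> set (class5 r) \<and> rack5 S \<and> card S = n} = {S \<in> set ` set (subracks r). card S = n}"
    unfolding set_subracks by auto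
  also have "\<dots> = set ` set (strata r n)"
    by (auto simp: strata_def subracks_normal(2) distinct_card)
  finally have eq: "{S. S \<subseteq> ?C \<and> is_subrack S5 S \<and> card S = n} = (`) perm_of ` set ` set (strata r n)" .
  show 1: "(flat_stratum S5 (class5_of r) n :: (_, 'k::field) tensor set) =
      (\<lambda>l. indicator_form (perm_of ` set l)) ` set (strata r n)"
    unfolding flat_stratum_eq unfolding conj_class_code[OF r] eq image_image ..
  have "inj_on (\<lambda>l. indicator_form (perm_of ` set l) :: (_, 'k) tensor) (set (strata r n))"
  proof (rule inj_onI)
    fix k l assume kl: "k \<in> set (strata r n)" "l \<in> set (strata r n)"
      and eq: "indicator_form (perm_of ` set k) = (indicator_form (perm_of ` set l) :: (_, 'k) tensor)"
    have mem: "k \<in> set (subracks r)" "l \<in> set (subracks r)" using kl by (simp_all add: strata_def)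
    have "perm_of ` set k = perm_of ` set l"
      using subrack_sub[OF mem(1)] subrack_sub[OF mem(2)]
      by (intro inj_onD[OF inj_on_indicator_form eq]) (auto simp: conj_class_code[OF r])
    then have "set k = set l" by (simp add: inj_image_eq_iff[OF inj_perm_of])
    then show "k = l" using inj_onD[OF inj_on_set_subracks] mem by blast
  qed
  then show "card (flat_stratum S5 (class5_of r) n :: (_, 'k::field) tensor set) = length (strata r n)"
    unfolding 1 by (simp add: card_image distinct_card distinct_strata)
qed

section \<open>Cycle notation and the tables of explicit strata\<close>

definition tr5 :: "letter \<Rightarrow> letter \<Rightarrow> perm5" where
  "tr5 a b = tabulate (\<lambda>l. if l = a then b else if l = b then a else l)"

text \<open>The recursion is that of \<open>cycle_of_list\<close>, so that decoding a cycle is a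
  plain induction.\<close>

fun cyc1 :: "letter list \<Rightarrow> perm5" where
  "cyc1 (a # b # cs) = mul5 (tr5 a b) (cyc1 (b # cs))"
| "cyc1 cs = tabulate (\<lambda>l. l)"

definition cyc5 :: "letter list list \<Rightarrow> perm5" where
  "cyc5 css = foldr (\<lambda>cs p. mul5 (cyc1 cs) p) css (tabulate (\<lambda>l. l))"

lemma perm_of_id: "perm_of (tabulate (\<lambda>l. l)) = id"
  by (rule perm_of_eqI[symmetric]) simp_all

lemma perm_of_tr5: "perm_of (tr5 a b) = Transposition.transpose (num_of a) (num_of b)"
  using num_of_range[of a] num_of_range[of b]
  by (intro perm_of_eqI[symmetric]) (auto simp: tr5_def Transposition.transpose_def)

lemma perm_of_cyc1: "perm_of (cyc1 cs) = cycle_of_list (map num_of cs)"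
  by (induction cs rule: cyc1.induct) (simp_all add: perm_of_mul5 perm_of_tr5 perm_of_id)

lemma cyc_map: "cyc (map (map num_of) css) = perm_of (cyc5 css)"
  by (induction css) (simp_all add: cyc_def cyc5_def perm_of_mul5 perm_of_cyc1 perm_of_id)

text \<open>Each row consists of the five involutions in the normaliser, within A_5, of a Sylow
  5-subgroup, a dihedral group of order 10; \<open>dihedral_code\<close> recovers the same six sets
  from the Sylow generators.\<close>

definition dihedral_table :: "letter list list list list" where
  "dihedral_table = [[[[L1,L4],[L2,L3]], [[L1,L2],[L3,L5]], [[L1,L3],[L4,L5]], [[L2,L5],[L3,L4]], [[L1,L5],[L2,L4]]],
   [[[L1,L4],[L2,L3]], [[L1,L3],[L2,L5]], [[L2,L4],[L3,L5]], [[L1,L5],[L3,L4]], [[L1,L2],[L4,L5]]],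
   [[[L1,L3],[L2,L4]], [[L1,L2],[L3,L5]], [[L2,L3],[L4,L5]], [[L1,L5],[L3,L4]], [[L1,L4],[L2,L5]]],
   [[[L1,L3],[L2,L4]], [[L1,L5],[L2,L3]], [[L2,L5],[L3,L4]], [[L1,L2],[L4,L5]], [[L1,L4],[L3,L5]]],
   [[[L1,L2],[L3,L4]], [[L1,L3],[L2,L5]], [[L2,L3],[L4,L5]], [[L1,L5],[L2,L4]], [[L1,L4],[L3,L5]]],
   [[[L1,L2],[L3,L4]], [[L1,L5],[L2,L3]], [[L2,L4],[L3,L5]], [[L1,L4],[L2,L5]], [[L1,L3],[L4,L5]]]]"

text \<open>Each row consists of the ten elements of order four in the normaliser, within the whole
  symmetric group, of a Sylow 5-subgroup, a Frobenius group of order 20.\<close>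

definition frobenius_table :: "letter list list list list" where
  "frobenius_table = [[[[L1,L2,L3,L4]], [[L1,L5,L2,L3]], [[L2,L4,L3,L5]], [[L2,L5,L3,L4]], [[L1,L2,L4,L5]], [[L1,L5,L4,L2]], [[L1,L3,L5,L4]], [[L1,L4,L5,L3]], [[L1,L4,L3,L2]], [[L1,L3,L2,L5]]],
   [[[L1,L2,L3,L4]], [[L1,L2,L5,L3]], [[L2,L4,L5,L3]], [[L2,L3,L5,L4]], [[L1,L5,L2,L4]], [[L1,L4,L2,L5]], [[L1,L3,L4,L5]], [[L1,L5,L4,L3]], [[L1,L4,L3,L2]], [[L1,L3,L5,L2]]],
   [[[L1,L2,L4,L3]], [[L1,L3,L4,L2]], [[L1,L5,L3,L2]], [[L1,L2,L3,L5]], [[L2,L3,L4,L5]], [[L2,L5,L4,L3]], [[L1,L5,L2,L4]], [[L1,L4,L2,L5]], [[L1,L3,L5,L4]], [[L1,L4,L5,L3]]],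
   [[[L1,L5,L2,L3]], [[L2,L4,L5,L3]], [[L2,L3,L5,L4]], [[L1,L2,L4,L3]], [[L1,L4,L5,L2]], [[L1,L2,L5,L4]], [[L1,L5,L3,L4]], [[L1,L4,L3,L5]], [[L1,L3,L4,L2]], [[L1,L3,L2,L5]]],
   [[[L1,L5,L3,L2]], [[L2,L4,L3,L5]], [[L2,L5,L3,L4]], [[L1,L4,L5,L2]], [[L1,L2,L5,L4]], [[L1,L3,L4,L5]], [[L1,L3,L2,L4]], [[L1,L5,L4,L3]], [[L1,L4,L2,L3]], [[L1,L2,L3,L5]]],
   [[[L1,L2,L5,L3]], [[L2,L3,L4,L5]], [[L2,L5,L4,L3]], [[L1,L2,L4,L5]], [[L1,L5,L4,L2]], [[L1,L5,L3,L4]], [[L1,L4,L3,L5]], [[L1,L3,L2,L4]], [[L1,L4,L2,L3]], [[L1,L3,L5,L2]]]]"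

definition fixing :: "perm5 \<Rightarrow> letter \<Rightarrow> perm5 list" where
  "fixing r l = filter (\<lambda>a. app a l = l) (class5 r)"

text \<open>An element of order six together with its inverse. The tuple serves here as a list of
  five letters and not as a map.\<close>

fun pair_code :: "perm5 \<Rightarrow> perm5 list" where
  "pair_code (P5 a b c d e) = [cyc5 [[a, b, c], [d, e]], cyc5 [[a, c, b], [d, e]]]"

fun cycle_code :: "perm5 \<Rightarrow> perm5" where
  "cycle_code (P5 a b c d e) = cyc5 [[a, b, c, d, e]]"

text \<open>Moves one letter home by a transposition, keeping track of the parity.\<close>

fun clear_letter :: "letter \<Rightarrow> bool \<times> perm5 \<Rightarrow> bool \<times> perm5" where
  "clear_letter l (s, p) = (if app p l = l then (s, p) else (\<not> s, mul5 (tr5 l (app p l)) p))"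

text \<open>Four rounds suffice: once the other letters are home, \<open>L1\<close> is home as
  well.\<close>

definition even5 :: "perm5 \<Rightarrow> bool" where
  "even5 p = fst (clear_letter L2 (clear_letter L3 (clear_letter L4 (clear_letter L5 (True, p)))))"

lemma clear_letter_all: "list_all (\<lambda>p. snd (clear_letter L2 (clear_letter L3 (clear_letter L4 (clear_letter L5 (True, p))))) = tabulate (\<lambda>l. l)) all_perms"
  by code_simp

lemma classes_cover: "set all_perms = insert (tabulate (\<lambda>l. l)) (set (class5 (cyc5 [[L1,L2]])) \<union> set (class5 (cyc5 [[L1,L2],[L3,L4]]))
  \<union> set (class5 (cyc5 [[L1,L2,L3]])) \<union> set (class5 (cyc5 [[L1,L2,L3],[L4,L5]])) \<union> set (class5 (cyc5 [[L1,L2,L3,L4]]))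
  \<union> set (class5 (cyc5 [[L1,L2,L3,L4,L5]])))"
  by code_simp

text \<open>Here and in the tables that follow, the length 0 belongs to the empty subrack, that is
  to \<phi> = 0, which the theorem leaves out. Lengths 1 and that of the full class are settled for
  all classes at once by \<open>flat_stratum_1\<close> and \<open>flat_stratum_top\<close>, so only
  intermediate strata are counted.\<close>

lemma transposition_code:
  "let r = cyc5 [[L1,L2]]; L = subracks r in length (class5 r) = 10 \<and>
    map (\<lambda>n. length (filter (\<lambda>l. length l = n) L)) [2,3,4,6] = [15,10,10,5] \<and>
    list_all (\<lambda>l. List.member [0,1,2,3,4,6,10] (length l)) L \<and>
    set (filter (\<lambda>l. length l = 6) L) = set (map (fixing r) letters)"
  by code_simp

lemma double_transposition_code:
  "let r = cyc5 [[L1,L2],[L3,L4]]; L = subracks r in length (class5 r) = 15 \<and>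
    map (\<lambda>n. length (filter (\<lambda>l. length l = n) L)) [2,3,5] = [15,15,6] \<and>
    list_all (\<lambda>l. List.member [0,1,2,3,5,15] (length l)) L \<and>
    set (filter (\<lambda>l. length l = 5) L) = set (map (sublist_of (class5 r)) (map (map cyc5) dihedral_table))"
  by code_simp

lemma three_cycle_code:
  "let r = cyc5 [[L1,L2,L3]]; L = subracks r in length (class5 r) = 20 \<and>
    map (\<lambda>n. length (filter (\<lambda>l. length l = n) L)) [2,4,8] = [10,10,5] \<and>
    list_all (\<lambda>l. List.member [0,1,2,4,8,20] (length l)) L \<and>
    set (filter (\<lambda>l. length l = 8) L) = set (map (fixing r) letters)"
  by code_simp

lemma order_six_code:
  "let r = cyc5 [[L1,L2,L3],[L4,L5]]; L = subracks r in length (class5 r) = 20 \<and>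
    map (\<lambda>n. length (filter (\<lambda>l. length l = n) L)) [2] = [10] \<and>
    list_all (\<lambda>l. List.member [0,1,2,20] (length l)) L \<and>
    set (filter (\<lambda>l. length l = 2) L) = set (map (sublist_of (class5 r)) (map pair_code all_perms))"
  by code_simp

lemma four_cycle_code:
  "let r = cyc5 [[L1,L2,L3,L4]]; L = subracks r in length (class5 r) = 30 \<and>
    map (\<lambda>n. length (filter (\<lambda>l. length l = n) L)) [2,5,6,10] = [15,12,5,6] \<and>
    list_all (\<lambda>l. List.member [0,1,2,5,6,10,30] (length l)) L \<and>
    set (filter (\<lambda>l. length l = 6) L) = set (map (fixing r) letters) \<and>
    set (filter (\<lambda>l. length l = 10) L) = set (map (sublist_of (class5 r)) (map (map cyc5) frobenius_table))"
  by code_simp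

lemma five_cycle_code:
  "let r = cyc5 [[L1,L2,L3,L4,L5]]; L = subracks r in length (class5 r) = 24 \<and>
    map (\<lambda>n. length (filter (\<lambda>l. length l = n) L)) [2,3,4,12] = [36,24,6,2] \<and>
    list_all (\<lambda>l. List.member [0,1,2,3,4,12,24] (length l)) L \<and>
    set (filter (\<lambda>l. length l = 12) L) = set (map (sublist_of (class5 r))
      [map cycle_code (filter even5 all_perms), map cycle_code (filter (\<lambda>p. \<not> even5 p) all_perms)])"
  by code_simp

section \<open>Quotients by \<open>\<theta>\<close> and pairings\<close>

interpretation tensor: vector_space "scale :: 'k::field \<Rightarrow> ('g, 'k) tensor \<Rightarrow> ('g, 'k) tensor"
  by (rule vector_space_scale)

text \<open>The first isomorphism theorem for the quotient record: a linear equivariant map on the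
  span with kernel k\<theta> and image \<open>W\<close> identifies the stratum representation with
  \<open>W\<close>. All six classes are treated through it.\<close>

lemma stratum_rep_iso:
  fixes G :: "('g, 'm) monoid_scheme" and C :: "'g set" and n :: nat
    and W :: "('k::field, 'w, 'g) rep" and T :: "('g, 'k) tensor \<Rightarrow> 'w"
  defines "U \<equiv> span_k (flat_stratum G C n)" and "N \<equiv> span_k {theta C}"
  assumes theta: "theta C \<in> U"
    and add: "\<And>x y. x \<in> U \<Longrightarrow> y \<in> U \<Longrightarrow> T (x + y) = T x \<oplus>\<^bsub>W\<^esub> T y"
    and smult: "\<And>c x. x \<in> U \<Longrightarrow> T (scale c x) = c \<odot>\<^bsub>W\<^esub> T x"
    and ker: "\<And>x y. x \<in> U \<Longrightarrow> y \<in> U \<Longrightarrow> T x = T y \<longleftrightarrow> x - y \<in> N"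
    and onto: "T ` U = carrier W"
    and equiv: "\<And>g x. g \<in> carrier G \<Longrightarrow> x \<in> U \<Longrightarrow> T (Lambda1_act G C g x) = act W g (T x)"
  shows "rep_iso G (stratum_rep G C n) W"
proof -
  let ?V = "stratum_rep G C n :: ('k, ('g, 'k) tensor set, 'g) rep" and ?U = "U"
  define coset where "coset x = (\<lambda>v. v + x) ` N" for x
  \<comment> \<open>\<open>T\<close> is constant on each coset of \<open>N\<close>, so its image of
    a coset is a singleton.\<close>
  define T' where "T' X = the_elem (T ` X)" for X
  have NU: "N \<subseteq> ?U"
    unfolding N_def U_def span_k_def
    using theta by (intro tensor.span_minimal) (auto simp: U_def span_k_def)
  have U_add: "x + y \<in> ?U" if "x \<in> ?U" "y \<in> ?U" for x y
    using that by (simp add: U_def span_k_def tensor.span_add)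
  have U_scale: "scale c x \<in> ?U" if "x \<in> ?U" for c x
    using that by (simp add: U_def span_k_def tensor.span_scale)

  have N0: "0 \<in> N" and N_add: "\<And>x y. x \<in> N \<Longrightarrow> y \<in> N \<Longrightarrow> x + y \<in> N"
    and N_diff: "\<And>x y. x \<in> N \<Longrightarrow> y \<in> N \<Longrightarrow> x - y \<in> N"
    and N_scale: "\<And>c x. x \<in> N \<Longrightarrow> scale c x \<in> N"
    by (simp_all add: N_def span_k_def tensor.span_zero tensor.span_add tensor.span_diff tensor.span_scale)
  have coset_eq: "coset x = {y. y - x \<in> N}" for x
  proof (intro equalityI subsetI)
    fix y assume "y \<in> {y. y - x \<in> N}"
    then show "y \<in> coset x" unfolding coset_def by (intro image_eqI[of _ _ "y - x"]) simp_all
  qed (auto simp: coset_def)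
  have coset_U: "coset x \<subseteq> ?U" if "x \<in> ?U" for x
    using that NU U_add by (auto simp: coset_def)
  have T_coset: "T y = T x" if "x \<in> ?U" "y \<in> coset x" for x y
    using that ker[of y x] coset_U by (auto simp: coset_eq)
  have self: "x \<in> coset x" for x using N0 by (simp add: coset_eq)
  have T'_coset: "T' (coset x) = T x" if "x \<in> ?U" for x
  proof -
    have "T ` coset x = {T x}" using T_coset[OF that] self by blast
    then show ?thesis by (simp add: T'_def)
  qed
  have carV: "carrier ?V = coset ` ?U"
    by (auto simp: stratum_rep_def rep_quot_def mk_rep_def Lambda1_rep_def A_RCOSETS_def' a_r_coset_def'
      U_def N_def coset_def)
  have addV: "coset x \<oplus>\<^bsub>?V\<^esub> coset y = coset (x + y)" for x y
  proof -
    have "coset x \<oplus>\<^bsub>?V\<^esub> coset y = {u + v | u v. u \<in> coset x \<and> v \<in> coset y}"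
      by (auto simp: stratum_rep_def rep_quot_def mk_rep_def Lambda1_rep_def set_add_def')
    also have "\<dots> = coset (x + y)"
    proof (intro equalityI subsetI)
      fix z assume "z \<in> coset (x + y)"
      then have "z - y \<in> coset x" by (simp add: coset_eq algebra_simps)
      then show "z \<in> {u + v | u v. u \<in> coset x \<and> v \<in> coset y}" using self[of y] by force
    next
      fix z assume "z \<in> {u + v | u v. u \<in> coset x \<and> v \<in> coset y}"
      then obtain u v where "z = u + v" "u - x \<in> N" "v - y \<in> N" by (auto simp: coset_eq)
      then show "z \<in> coset (x + y)" using N_add[of "u - x" "v - y"] by (simp add: coset_eq algebra_simps)
    qed
    finally show ?thesis .
  qed
  have smV: "c \<odot>\<^bsub>?V\<^esub> coset x = coset (scale c x)" for c x
  proof -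
    have "c \<odot>\<^bsub>?V\<^esub> coset x = {u + scale c v | u v. u \<in> N \<and> v \<in> coset x}"
      by (auto simp: stratum_rep_def rep_quot_def mk_rep_def Lambda1_rep_def set_add_def' N_def)
    also have "\<dots> = coset (scale c x)"
    proof (intro equalityI subsetI)
      fix z assume "z \<in> coset (scale c x)"
      then have "z - scale c x \<in> N" by (simp add: coset_eq)
      then show "z \<in> {u + scale c v | u v. u \<in> N \<and> v \<in> coset x}" using self[of x]
        by (intro CollectI exI[of _ "z - scale c x"] exI[of _ x]) simp
    next
      fix z assume "z \<in> {u + scale c v | u v. u \<in> N \<and> v \<in> coset x}"
      then obtain u v where "z = u + scale c v" "u \<in> N" "v - x \<in> N" by (auto simp: coset_eq)
      then show "z \<in> coset (scale c x)" using N_add[OF _ N_scale[of "v - x" c], of u]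
        by (simp add: coset_eq tensor.scale_right_diff_distrib algebra_simps)
    qed
    finally show ?thesis .
  qed
  have actV: "act ?V g X = Lambda1_act G C g ` X" for g X
    by (simp add: stratum_rep_def rep_quot_def mk_rep_def Lambda1_rep_def)
  have T'_act: "T' (act ?V g (coset x)) = act W g (T x)" if "g \<in> carrier G" "x \<in> ?U" for g x
  proof -
    have "T ` Lambda1_act G C g ` coset x = {act W g (T x)}"
    proof -
      have "T (Lambda1_act G C g y) = act W g (T x)" if "y \<in> coset x" for y
        using equiv[OF \<open>g \<in> carrier G\<close>, of y] T_coset[OF \<open>x \<in> U\<close> that] coset_U[OF \<open>x \<in> U\<close>] that by auto
      then show ?thesis using self[of x] by (auto simp: image_image)
    qed
    then show ?thesis by (simp add: T'_def actV)
  qed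
  have "bij_betw T' (carrier ?V) (carrier W)"
  proof (rule bij_betw_imageI)
    show "inj_on T' (carrier ?V)"
    proof (rule inj_onI)
      fix X Y assume "X \<in> carrier ?V" "Y \<in> carrier ?V" and eq: "T' X = T' Y"
      then obtain x y where xy: "X = coset x" "Y = coset y" "x \<in> ?U" "y \<in> ?U" by (auto simp: carV)
      then have d: "x - y \<in> N" using eq ker by (simp add: T'_coset)
      have "z - x \<in> N \<longleftrightarrow> z - y \<in> N" for z
        using N_add[OF _ d, of "z - x"] N_diff[OF _ d, of "z - y"] by auto
      then show "X = Y" by (simp add: xy coset_eq)
    qed
    show "T' ` carrier ?V = carrier W"
      unfolding carV onto[symmetric] image_image by (intro image_cong refl T'_coset)
  qed
  moreover have "\<forall>X\<in>carrier ?V. \<forall>Y\<in>carrier ?V. T' (X \<oplus>\<^bsub>?V\<^esub> Y) = T' X \<oplus>\<^bsub>W\<^esub> T' Y"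
    unfolding carV ball_simps by (intro ballI) (simp only: addV T'_coset U_add add)
  moreover have "\<forall>c. \<forall>X\<in>carrier ?V. T' (c \<odot>\<^bsub>?V\<^esub> X) = c \<odot>\<^bsub>W\<^esub> T' X"
    unfolding carV ball_simps by (intro ballI allI) (simp only: smV T'_coset U_scale smult)
  moreover have "\<forall>g\<in>carrier G. \<forall>X\<in>carrier ?V. T' (act ?V g X) = act W g (T' X)"
    unfolding carV ball_simps by (intro ballI) (simp only: T'_act T'_coset)
  ultimately show ?thesis unfolding rep_iso_def by (intro exI[of _ T'] conjI)
qed

text \<open>The coefficients are indexed by \<open>I\<close> rather than by the image of
  \<open>v\<close>, to match the Gram matrix indexed by \<open>I\<close>.\<close>

lemma span_image_sum:
  fixes v :: "'i \<Rightarrow> ('g, 'k::field) tensor"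
  assumes "finite I" "p \<in> span_k (v ` I)"
  obtains c where "p = (\<Sum>j\<in>I. scale (c j) (v j))"
proof -
  let ?P = "{p. \<exists>c. p = (\<Sum>j\<in>I. scale (c j) (v j))}"
  have "tensor.subspace ?P"
  proof (rule tensor.subspaceI)
    show "0 \<in> ?P" by (intro CollectI exI[of _ "\<lambda>j. 0"]) simp
  next
    fix x y assume "x \<in> ?P" "y \<in> ?P"
    then obtain c d where "x = (\<Sum>j\<in>I. scale (c j) (v j))" "y = (\<Sum>j\<in>I. scale (d j) (v j))" by auto
    then have "x + y = (\<Sum>j\<in>I. scale (c j + d j) (v j))"
      by (simp add: tensor.scale_left_distrib sum.distrib)
    then show "x + y \<in> ?P" by (intro CollectI exI[of _ "\<lambda>j. c j + d j"])
  next
    fix a x assume "x \<in> ?P"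
    then obtain c where "x = (\<Sum>j\<in>I. scale (c j) (v j))" by auto
    then have "scale a x = (\<Sum>j\<in>I. scale (a * c j) (v j))" by (simp add: tensor.scale_sum_right)
    then show "scale a x \<in> ?P" by (intro CollectI exI[of _ "\<lambda>j. a * c j"])
  qed
  moreover have "v ` I \<subseteq> ?P"
  proof
    fix x assume "x \<in> v ` I"
    then obtain i where i: "i \<in> I" "x = v i" by auto
    have "x = (\<Sum>j\<in>I. scale (if j = i then 1 else 0) (v j))"
      using i assms(1) by (simp add: if_distrib if_distribR cong: if_cong)
    then show "x \<in> ?P" by (intro CollectI exI[of _ "\<lambda>j. if j = i then 1 else 0"])
  qed
  ultimately have "span_k (v ` I) \<subseteq> ?P" unfolding span_k_def by (intro tensor.span_minimal)
  then show thesis using assms(2) that by auto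
qed

section \<open>Integer weights paired with one-forms\<close>

definition pairing :: "'g set \<Rightarrow> ('g \<Rightarrow> int) \<Rightarrow> ('g, 'k::field) tensor \<Rightarrow> 'k" where
  "pairing C w p = (\<Sum>a\<in>C. of_int (w a) * coeff1 p a)"

lemma pairing_add: "pairing C w (p + q) = pairing C w p + pairing C w q"
  by (simp add: pairing_def coeff1_def lookup_add algebra_simps sum.distrib)

lemma pairing_scale: "pairing C w (scale c p) = c * pairing C w p"
  by (simp add: pairing_def coeff1_def lookup_scale sum_distrib_left mult_ac)

lemma pairing_sum: "pairing C w (sum f I) = (\<Sum>i\<in>I. pairing C w (f i))"
  by (simp add: pairing_def coeff1_def lookup_sum sum_distrib_left) (rule sum.swap)

lemma pairing_diff: "pairing C w (p - q) = pairing C w p - pairing C w q"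
  by (simp add: pairing_def coeff1_def lookup_minus algebra_simps sum_subtractf)

lemma pairing_indicator_form:
  assumes "finite C" "S \<subseteq> C"
  shows "pairing C w (indicator_form S) = of_int (\<Sum>a\<in>S. w a)"
proof -
  have "finite S" using assms finite_subset by blast
  then have "pairing C w (indicator_form S) = (\<Sum>a\<in>C. if a \<in> S then of_int (w a) else 0)"
    unfolding pairing_def by (intro sum.cong refl) (simp add: coeff1_indicator_form)
  also have "\<dots> = of_int (\<Sum>a\<in>S. w a)"
    using assms by (simp add: sum.inter_restrict[symmetric] Int_absorb1)
  finally show ?thesis .
qed

lemma pairing_mult: "pairing C (\<lambda>a. s * w a) p = of_int s * pairing C w p"
  by (simp add: pairing_def sum_distrib_left mult_ac)

lemma pairing_cong: "(\<And>a. a \<in> C \<Longrightarrow> w a = w' a) \<Longrightarrow> pairing C w p = pairing C w' p"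
  by (simp add: pairing_def)

text \<open>Moves the action from forms to weights, so that equivariance of coordinates becomes a
  statement about weight functions alone.\<close>

lemma (in finite_conj_class) pairing_act:
  fixes p :: "('g, 'k::field) tensor"
  assumes "g \<in> carrier G"
  shows "pairing C w (Lambda1_act G C g p) = pairing C (\<lambda>a. w (g \<otimes> a \<otimes> inv g)) p"
proof -
  have "pairing C w (basis_elt b) = (of_int (w b) :: 'k)" if "b \<in> C" for b
    using pairing_indicator_form[of C "{b}" w] finite_C that by (simp add: indicator_form_def)
  then have "pairing C w (Lambda1_act G C g p) = (\<Sum>a\<in>C. coeff1 p a * of_int (w (g \<otimes> a \<otimes> inv g)))"
    unfolding Lambda1_act_def pairing_sum pairing_scale
    using assms conj_C by (intro sum.cong refl) simp
  then show ?thesis by (simp add: pairing_def mult.commute)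
qed

text \<open>With m = \<open>card I\<close>, the matrix m\<delta> - 1 kills constant vectors and
  multiplies sum-zero vectors by m. Constant combinations of the forms are multiples of \<theta> by
  \<open>sum_v\<close>, so modulo \<theta> the pairings are a bijection onto sum-zero families.
  Geometrically the forms are the vertices of a regular simplex with its centre at \<theta>, up to
  scaling.\<close>

locale simplex_forms =
  fixes C :: "'g set" and I :: "'i set" and v :: "'i \<Rightarrow> ('g, 'k::field_char_0) tensor"
    and w :: "'i \<Rightarrow> 'g \<Rightarrow> int" and K r :: 'k
  assumes finite_I: "finite I" and I_ne: "I \<noteq> {}" and K: "K \<noteq> 0" and r: "r \<noteq> 0"
    and gram: "\<And>i j. i \<in> I \<Longrightarrow> j \<in> I \<Longrightarrow>
      pairing C (w i) (v j) = K * ((if i = j then of_nat (card I) else 0) - 1)"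
    and sum_v: "(\<Sum>j\<in>I. v j) = scale r (theta C)"
begin

lemma card_ne: "of_nat (card I) \<noteq> (0 :: 'k)"
  using finite_I I_ne by simp

lemma theta_span: "theta C \<in> span_k (v ` I)"
proof -
  have "theta C = scale (1 / r) (\<Sum>j\<in>I. v j)" using r by (simp add: sum_v)
  then show ?thesis
    unfolding span_k_def
    by (auto intro: tensor.span_scale tensor.span_sum[of I v] tensor.span_base)
qed

lemma pairing_combination:
  assumes "i \<in> I"
  shows "pairing C (w i) (\<Sum>j\<in>I. scale (c j) (v j)) = K * (of_nat (card I) * c i - sum c I)"
proof -
  have "pairing C (w i) (\<Sum>j\<in>I. scale (c j) (v j)) =
      (\<Sum>j\<in>I. c j * (K * ((if i = j then of_nat (card I) else 0) - 1)))"
    unfolding pairing_sum pairing_scale using assms by (intro sum.cong refl) (simp add: gram)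
  also have "\<dots> = (\<Sum>j\<in>I. (if i = j then K * of_nat (card I) * c j else 0) - K * c j)"
    by (intro sum.cong refl) (simp add: algebra_simps)
  also have "\<dots> = K * (of_nat (card I) * c i - sum c I)"
    using assms finite_I by (simp add: sum_subtractf algebra_simps sum_distrib_left)
  finally show ?thesis .
qed

lemma kernel:
  assumes "p \<in> span_k (v ` I)"
  shows "(\<forall>i\<in>I. pairing C (w i) p = 0) \<longleftrightarrow> p \<in> span_k {theta C}"
proof
  obtain c where p: "p = (\<Sum>j\<in>I. scale (c j) (v j))" using span_image_sum[OF finite_I assms] .
  \<comment> \<open>The mean of the coefficients; the vanishing of pairing \<open>i\<close> says
    exactly that \<open>c i\<close> equals it.\<close>
  define s where "s = sum c I / of_nat (card I)"
  assume zero: "\<forall>i\<in>I. pairing C (w i) p = 0"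
  have "c i = s" if "i \<in> I" for i
  proof -
    have "K * (of_nat (card I) * c i - sum c I) = 0"
      using bspec[OF zero that] unfolding p pairing_combination[OF that] .
    then have "of_nat (card I) * c i = sum c I" using K by simp
    then show ?thesis using card_ne by (simp add: s_def eq_divide_eq mult.commute)
  qed
  then have "p = (\<Sum>j\<in>I. scale s (v j))" unfolding p by (intro sum.cong refl) simp
  then have "p = scale (s * r) (theta C)" by (simp add: sum_v flip: tensor.scale_sum_right)
  then show "p \<in> span_k {theta C}" by (simp add: span_k_def tensor.span_scale tensor.span_base)
next
  assume "p \<in> span_k {theta C}"
  then obtain k where k: "p = scale k (theta C)" by (auto simp: span_k_def tensor.span_singleton)
  have "theta C = (\<Sum>j\<in>I. scale (1 / r) (v j))"
    using r by (simp add: sum_v flip: tensor.scale_sum_right)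
  then show "\<forall>i\<in>I. pairing C (w i) p = 0"
    unfolding k by (auto simp: pairing_scale pairing_combination card_ne)
qed

lemma kernel_diff:
  assumes "p \<in> span_k (v ` I)" "q \<in> span_k (v ` I)"
  shows "(\<forall>i\<in>I. pairing C (w i) p = pairing C (w i) q) \<longleftrightarrow> p - q \<in> span_k {theta C}"
proof -
  have "p - q \<in> span_k (v ` I)" using assms by (simp add: span_k_def tensor.span_diff)
  from kernel[OF this] show ?thesis by (simp add: pairing_diff)
qed

lemma sum_pairing:
  assumes "p \<in> span_k (v ` I)" shows "(\<Sum>i\<in>I. pairing C (w i) p) = 0"
proof -
  obtain c where p: "p = (\<Sum>j\<in>I. scale (c j) (v j))" using span_image_sum[OF finite_I assms] .
  show ?thesis by (simp add: p pairing_combination sum_subtractf flip: sum_distrib_left)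
qed

lemma onto:
  assumes "(\<Sum>i\<in>I. y i) = 0"
  obtains p where "p \<in> span_k (v ` I)" "\<And>i. i \<in> I \<Longrightarrow> pairing C (w i) p = y i"
proof
  \<comment> \<open>On sum-zero families the Gram matrix is multiplication by
    \<open>K * of_nat (card I)\<close>, hence the divisor.\<close>
  let ?p = "\<Sum>j\<in>I. scale (y j / (K * of_nat (card I))) (v j)"
  show "?p \<in> span_k (v ` I)"
    unfolding span_k_def by (intro tensor.span_sum tensor.span_scale tensor.span_base) simp
  show "pairing C (w i) ?p = y i" if "i \<in> I" for i
    using that assms K card_ne by (simp add: pairing_combination flip: sum_divide_distrib)
qed

end

section \<open>Sum-zero families on six points\<close>

text \<open>The six points are the projective line over Z/5 with \<open>None\<close> at infinity: a
  5-cycle will fix \<open>None\<close> and act on the rest as z + 1, so that arithmetic in the type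
  \<open>5\<close> keeps track of the positions.\<close>

definition ext6 :: "'k::field ^ 5 \<Rightarrow> 5 option \<Rightarrow> 'k" where
  "ext6 x i = (case i of None \<Rightarrow> - (\<Sum>j\<in>UNIV. x $ j) | Some z \<Rightarrow> x $ z)"

lemma mem_5: "(z :: 5) \<in> {0, 1, 2, 3, 4}"
proof (cases z rule: bit1_cases)
  case (of_int m)
  then have "m = 0 \<or> m = 1 \<or> m = 2 \<or> m = 3 \<or> m = 4" by simp presburger
  then show ?thesis using of_int by auto
qed

lemma pred_5: "0 - 1 = (4 :: 5)"
  unfolding diff_0 by simp

lemma pred_ring: "1 - 1 = (0 :: 'a::ring_1)" "2 - 1 = (1 :: 'a)" "3 - 1 = (2 :: 'a)" "4 - 1 = (3 :: 'a)"
  by simp_all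

lemma UNIV_5: "(UNIV :: 5 set) = {0, 1, 2, 3, 4}"
  using mem_5 by blast

lemma sum_5option: "(\<Sum>i\<in>UNIV. f (i :: 5 option)) = f None + (\<Sum>z\<in>UNIV. f (Some z))"
  unfolding UNIV_option_conv by (subst sum.insert) (auto simp: sum.reindex o_def)

lemma sum_ext6: "(\<Sum>i\<in>UNIV. ext6 x i) = 0"
  by (simp add: sum_5option ext6_def)

lemma ext6_eqI: "(\<And>i. ext6 x i = ext6 y i) \<Longrightarrow> x = y"
  unfolding vec_eq_iff by (auto simp: ext6_def dest: meta_spec[of _ "Some _"])

lemma ext6_restrict:
  assumes "(\<Sum>i\<in>UNIV. f i) = 0" shows "ext6 (\<chi> z. f (Some z)) i = f i"
  using assms by (cases i) (auto simp: ext6_def sum_5option add_eq_0_iff)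

text \<open>Families indexed by six points with sum zero are parametrised by the coordinates
  other than the one at \<open>None\<close>.\<close>

locale six_point_action =
  fixes \<pi> :: "(nat \<Rightarrow> nat) \<Rightarrow> 5 option \<Rightarrow> 5 option" and \<sigma> :: "(nat \<Rightarrow> nat) \<Rightarrow> int"
  assumes pi_one: "\<pi> id = id" and pi_mult: "\<And>g h. g \<in> carrier S5 \<Longrightarrow> h \<in> carrier S5 \<Longrightarrow> \<pi> (g \<circ> h) = \<pi> g \<circ> \<pi> h"
    and sig_one: "\<sigma> id = 1" and sig_mult: "\<And>g h. g \<in> carrier S5 \<Longrightarrow> h \<in> carrier S5 \<Longrightarrow> \<sigma> (g \<circ> h) = \<sigma> g * \<sigma> h"
begin

lemma S5_inv: "g \<in> carrier S5 \<Longrightarrow> inv\<^bsub>S5\<^esub> g \<in> carrier S5"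
  by (rule group.inv_closed[OF sym_group_is_group])

lemma S5_comp: "g \<in> carrier S5 \<Longrightarrow> h \<in> carrier S5 \<Longrightarrow> g \<circ> h \<in> carrier S5"
  using group.subgroup_self[OF sym_group_is_group] by (auto simp: sym_group_carrier permutes_compose)

lemma S5_inv_comp:
  assumes "g \<in> carrier S5" shows "inv\<^bsub>S5\<^esub> g \<circ> g = id" "g \<circ> inv\<^bsub>S5\<^esub> g = id"
  using group.l_inv[OF sym_group_is_group assms] group.r_inv[OF sym_group_is_group assms]
  by (simp_all add: sym_group_mult sym_group_one del: sym_group_inv_equality)

lemma pi_inv:
  assumes "g \<in> carrier S5" shows "\<pi> (inv\<^bsub>S5\<^esub> g) (\<pi> g i) = i" "\<pi> g (\<pi> (inv\<^bsub>S5\<^esub> g) i) = i"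
  using pi_mult[OF S5_inv[OF assms] assms] pi_mult[OF assms S5_inv[OF assms]]
  by (simp_all add: S5_inv_comp[OF assms] pi_one fun_eq_iff del: sym_group_inv_equality)

lemma bij_pi: assumes "g \<in> carrier S5" shows "bij (\<pi> g)"
  by (rule o_bij[of "\<pi> (inv\<^bsub>S5\<^esub> g)"]) (simp_all add: fun_eq_iff pi_inv[OF assms] del: sym_group_inv_equality)

lemma inv_comp:
  assumes "g \<in> carrier S5" "h \<in> carrier S5"
  shows "inv\<^bsub>S5\<^esub> (g \<circ> h) = inv\<^bsub>S5\<^esub> h \<circ> inv\<^bsub>S5\<^esub> g"
  using group.inv_mult_group[OF sym_group_is_group assms] by (simp add: sym_group_mult del: sym_group_inv_equality)

text \<open>The signed permutation action on sum-zero families, in the coordinates at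
  \<open>Some\<close>. A row whose source is \<open>None\<close> consists of -1 throughout (up to
  the sign), because the coordinate at \<open>None\<close> is minus the sum of the others.\<close>

definition rho :: "(nat \<Rightarrow> nat) \<Rightarrow> 'k::field_char_0 ^ 5 ^ 5" where
  "rho g = (\<chi> z j. of_int (\<sigma> g) * (case \<pi> (inv\<^bsub>S5\<^esub> g) (Some z) of None \<Rightarrow> - 1 | Some m \<Rightarrow> if m = j then 1 else 0))"

text \<open>In all six coordinates the action is a plain signed permutation; both the representation
  law and irreducibility are proved in this form.\<close>

lemma ext6_rho:
  fixes x :: "'k::field_char_0 ^ 5"
  assumes "g \<in> carrier S5"
  shows "ext6 (rho g *v x) i = of_int (\<sigma> g) * ext6 x (\<pi> (inv\<^bsub>S5\<^esub> g) i)"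
proof -
  have "rho g *v x = (\<chi> z. of_int (\<sigma> g) * ext6 x (\<pi> (inv\<^bsub>S5\<^esub> g) (Some z)))"
    by (simp add: vec_eq_iff matrix_vector_mult_def rho_def ext6_def mult.assoc split: option.split
      flip: sum_distrib_left) (auto simp: if_distrib if_distribR sum_negf cong: if_cong)
  also have "ext6 \<dots> i = of_int (\<sigma> g) * ext6 x (\<pi> (inv\<^bsub>S5\<^esub> g) i)"
  proof (rule ext6_restrict)
    have "(\<Sum>i\<in>UNIV. ext6 x (\<pi> (inv\<^bsub>S5\<^esub> g) i)) = (\<Sum>i\<in>UNIV. ext6 x i)"
      by (rule sum.reindex_bij_betw[OF bij_pi[OF S5_inv[OF assms]]])
    then show "(\<Sum>i\<in>UNIV. of_int (\<sigma> g) * ext6 x (\<pi> (inv\<^bsub>S5\<^esub> g) i)) = 0"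
      by (simp add: sum_ext6 flip: sum_distrib_left)
  qed
  finally show ?thesis .
qed

lemma matrix_rep_rho: "matrix_rep S5 (rho :: _ \<Rightarrow> 'k::field_char_0 ^ 5 ^ 5)"
  unfolding matrix_rep_def
proof (intro conjI ballI)
  have id: "id \<in> carrier S5" by (simp add: sym_group_carrier permutes_id)
  have inv_id: "inv\<^bsub>S5\<^esub> id = id"
    using monoid.inv_one[OF group.is_monoid[OF sym_group_is_group], of 5] by (simp add: sym_group_one del: sym_group_inv_equality)
  show "rho \<one>\<^bsub>S5\<^esub> = (mat 1 :: 'k ^ 5 ^ 5)"
    unfolding matrix_eq sym_group_one
    by (intro allI ext6_eqI) (simp add: ext6_rho[OF id] inv_id pi_one sig_one del: sym_group_inv_equality)
next
  fix g h assume gh: "g \<in> carrier S5" "h \<in> carrier S5"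
  have 1: "ext6 (rho (g \<circ> h) *v x) i = ext6 (rho g *v (rho h *v x)) i" for x :: "'k ^ 5" and i
    unfolding ext6_rho[OF gh(1)] ext6_rho[OF gh(2)] ext6_rho[OF S5_comp[OF gh]] inv_comp[OF gh]
      pi_mult[OF S5_inv[OF gh(2)] S5_inv[OF gh(1)]] by (simp add: sig_mult gh del: sym_group_inv_equality)
  show "rho (g \<otimes>\<^bsub>S5\<^esub> h) = rho g ** (rho h :: 'k ^ 5 ^ 5)"
    unfolding matrix_eq sym_group_mult
    by (intro allI ext6_eqI) (simp add: 1 flip: matrix_vector_mul_assoc)
qed

text \<open>Without fixed points, a diagonal entry can only come from a row whose source is
  \<open>None\<close>. As \<open>None\<close> itself is moved, there is exactly one such row, and it
  contributes -1 times the sign.\<close>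

lemma trace_rho:
  assumes t: "t \<in> carrier S5" and no_fix: "\<And>i. \<pi> t i \<noteq> i"
  shows "trace (rho t :: 'k::field_char_0 ^ 5 ^ 5) = of_int (- \<sigma> t)"
proof -
  obtain z0 where z0: "\<pi> t None = Some z0" using no_fix[of None] by auto
  have none: "\<pi> (inv\<^bsub>S5\<^esub> t) (Some z) = None \<longleftrightarrow> z = z0" for z
    using pi_inv[OF t] z0 by (metis option.inject)
  have fix_iff: "\<pi> (inv\<^bsub>S5\<^esub> t) (Some z) \<noteq> Some z" for z
    using pi_inv(2)[OF t, of "Some z"] no_fix[of "Some z"] by auto
  have "(rho t :: 'k ^ 5 ^ 5) $ z $ z = (if z = z0 then of_int (- \<sigma> t) else 0)" for z
    using none[of z] fix_iff[of z] by (auto simp: rho_def split: option.split)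
  then show ?thesis by (simp add: trace_def)
qed

lemma irreducible_rho:
  assumes trans: "\<And>i. \<exists>g\<in>carrier S5. \<pi> g None = i"
    and c: "c \<in> carrier S5" "\<pi> c None = None" "\<And>z. \<pi> c (Some z) = Some (z + 1)" "\<sigma> c = 1"
    and sig: "\<And>g. g \<in> carrier S5 \<Longrightarrow> \<sigma> g \<noteq> 0"
  shows "irreducible_matrix_rep S5 (rho :: _ \<Rightarrow> 'k::field_char_0 ^ 5 ^ 5)"
  unfolding irreducible_matrix_rep_def
proof (intro conjI matrix_rep_rho allI impI)
  fix U :: "('k ^ 5) set"
  assume U: "vec.subspace U \<and> (\<forall>g\<in>carrier S5. \<forall>x\<in>U. rho g *v x \<in> U)"
  then have sub: "vec.subspace U" and inv: "\<And>g x. g \<in> carrier S5 \<Longrightarrow> x \<in> U \<Longrightarrow> rho g *v x \<in> U" by auto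
  show "U = {0} \<or> U = UNIV"
  proof (cases "U \<subseteq> {0}")
    case True
    then show ?thesis using vec.subspace_0[OF sub] by auto
  next
    case False
    then obtain x where x: "x \<in> U" "x \<noteq> 0" by auto
    then obtain i where i: "ext6 x i \<noteq> 0"
      using ext6_eqI[of x 0] by (force simp: ext6_def split: option.splits)
    obtain g where g: "g \<in> carrier S5" "\<pi> g None = i" using trans by blast
    \<comment> \<open>Brings a nonzero coordinate to \<open>None\<close>, so that the other five
      coordinates of \<open>y\<close> have a nonzero sum.\<close>
    define y where "y = rho (inv\<^bsub>S5\<^esub> g) *v x"
    have y: "y \<in> U" unfolding y_def by (intro inv S5_inv g x)
    have "ext6 y None \<noteq> 0"
      using i sig[OF S5_inv[OF g(1)]] g
      by (simp add: y_def ext6_rho[OF S5_inv[OF g(1)]] group.inv_inv[OF sym_group_is_group] del: sym_group_inv_equality)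
    then have s: "(\<Sum>j\<in>UNIV. y $ j) \<noteq> 0" by (simp add: ext6_def)
    have pic: "\<pi> (inv\<^bsub>S5\<^esub> c) (Some z) = Some (z - 1)" for z
      using pi_inv(1)[OF c(1), of "Some (z - 1)"] c(3)[of "z - 1"] by simp
    have step: "(rho c *v u) $ z = u $ (z - 1)" for u :: "'k ^ 5" and z
      using ext6_rho[OF c(1), of u "Some z"] unfolding pic by (simp add: ext6_def c(4))
    \<comment> \<open>Under five successive shifts every position meets each of the five coordinates
      once, so \<open>u\<close> is constant with value their sum.\<close>
    define u where "u = (\<Sum>k<5. ((\<lambda>u. rho c *v u) ^^ k) y)"
    have pow: "((\<lambda>u. rho c *v u) ^^ k) y \<in> U" for k
      by (induction k) (simp_all add: y inv c)
    then have uU: "u \<in> U" unfolding u_def by (intro vec.subspace_sum[OF sub])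
    have "u $ z = (\<Sum>j\<in>UNIV. y $ j)" for z
    proof -
      have u: "u $ z = y $ z + y $ (z - 1) + y $ (z - 1 - 1) + y $ (z - 1 - 1 - 1) + y $ (z - 1 - 1 - 1 - 1)"
        by (simp add: u_def step numeral_eq_Suc)
      have sum: "(\<Sum>j\<in>UNIV. y $ j) = y $ 0 + y $ 1 + y $ 2 + y $ 3 + y $ 4"
        unfolding UNIV_5 by simp
      have "z = 0 \<or> z = 1 \<or> z = 2 \<or> z = 3 \<or> z = 4" using mem_5[of z] by simp
      then show ?thesis
        unfolding u sum by (elim disjE) (simp_all only: pred_5 pred_ring, simp_all only: add_ac)
    qed
    then have "u = (\<Sum>j\<in>UNIV. y $ j) *s 1" by (simp add: vec_eq_iff)
    then have "1 = (1 / (\<Sum>j\<in>UNIV. y $ j)) *s u" using s by (simp add: vec_eq_iff)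
    then have one: "1 \<in> U" by (rule ssubst) (rule vec.subspace_scale[OF sub uU])
    have axis: "axis j 1 \<in> U" for j
    proof -
      obtain h where h: "h \<in> carrier S5" "\<pi> h None = Some j" using trans by blast
      let ?v = "rho h *v 1"
      have v: "?v \<in> U" by (intro inv h one)
      \<comment> \<open>The vector \<open>1\<close> has -5 at \<open>None\<close>. The element
        \<open>h\<close> takes that coordinate to \<open>j\<close>, up to sign, and 1 - (-5) = 6
        then isolates the \<open>j\<close>-th axis; 6 is invertible in characteristic zero.\<close>
      have eq: "?v $ z = of_int (\<sigma> h) * (1 - (if z = j then 6 else 0))" for z
      proof -
        have "\<pi> (inv\<^bsub>S5\<^esub> h) (Some z) = None \<longleftrightarrow> z = j" using pi_inv[OF h(1)] h(2) by (metis option.inject)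
        then show ?thesis using ext6_rho[OF h(1), of 1 "Some z"] by (auto simp: ext6_def split: option.splits)
      qed
      have nz: "of_int (\<sigma> h) \<noteq> (0 :: 'k)" using sig[OF h(1)] by simp
      have "axis j 1 = (1 / 6) *s (1 - (1 / of_int (\<sigma> h)) *s ?v)"
        using nz by (auto simp: vec_eq_iff eq axis_def)
      also have "\<dots> \<in> U" using v one by (intro vec.subspace_scale[OF sub] vec.subspace_diff[OF sub])
      finally show ?thesis .
    qed
    have "x \<in> U" for x
    proof -
      have "x = (\<Sum>j\<in>UNIV. (x $ j) *s axis j 1)" by (simp add: basis_expansion)
      also have "\<dots> \<in> U" by (intro vec.subspace_sum[OF sub] vec.subspace_scale[OF sub] axis)
      finally show ?thesis .
    qed
    then show ?thesis by auto
  qed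
qed

end

section \<open>The six Sylow 5-subgroups\<close>

text \<open>Generators of the six Sylow 5-subgroups; the first one permutes the other five cyclically.\<close>

definition sylows :: "perm5 list" where
  "sylows = (let c = cyc5 [[L1, L2, L3, L4, L5]]; d = cyc5 [[L2, L3, L1, L4, L5]] in
     [c, d, conj5 c d, conj5 c (conj5 c d), conj5 c (conj5 c (conj5 c d)), conj5 c (conj5 c (conj5 c (conj5 c d)))])"

text \<open>\<open>a\<close> inverts \<open>c\<close>. Among double transpositions this selects the
  five reflections of the dihedral group around \<open>c\<close>.\<close>

definition dihedral :: "perm5 \<Rightarrow> perm5 \<Rightarrow> bool" where
  "dihedral c a \<longleftrightarrow> mul5 (conj5 a c) c = tabulate (\<lambda>l. l)"

text \<open>\<open>a\<close> acts on the cyclic group generated by \<open>c\<close> by one of its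
  two automorphisms of order four.\<close>

definition frobenius :: "perm5 \<Rightarrow> perm5 \<Rightarrow> bool" where
  "frobenius c a \<longleftrightarrow> conj5 a c = mul5 c c \<or> conj5 a c = mul5 c (mul5 c c)"

text \<open>For \<open>a\<close> = (xyz)(ij) the letters that return after two steps are i and j, so
  the condition says that {i, j} is a side of the pentagon traced by \<open>c\<close>. The
  generators in \<open>sylows\<close> all lie in one A_5-class; hence an odd permutation takes the
  sides of one chosen pentagon to the diagonals of another, which is the -1 in
  \<open>pentagon_six\<close>.\<close>

definition pentagon_edge :: "perm5 \<Rightarrow> perm5 \<Rightarrow> bool" where
  "pentagon_edge c a \<longleftrightarrow> list_ex (\<lambda>l. app a (app a l) = l \<and> app c l = app a l) letters"

definition hexad :: "(perm5 \<Rightarrow> perm5 \<Rightarrow> bool) \<Rightarrow> perm5 \<Rightarrow> perm5 list list" where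
  "hexad sel r = (let C = class5 r in map (\<lambda>c. filter (sel c) C) sylows)"

text \<open>A pair \<open>\<alpha>\<close> of integers lists the values of a weight on a set and on its complement.\<close>

definition weight :: "int \<times> int \<Rightarrow> perm5 list \<Rightarrow> perm5 \<Rightarrow> int" where
  "weight \<alpha> S a = (if List.member S a then fst \<alpha> else snd \<alpha>)"

definition carries :: "perm5 list \<Rightarrow> int \<times> int \<Rightarrow> int \<Rightarrow> perm5 \<Rightarrow> perm5 list \<Rightarrow> perm5 list \<Rightarrow> bool" where
  "carries C \<alpha> s g S S' \<longleftrightarrow> list_all (\<lambda>a. weight \<alpha> S a = s * weight \<alpha> S' (conj5 g a)) C"

text \<open>Squares have trivial sign, so transitivity and the cyclic shift can be stated without the
  sign \<open>s\<close>, which is the one picked up under a transposition.\<close>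

definition six_ok :: "perm5 list \<Rightarrow> int \<times> int \<Rightarrow> int \<Rightarrow> perm5 list list \<Rightarrow> bool" where
  "six_ok C \<alpha> s Q \<longleftrightarrow> length Q = 6 \<and> distinct Q \<and>
     list_all (\<lambda>a. list_all (\<lambda>b. a = b \<or> list_all (\<lambda>S. list_ex (carries C \<alpha> s (tr5 a b) S) Q) Q) letters) letters \<and>
     list_all (\<lambda>S. list_ex (\<lambda>x. carries C \<alpha> 1 (mul5 x x) (hd Q) S) all_perms) Q \<and>
     list_all2 (carries C \<alpha> 1 (let x = cyc5 [[L1, L4, L2, L5, L3]] in mul5 x x)) Q
       [Q ! 0, Q ! 2, Q ! 3, Q ! 4, Q ! 5, Q ! 1] \<and>
     list_all (\<lambda>S. \<not> carries C \<alpha> s (tr5 L1 L2) S S) Q"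

definition weight_sum :: "int \<times> int \<Rightarrow> perm5 list \<Rightarrow> perm5 list \<Rightarrow> int" where
  "weight_sum \<alpha> S l = sum_list (map (weight \<alpha> S) l)"

definition gram_ok :: "int \<times> int \<Rightarrow> perm5 list list \<Rightarrow> int \<Rightarrow> bool" where
  "gram_ok \<alpha> Q K \<longleftrightarrow> list_all (\<lambda>S. list_all (\<lambda>S'.
     weight_sum \<alpha> S S' = K * ((if S = S' then int (length Q) else 0) - 1)) Q) Q"

text \<open>Supplies the assumption \<open>sum_v\<close> of \<open>simplex_forms\<close>: if every
  class element lies in \<open>R\<close> of the sets, their indicator forms add up to
  \<open>R\<close> times \<theta>.\<close>

definition covers :: "perm5 list \<Rightarrow> perm5 list list \<Rightarrow> nat \<Rightarrow> bool" where
  "covers C Q R \<longleftrightarrow> list_all (\<lambda>a. length (filter (\<lambda>S. List.member S a) Q) = R) C"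

text \<open>For an element of order six the square is a 3-cycle, so the letters fixed by the square
  are those of the 2-cycle.\<close>

definition in_two_cycle :: "perm5 \<Rightarrow> letter \<Rightarrow> perm5 list" where
  "in_two_cycle r l = filter (\<lambda>a. app a (app a l) = l) (class5 r)"

text \<open>The integer combination equal to \<open>1200\<close> times the identity is the decomposition of the
  permutation module on 2-cycles into its trivial, standard and five-dimensional parts, cleared of
  denominators.\<close>

definition form_matrix_ok :: "perm5 list list \<Rightarrow> perm5 list list \<Rightarrow> perm5 list list \<Rightarrow> bool" where
  "form_matrix_ok P Q E \<longleftrightarrow>
     list_all (\<lambda>e. sum_list (map (\<lambda>S. weight_sum (3, -2) S e) P) = 0) E \<and>
     list_all (\<lambda>e. sum_list (map (\<lambda>S. weight_sum (1, -1) S e) Q) = 0) E \<and>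
     list_all (\<lambda>S. sum_list (map (weight_sum (3, -2) S) E) = 0) P \<and>
     list_all (\<lambda>S. sum_list (map (weight_sum (1, -1) S) E) = 0) Q \<and>
     list_all (\<lambda>e. list_all (\<lambda>e'.
       4 * sum_list (map (\<lambda>S. weight_sum (3, -2) S e * weight_sum (3, -2) S e') P)
       + 25 * sum_list (map (\<lambda>S. weight_sum (1, -1) S e * weight_sum (1, -1) S e') Q) + 120
       = (if e = e' then 1200 else 0)) E) E \<and>
     list_all (\<lambda>S. list_all (\<lambda>S'.
       sum_list (map (\<lambda>e. weight_sum (3, -2) S e * weight_sum (3, -2) S' e) E)
       = (if S = S' then 300 else 0) - 60) P) P \<and>
     list_all (\<lambda>S. list_all (\<lambda>S'.
       sum_list (map (\<lambda>e. weight_sum (1, -1) S e * weight_sum (1, -1) S' e) E)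
       = (if S = S' then 48 else 0) - 8) Q) Q \<and>
     list_all (\<lambda>S. list_all (\<lambda>S'.
       sum_list (map (\<lambda>e. weight_sum (3, -2) S e * weight_sum (1, -1) S' e) E) = 0) Q) P"

text \<open>Origin of the constants: a letter is fixed by 6 of the 10 transpositions, and 6 * 2 = 4
  * 3 makes the weight sum to 0 over the class. The diagonal Gram entry 6 * 2 must equal K (m - 1)
  with m = 5, so K = 3; the 3 in \<open>covers\<close> counts the letters fixed by a transposition.
  The later constants of \<open>gram_ok\<close> and \<open>covers\<close> arise in the same
  way.\<close>

lemma transposition_fixing_code:
  "let r = cyc5 [[L1,L2]]; Q = map (fixing r) letters in
     distinct Q \<and> covers (class5 r) Q 3 \<and> gram_ok (2, -3) Q 3"
  by code_simp

lemma three_cycle_fixing_code: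
  "let r = cyc5 [[L1,L2,L3]]; Q = map (fixing r) letters in
     distinct Q \<and> covers (class5 r) Q 2 \<and> gram_ok (3, -2) Q 6"
  by code_simp

lemma parity_code:
  "let r = cyc5 [[L1,L2,L3,L4,L5]]; Q = map (sublist_of (class5 r))
       [map cycle_code (filter even5 all_perms), map cycle_code (filter (\<lambda>p. \<not> even5 p) all_perms)] in
     distinct Q \<and> covers (class5 r) Q 1 \<and> gram_ok (1, -1) Q 12"
  by code_simp

lemma dihedral_code:
  "let r = cyc5 [[L1,L2],[L3,L4]]; Q = hexad dihedral r in
     set Q = set (strata r 5) \<and> covers (class5 r) Q 2 \<and> gram_ok (2, -1) Q 2"
  by code_simp

lemma dihedral_six: "six_ok (class5 (cyc5 [[L1,L2],[L3,L4]])) (2, -1) 1 (hexad dihedral (cyc5 [[L1,L2],[L3,L4]]))"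
  by code_simp

lemma frobenius_code:
  "let r = cyc5 [[L1,L2,L3,L4]]; Q = hexad frobenius r in
     set Q = set (strata r 10) \<and> covers (class5 r) Q 2 \<and> gram_ok (2, -1) Q 4"
  by code_simp

lemma frobenius_six: "six_ok (class5 (cyc5 [[L1,L2,L3,L4]])) (2, -1) 1 (hexad frobenius (cyc5 [[L1,L2,L3,L4]]))"
  by code_simp

lemma pentagon_six:
  "six_ok (class5 (cyc5 [[L1,L2,L3],[L4,L5]])) (1, -1) (-1) (hexad pentagon_edge (cyc5 [[L1,L2,L3],[L4,L5]]))"
  by code_simp

lemma pentagon_code:
  "let r = cyc5 [[L1,L2,L3],[L4,L5]]; P = map (in_two_cycle r) letters; Q = hexad pentagon_edge r; E = strata r 2 in
     distinct P \<and> covers (class5 r) E 1 \<and> form_matrix_ok P Q E"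
  by code_simp

section \<open>The standard representation\<close>

definition weight_fun :: "int \<times> int \<Rightarrow> perm5 list \<Rightarrow> (nat \<Rightarrow> nat) \<Rightarrow> int" where
  "weight_fun \<alpha> S a = (if a \<in> perm_of ` set S then fst \<alpha> else snd \<alpha>)"

lemma weight_fun_perm_of: "weight_fun \<alpha> S (perm_of a) = weight \<alpha> S a"
  by (simp add: weight_fun_def weight_def inj_image_mem_iff[OF inj_perm_of])

abbreviation form_of :: "perm5 list \<Rightarrow> (nat \<Rightarrow> nat, 'k::field) tensor" where
  "form_of S \<equiv> indicator_form (perm_of ` set S)"

lemma pairing_form_of:
  assumes "r \<in> set all_perms" "set l \<subseteq> set (class5 r)" "distinct l"
  shows "pairing (class5_of r) (weight_fun \<alpha> S) (form_of l) = of_int (weight_sum \<alpha> S l)"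
proof -
  have "pairing (class5_of r) (weight_fun \<alpha> S) (form_of l) = of_int (\<Sum>a\<in>perm_of ` set l. weight_fun \<alpha> S a)"
    using assms by (intro pairing_indicator_form) (auto simp: conj_class_code)
  also have "(\<Sum>a\<in>perm_of ` set l. weight_fun \<alpha> S a) = (\<Sum>a\<in>set l. weight \<alpha> S a)"
    by (subst sum.reindex) (auto simp: weight_fun_perm_of intro: inj_on_subset[OF inj_perm_of])
  finally show ?thesis by (simp add: assms weight_sum_def sum_list_distinct_conv_sum_set)
qed

lemma subspace_Lambda1: "tensor.subspace (Lambda1 C :: ('g, 'k::field) tensor set)"
proof -
  have "Lambda1 C = {p :: ('g, 'k) tensor. \<forall>u. u \<notin> {[a] | a. a \<in> C} \<longrightarrow> Poly_Mapping.lookup p u = 0}"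
    unfolding Lambda1_def subset_iff in_keys_iff by blast
  then show ?thesis by (intro tensor.subspaceI) (simp_all add: lookup_scale lookup_add)
qed

lemma sum_form_of:
  assumes r: "r \<in> set all_perms" and Q: "\<And>S. S \<in> set Q \<Longrightarrow> set S \<subseteq> set (class5 r)" "distinct Q"
    and cov: "covers (class5 r) Q R"
  shows "(\<Sum>S\<in>set Q. form_of S) = scale (of_nat R) (theta (class5_of r) :: (_, 'k::field) tensor)"
proof -
  let ?C = "class5_of r"
  interpret finite_conj_class S5 ?C using r by (intro finite_conj_class_S5 perm_of_carrier)
  have C: "?C = perm_of ` set (class5 r)" by (rule conj_class_code[OF r])
  have 1: "(\<Sum>S\<in>set Q. form_of S) \<in> (Lambda1 ?C :: (_, 'k) tensor set)"
      "scale (of_nat R) (theta ?C) \<in> (Lambda1 ?C :: (_, 'k) tensor set)"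
    using Q(1) unfolding theta_indicator
    by (auto intro!: tensor.subspace_sum[OF subspace_Lambda1] tensor.subspace_scale[OF subspace_Lambda1]
      indicator_form_Lambda1 simp: C)
  show ?thesis
  proof (rule Lambda1_eqI[OF 1])
    fix b assume "b \<in> ?C"
    then obtain a where a: "a \<in> set (class5 r)" "b = perm_of a" by (auto simp: C)
    have "coeff1 (\<Sum>S\<in>set Q. form_of S) b = (\<Sum>S\<in>set Q. if a \<in> set S then 1 else (0 :: 'k))"
      by (simp add: coeff1_sum coeff1_indicator_form a(2) inj_image_mem_iff[OF inj_perm_of])
    also have "\<dots> = of_nat (card {S \<in> set Q. a \<in> set S})"
      by (simp add: sum.If_cases Int_def)
    also have "card {S \<in> set Q. a \<in> set S} = length (filter (\<lambda>S. List.member S a) Q)"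
      using distinct_card[OF distinct_filter[OF Q(2)], of "\<lambda>S. List.member S a"] by simp
    also have "\<dots> = R" using cov a(1) by (simp add: covers_def list_all_iff)
    finally show "coeff1 (\<Sum>S\<in>set Q. form_of S) b = coeff1 (scale (of_nat R) (theta ?C) :: (_, 'k) tensor) b"
      using \<open>b \<in> ?C\<close> finite_C by (simp add: coeff1_scale theta_indicator coeff1_indicator_form)
  qed
qed

lemma stratum_member:
  assumes "S \<in> set (strata r n)" shows "set S \<subseteq> set (class5 r)" "distinct S" "sublist_of (class5 r) S = S"
  using assms subrack_sub subracks_normal by (auto simp: strata_def)

lemma simplex_code:
  assumes r: "r \<in> set all_perms" and Q: "set Q = set (strata r n)" "distinct Q" "Q \<noteq> []"
    and cov: "covers (class5 r) Q R" "R > 0" and gram: "gram_ok \<alpha> Q K" "K \<noteq> 0"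
  shows "simplex_forms (class5_of r) (set Q) (form_of :: _ \<Rightarrow> (_, 'k::field_char_0) tensor)
    (weight_fun \<alpha>) (of_int K) (of_nat R)"
proof
  show "set Q \<noteq> {}" "of_int K \<noteq> (0 :: 'k)" "of_nat R \<noteq> (0 :: 'k)" using Q cov gram by auto
  show "(\<Sum>S\<in>set Q. form_of S) = scale (of_nat R) (theta (class5_of r) :: (_, 'k) tensor)"
    using r Q cov stratum_member by (intro sum_form_of) auto
  fix S S' assume S: "S \<in> set Q" "S' \<in> set Q"
  have "weight_sum \<alpha> S S' = K * ((if S = S' then int (length Q) else 0) - 1)"
    using gram(1) S by (auto simp: gram_ok_def list_all_iff)
  then show "pairing (class5_of r) (weight_fun \<alpha> S) (form_of S') =
      (of_int K :: 'k) * ((if S = S' then of_nat (card (set Q)) else 0) - 1)"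
    using pairing_form_of[OF r, of S' \<alpha> S] stratum_member[of S' r n] S Q(1)
    unfolding distinct_card[OF Q(2)] by auto
qed simp

lemma sum_range_num_of: "(\<Sum>i=1..5. f i) = (\<Sum>l\<in>UNIV. f (num_of l))"
  unfolding range_num_of[symmetric] by (simp add: sum.reindex[OF inj_num_of] o_def)

text \<open>The value 0 outside \<open>{1..5}\<close> is what the carrier of \<open>fund_rep\<close>
  prescribes.\<close>

definition fund_coords :: "(nat \<Rightarrow> nat) set \<Rightarrow> (nat \<Rightarrow> (nat \<Rightarrow> nat) \<Rightarrow> int) \<Rightarrow>
    (nat \<Rightarrow> nat, 'k::field) tensor \<Rightarrow> nat \<Rightarrow> 'k" where
  "fund_coords C w p = (\<lambda>i. if i \<in> {1..5} then pairing C (w i) p else 0)"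

lemma fund_coords_add: "fund_coords C w (p + q) = fund_coords C w p \<oplus>\<^bsub>fund_rep\<^esub> fund_coords C w q"
  by (auto simp: fund_coords_def fund_rep_def mk_rep_def pairing_add)

lemma fund_coords_scale: "fund_coords C w (scale c p) = c \<odot>\<^bsub>fund_rep\<^esub> fund_coords C w p"
  by (auto simp: fund_coords_def fund_rep_def mk_rep_def pairing_scale)

lemma fund_coords_num_of: "fund_coords C w p (num_of l) = pairing C (w (num_of l)) p"
  unfolding fund_coords_def using num_of_range by simp

lemma fund_coords_eq_iff:
  assumes "\<And>i. i \<notin> {1..5} \<Longrightarrow> f i = 0"
  shows "fund_coords C w p = f \<longleftrightarrow> (\<forall>l. pairing C (w (num_of l)) p = f (num_of l))"
proof
  assume "fund_coords C w p = f"
  then show "\<forall>l. pairing C (w (num_of l)) p = f (num_of l)" unfolding fund_coords_num_of[symmetric] by simp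
next
  assume eq: "\<forall>l. pairing C (w (num_of l)) p = f (num_of l)"
  show "fund_coords C w p = f"
  proof
    fix i show "fund_coords C w p i = f i"
    proof (cases "i \<in> {1..5}")
      case True
      then obtain l where "i = num_of l" by (rule num_of_cases)
      then show ?thesis using eq by (simp add: fund_coords_num_of)
    next
      case False
      then show ?thesis using assms[OF False] by (simp only: fund_coords_def if_False)
    qed
  qed
qed

lemma fund_coords_eq_coords_iff:
  "fund_coords C w p = fund_coords C w q \<longleftrightarrow> (\<forall>l. pairing C (w (num_of l)) p = pairing C (w (num_of l)) q)"
proof -
  have "fund_coords C w q i = 0" if "i \<notin> {1..5}" for i
    using that by (simp only: fund_coords_def if_False)
  from fund_coords_eq_iff[OF this, where C = C and w = w and p = p] show ?thesis by (simp add: fund_coords_num_of)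
qed

lemma fund_coords_carrier:
  "fund_coords C w p \<in> carrier fund_rep \<longleftrightarrow> (\<Sum>l\<in>UNIV. pairing C (w (num_of l)) p) = 0"
proof -
  have "\<forall>i. i \<notin> {1..5} \<longrightarrow> fund_coords C w p i = 0" unfolding fund_coords_def by simp
  then have "fund_coords C w p \<in> carrier fund_rep \<longleftrightarrow> (\<Sum>i=1..5. fund_coords C w p i) = 0"
    unfolding fund_rep_def mk_rep_def partial_object.simps mem_Collect_eq by blast
  then show ?thesis unfolding sum_range_num_of fund_coords_num_of .
qed

text \<open>An intrinsic form of the weights labelled by letters, for which equivariance under
  conjugation is visible: \<open>m = 1\<close> tests whether \<open>i\<close> is fixed, and
  \<open>m = 2\<close>, on elements of order six, whether \<open>i\<close> lies in the
  2-cycle.\<close>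

definition point_weight :: "nat \<Rightarrow> int \<times> int \<Rightarrow> nat \<Rightarrow> (nat \<Rightarrow> nat) \<Rightarrow> int" where
  "point_weight m \<alpha> i a = (if (a ^^ m) i = i then fst \<alpha> else snd \<alpha>)"

lemma point_weight_conj:
  assumes g: "g \<in> carrier S5"
  shows "point_weight m \<alpha> i (conj_by g a) = point_weight m \<alpha> ((inv\<^bsub>S5\<^esub> g) i) a"
proof -
  have bij: "bij g" using g by (auto simp: sym_group_carrier permutes_bij)
  have "((g \<circ> a \<circ> inv' g) ^^ m) j = g ((a ^^ m) (inv' g j))" for j
    using bij by (induction m arbitrary: j) (simp_all add: bij_is_inj bij_is_surj surj_f_inv_f)
  moreover have "g ((a ^^ m) (inv' g i)) = i \<longleftrightarrow> (a ^^ m) (inv' g i) = inv' g i"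
    using bij by (metis bij_inv_eq_iff)
  ultimately show ?thesis using g by (simp add: point_weight_def mult_S5)
qed

lemma fund_coords_act:
  assumes fc: "finite_conj_class S5 C" and g: "g \<in> carrier S5"
  shows "fund_coords C (point_weight m \<alpha>) (Lambda1_act S5 C g x) =
    act fund_rep g (fund_coords C (point_weight m \<alpha>) x)"
proof
  fix i
  have perm: "inv\<^bsub>S5\<^esub> g permutes {1..5}" using S5.inv_closed[OF g] by (simp only: sym_group_carrier)
  have "pairing C (point_weight m \<alpha> i) (Lambda1_act S5 C g x) = pairing C (point_weight m \<alpha> ((inv\<^bsub>S5\<^esub> g) i)) x"
    unfolding finite_conj_class.pairing_act[OF fc g] point_weight_conj[OF g] ..
  moreover have "(inv\<^bsub>S5\<^esub> g) i \<in> {1..5} \<longleftrightarrow> i \<in> {1..5}" by (rule permutes_in_image[OF perm])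
  ultimately show "fund_coords C (point_weight m \<alpha>) (Lambda1_act S5 C g x) i =
      act fund_rep g (fund_coords C (point_weight m \<alpha>) x) i"
    by (simp only: fund_coords_def fund_rep_def mk_rep_def rep.simps)
qed

text \<open>The submaximal forms are labelled by the letter that their elements fix, and
  \<open>S5\<close> acts on these labels in the natural way. Sum-zero families on the five letters
  are the standard representation.\<close>

lemma fund_iso:
  fixes \<alpha> :: "int \<times> int"
  assumes r: "r \<in> set all_perms" and Q: "set (map (fixing r) letters) = set (strata r n)" "distinct (map (fixing r) letters)"
    and cov: "covers (class5 r) (map (fixing r) letters) R" "R > 0"
    and gram: "gram_ok \<alpha> (map (fixing r) letters) K" "K \<noteq> 0"
  shows "theta (class5_of r) \<in> span_k (flat_stratum S5 (class5_of r) n :: (_, 'k::field_char_0) tensor set)"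
    and "rep_iso S5 (stratum_rep S5 (class5_of r) n :: ('k, _, _) rep) fund_rep"
proof -
  let ?C = "class5_of r" and ?Q = "map (fixing r) letters"
  interpret finite_conj_class S5 ?C using r by (intro finite_conj_class_S5 perm_of_carrier)
  interpret S: simplex_forms ?C "set ?Q" "form_of :: _ \<Rightarrow> (_, 'k) tensor" "weight_fun \<alpha>" "of_int K" "of_nat R"
    by (rule simplex_code[OF r Q _ cov gram]) (simp add: letters_def)
  have F: "flat_stratum S5 ?C n = (form_of ` set ?Q :: (_, 'k) tensor set)"
    unfolding flat_stratum_code(1)[OF r] Q ..
  show th: "theta ?C \<in> span_k (flat_stratum S5 ?C n :: (_, 'k) tensor set)"
    unfolding F by (rule S.theta_span)
  have w: "pairing ?C (point_weight 1 \<alpha> (num_of l)) p = pairing ?C (weight_fun \<alpha> (fixing r l)) p" for l and p :: "(_, 'k) tensor"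
    by (intro pairing_cong)
      (auto simp: conj_class_code[OF r] weight_fun_perm_of weight_def fixing_def point_weight_def)
  have inj: "inj (fixing r)" using Q(2) by (simp add: distinct_map set_letters)
  have letters: "set ?Q = range (fixing r)" by (simp add: set_letters)
  let ?T = "fund_coords ?C (point_weight 1 \<alpha>) :: (_, 'k) tensor \<Rightarrow> _"
  show "rep_iso S5 (stratum_rep S5 ?C n :: ('k, _, _) rep) fund_rep"
  proof (rule stratum_rep_iso[where T = ?T, OF th fund_coords_add fund_coords_scale])
    fix x y :: "(_, 'k) tensor"
    assume "x \<in> span_k (flat_stratum S5 ?C n)" "y \<in> span_k (flat_stratum S5 ?C n)"
    then show "?T x = ?T y \<longleftrightarrow> x - y \<in> span_k {theta ?C}"
      using S.kernel_diff unfolding F letters fund_coords_eq_coords_iff w by simp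
  next
    show "?T ` span_k (flat_stratum S5 ?C n) = carrier fund_rep"
    proof (intro equalityI subsetI)
      fix f assume "f \<in> ?T ` span_k (flat_stratum S5 ?C n)"
      then obtain p where p: "f = ?T p" "p \<in> span_k (form_of ` set ?Q)" unfolding F by auto
      have "(\<Sum>l\<in>UNIV. pairing ?C (weight_fun \<alpha> (fixing r l)) p) = 0"
        using S.sum_pairing[OF p(2)] unfolding letters by (simp add: sum.reindex[OF inj])
      then show "f \<in> carrier fund_rep" by (simp only: p(1) fund_coords_carrier w)
    next
      fix f :: "nat \<Rightarrow> 'k" assume f: "f \<in> carrier fund_rep"
      have "(\<Sum>S\<in>set ?Q. f (num_of (inv_into UNIV (fixing r) S))) = (\<Sum>i=1..5. f i)"
        unfolding letters sum_range_num_of by (simp add: sum.reindex[OF inj] inv_f_f[OF inj])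
      also have "\<dots> = 0" using f by (simp add: fund_rep_def mk_rep_def)
      finally obtain p where p: "p \<in> span_k (form_of ` set ?Q)"
        "\<And>S. S \<in> set ?Q \<Longrightarrow> pairing ?C (weight_fun \<alpha> S) p = f (num_of (inv_into UNIV (fixing r) S))"
        by (rule S.onto) blast
      have "f i = 0" if "i \<notin> {1..5}" for i using f that by (simp add: fund_rep_def mk_rep_def)
      moreover have "pairing ?C (weight_fun \<alpha> (fixing r l)) p = f (num_of l)" for l
        using p(2)[of "fixing r l"] by (simp add: set_letters inv_f_f[OF inj])
      ultimately have "?T p = f" by (subst fund_coords_eq_iff) (simp_all only: w simp_thms)
      then show "f \<in> ?T ` span_k (flat_stratum S5 ?C n)" using p(1) unfolding F by blast
    qed
  next
    fix g and x :: "(_, 'k) tensor" assume "g \<in> carrier S5"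
    then show "?T (Lambda1_act S5 ?C g x) = act fund_rep g (?T x)"
      by (rule fund_coords_act[OF finite_conj_class_axioms])
  qed
qed

section \<open>Hexads of weights\<close>

text \<open>Positions in the order of \<open>sylows\<close>: the head is the subgroup normalised by
  the chosen 5-cycle and sits at \<open>None\<close>; the others follow in the order in which that
  cycle permutes them.\<close>

definition pos6 :: "5 option \<Rightarrow> nat" where
  "pos6 i = (case i of None \<Rightarrow> 0 | Some z \<Rightarrow>
     if z = 0 then 1 else if z = 1 then 2 else if z = 2 then 3 else if z = 3 then 4 else 5)"

lemma exhaust_5: "(z :: 5) = 0 \<or> z = 1 \<or> z = 2 \<or> z = 3 \<or> z = 4"
  using mem_5[of z] by simp

lemma pos6_simps [simp]: "pos6 None = 0" "pos6 (Some 0) = 1" "pos6 (Some 1) = 2" "pos6 (Some 2) = 3"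
  "pos6 (Some 3) = 4" "pos6 (Some 4) = 5"
  by (simp_all add: pos6_def)

lemma all_6: "(\<forall>i. P i) \<longleftrightarrow> P None \<and> P (Some 0) \<and> P (Some 1) \<and> P (Some 2) \<and> P (Some 3) \<and> P (Some (4 :: 5))"
proof -
  have "P i" if "P None" "P (Some 0)" "P (Some 1)" "P (Some 2)" "P (Some 3)" "P (Some 4)" for i :: "5 option"
    using that exhaust_5 by (cases i) metis+
  then show ?thesis by blast
qed

lemma pos6_less: "pos6 i < 6"
proof -
  have "\<forall>i. pos6 i < 6" unfolding all_6 by simp
  then show ?thesis ..
qed

lemma ex_pos6: "k < 6 \<Longrightarrow> \<exists>i. k = pos6 i"
proof -
  assume "k < 6"
  then consider "k = 0" | "k = 1" | "k = 2" | "k = 3" | "k = 4" | "k = 5" by linarith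
  then show ?thesis
    by cases (metis pos6_simps)+
qed

lemma inj_pos6: "inj pos6"
proof -
  have "\<forall>i j. pos6 i = pos6 j \<longrightarrow> i = j" unfolding all_6 by simp
  then show ?thesis by (auto intro: injI)
qed

text \<open>The action on the six points is read off the weights: \<open>g\<close> takes
  \<open>i\<close> to the \<open>j\<close> whose weight, after conjugation by \<open>g\<close> and
  up to sign, is the weight of \<open>i\<close>. Targets under transpositions come from
  \<open>six_ok\<close>, all others by composition; uniqueness holds because a weight with two
  distinct values determines its set.\<close>

locale six_weights =
  fixes r :: perm5 and \<alpha> :: "int \<times> int" and s :: int and Q :: "perm5 list list"
  assumes r: "r \<in> set all_perms" and s: "s = 1 \<or> s = - 1" and \<alpha>: "fst \<alpha> \<noteq> snd \<alpha>"
    and Q: "\<And>S. S \<in> set Q \<Longrightarrow> sublist_of (class5 r) S = S"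
    and ok: "six_ok (class5 r) \<alpha> s Q"
begin

abbreviation "C \<equiv> class5_of r"

sublocale finite_conj_class S5 C
  using r by (intro finite_conj_class_S5 perm_of_carrier)

definition w :: "5 option \<Rightarrow> (nat \<Rightarrow> nat) \<Rightarrow> int" where
  "w i = weight_fun \<alpha> (Q ! pos6 i)"

text \<open>The one-dimensional character whose value at transpositions is \<open>s\<close>.\<close>

definition \<sigma> :: "(nat \<Rightarrow> nat) \<Rightarrow> int" where
  "\<sigma> g = (if s = 1 then 1 else sign g)"

definition rel :: "(nat \<Rightarrow> nat) \<Rightarrow> 5 option \<Rightarrow> 5 option \<Rightarrow> bool" where
  "rel g i j \<longleftrightarrow> (\<forall>a\<in>C. w i a = \<sigma> g * w j (conj_by g a))"

definition \<pi> :: "(nat \<Rightarrow> nat) \<Rightarrow> 5 option \<Rightarrow> 5 option" where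
  "\<pi> g i = (THE j. rel g i j)"

lemma length_Q: "length Q = 6" and distinct_Q: "distinct Q"
  using ok by (simp_all add: six_ok_def)

lemma nth_mem_Q: "Q ! pos6 i \<in> set Q"
  using pos6_less[of i] by (simp add: length_Q)

lemma set_Q: "S \<in> set Q \<Longrightarrow> \<exists>i. S = Q ! pos6 i"
  using ex_pos6 unfolding in_set_conv_nth length_Q by metis

lemma C_code: "C = perm_of ` set (class5 r)"
  by (rule conj_class_code[OF r])

lemma sig_one: "\<sigma> id = 1" by (simp add: \<sigma>_def)

lemma sig_mult: "g \<in> carrier S5 \<Longrightarrow> h \<in> carrier S5 \<Longrightarrow> \<sigma> (g \<circ> h) = \<sigma> g * \<sigma> h"
  using sym_group_carrier' by (auto simp: \<sigma>_def sign_compose)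

lemma sig_square: "\<sigma> g * \<sigma> g = 1"
  by (auto simp: \<sigma>_def sign_def)

lemma sig_transpose: "a \<noteq> b \<Longrightarrow> \<sigma> (Transposition.transpose a b) = s"
  using s by (auto simp: \<sigma>_def sign_swap_id)

lemma w_perm_of: "w i (perm_of a) = weight \<alpha> (Q ! pos6 i) a"
  by (simp add: w_def weight_fun_perm_of)

lemma rel_perm_of:
  assumes "g \<in> set all_perms"
  shows "rel (perm_of g) i j \<longleftrightarrow> carries (class5 r) \<alpha> (\<sigma> (perm_of g)) g (Q ! pos6 i) (Q ! pos6 j)"
proof -
  have "perm_of g \<otimes>\<^bsub>S5\<^esub> perm_of a \<otimes>\<^bsub>S5\<^esub> inv\<^bsub>S5\<^esub> perm_of g = perm_of (conj5 g a)" if "a \<in> set (class5 r)" for a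
    using that class5_sub[OF r] assms by (intro perm_of_conj5) auto
  then show ?thesis unfolding rel_def C_code carries_def list_all_iff ball_simps
    by (intro ball_cong refl) (simp only: w_perm_of)
qed

lemma conj_comp:
  assumes "g \<in> carrier S5" "h \<in> carrier S5" "a \<in> carrier S5"
  shows "(h \<circ> g) \<otimes>\<^bsub>S5\<^esub> a \<otimes>\<^bsub>S5\<^esub> inv\<^bsub>S5\<^esub> (h \<circ> g) =
    conj_by h (conj_by g a)"
  using assms unfolding mult_S5[symmetric]
  by (simp add: S5.inv_mult_group S5.m_assoc del: sym_group_inv_equality)

lemma rel_comp:
  assumes g: "g \<in> carrier S5" and h: "h \<in> carrier S5" and "rel g i j" "rel h j k"
  shows "rel (h \<circ> g) i k"
  unfolding rel_def
proof
  fix a assume a: "a \<in> C"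
  have "w i a = \<sigma> g * w j (conj_by g a)" using assms(3) a unfolding rel_def by blast
  also have "w j (conj_by g a) =
      \<sigma> h * w k (conj_by h (conj_by g a))"
    using assms(4) conj_C[OF g a] unfolding rel_def by blast
  finally show "w i a = \<sigma> (h \<circ> g) * w k ((h \<circ> g) \<otimes>\<^bsub>S5\<^esub> a \<otimes>\<^bsub>S5\<^esub> inv\<^bsub>S5\<^esub> (h \<circ> g))"
    unfolding conj_comp[OF g h C_carrier[OF a]] sig_mult[OF h g] by (simp only: mult_ac)
qed

lemma rel_unique:
  assumes g: "g \<in> carrier S5" and "rel g i j" "rel g i k"
  shows "j = k"
proof -
  have eq: "w j b = w k b" if b: "b \<in> C" for b
  proof -
    define a where "a = inv\<^bsub>S5\<^esub> g \<otimes>\<^bsub>S5\<^esub> b \<otimes>\<^bsub>S5\<^esub> g"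
    have a: "a \<in> C" unfolding a_def by (rule conj_inv_C[OF g b])
    have b_eq: "conj_by g a = b"
      using conj_eq_iff[OF g C_carrier[OF a] C_carrier[OF b]] by (simp add: a_def)
    have "\<sigma> g * w j b = \<sigma> g * w k b"
      using assms(2,3) a unfolding rel_def b_eq[symmetric] by metis
    then show ?thesis using sig_square[of g] by auto
  qed
  have "List.member (Q ! pos6 j) a = List.member (Q ! pos6 k) a" if "a \<in> set (class5 r)" for a
    using eq[of "perm_of a"] that \<alpha> by (auto simp: C_code w_perm_of weight_def split: if_splits)
  then have "sublist_of (class5 r) (Q ! pos6 j) = sublist_of (class5 r) (Q ! pos6 k)"
    unfolding sublist_of_def by (intro filter_cong refl)
  then have "Q ! pos6 j = Q ! pos6 k" using Q nth_mem_Q by metis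
  then have "pos6 j = pos6 k" using distinct_Q pos6_less by (simp add: nth_eq_iff_index_eq length_Q)
  then show ?thesis using inj_pos6 by (simp add: inj_eq)
qed

lemma rel_id: "rel id i i"
proof -
  have "conj_by id a = a" if "a \<in> carrier S5" for a
    using that S5.inv_one by (simp add: mult_S5 sym_group_one del: sym_group_inv_equality)
  then show ?thesis by (simp add: rel_def sig_one)
qed

lemma tr5_all_perms: "tr5 a b \<in> set all_perms"
  by (auto simp: in_all_perms_iff tr5_def inj_def)

text \<open>Induction over products of transpositions, with \<open>rel_comp\<close> as the inductive
  step.\<close>

lemma ex_rel:
  assumes "g \<in> carrier S5" shows "\<exists>j. rel g i j"
proof -
  have "g permutes {1..5}" "finite {1..5 :: nat}" using assms by (simp_all add: sym_group_carrier)
  then have "g permutes {1..5} \<and> (\<forall>i. \<exists>j. rel g i j)"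
  proof (induction rule: permutes_induct)
    case id
    then show ?case using rel_id permutes_id by blast
  next
    case (swap m n p)
    obtain a b where ab: "m = num_of a" "n = num_of b" "a \<noteq> b" using swap by (metis num_of_cases)
    then have t: "Transposition.transpose m n = perm_of (tr5 a b)" by (simp add: perm_of_tr5)
    have car: "perm_of (tr5 a b) \<in> carrier S5" "p \<in> carrier S5"
      using swap tr5_all_perms perm_of_carrier by (auto simp: sym_group_carrier)
    have "\<exists>k. rel (perm_of (tr5 a b)) j k" for j
    proof -
      have "list_ex (carries (class5 r) \<alpha> s (tr5 a b) (Q ! pos6 j)) Q"
        using ok nth_mem_Q[of j] ab(3) by (auto simp: six_ok_def list_all_iff set_letters)
      then obtain S where "S \<in> set Q" "carries (class5 r) \<alpha> s (tr5 a b) (Q ! pos6 j) S"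
        by (auto simp: list_ex_iff)
      then show ?thesis
        using set_Q sig_transpose[of m n] swap(3) unfolding rel_perm_of[OF tr5_all_perms] t by metis
    qed
    then have "\<forall>i. \<exists>k. rel (Transposition.transpose m n \<circ> p) i k"
      using swap.IH rel_comp[OF car(2,1)] unfolding t by metis
    then show ?case using S5.m_closed[OF car] unfolding t mult_S5 sym_group_carrier by blast
  qed
  then show ?thesis by blast
qed

lemma rel_pi: "g \<in> carrier S5 \<Longrightarrow> rel g i (\<pi> g i)"
  unfolding \<pi>_def using ex_rel rel_unique by (metis (mono_tags, lifting) theI)

lemma pi_eqI: "g \<in> carrier S5 \<Longrightarrow> rel g i j \<Longrightarrow> \<pi> g i = j"
  using rel_pi rel_unique by blast

sublocale six_point_action \<pi> \<sigma>
proof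
  have "id \<in> carrier S5" using S5.one_closed by (simp add: sym_group_one)
  then show "\<pi> id = id" using pi_eqI rel_id by fastforce
  fix g h assume gh: "g \<in> carrier S5" "h \<in> carrier S5"
  have "g \<circ> h \<in> carrier S5" using S5.m_closed[OF gh] by (simp add: mult_S5)
  then show "\<pi> (g \<circ> h) = \<pi> g \<circ> \<pi> h"
    using rel_comp[OF gh(2,1) rel_pi[OF gh(2)] rel_pi[OF gh(1)]] by (auto intro!: pi_eqI)
qed (simp_all add: sig_one sig_mult)

lemma pairing_w_act:
  assumes g: "g \<in> carrier S5"
  shows "pairing C (w i) (Lambda1_act S5 C g p) = (of_int (\<sigma> g) :: 'k::field) * pairing C (w (\<pi> (inv\<^bsub>S5\<^esub> g) i)) p"
proof -
  let ?j = "\<pi> (inv\<^bsub>S5\<^esub> g) i"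
  have rel: "rel g ?j i" using rel_pi[OF g, of ?j] unfolding pi_inv(2)[OF g] .
  have "w i (conj_by g a) = \<sigma> g * w ?j a" if "a \<in> C" for a
  proof -
    have "w ?j a = \<sigma> g * w i (conj_by g a)" using rel that unfolding rel_def by blast
    then have "\<sigma> g * w ?j a = (\<sigma> g * \<sigma> g) * w i (conj_by g a)" by (simp only: mult.assoc)
    then show ?thesis by (simp only: sig_square mult_1)
  qed
  then have "pairing C (w i) (Lambda1_act S5 C g p) = pairing C (\<lambda>a. \<sigma> g * w ?j a) p"
    unfolding pairing_act[OF g] by (intro pairing_cong)
  then show ?thesis by (simp only: pairing_mult)
qed

lemma square_sig: "x \<in> set all_perms \<Longrightarrow> mul5 x x \<in> set all_perms \<and> \<sigma> (perm_of (mul5 x x)) = 1"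
  using S5.m_closed[of "perm_of x" "perm_of x"] sig_mult[of "perm_of x" "perm_of x"] sig_square
  by (auto simp: perm_of_carrier mult_S5 carrier_S5 simp flip: perm_of_mul5)

lemma hd_Q: "hd Q = Q ! pos6 None"
  using length_Q by (simp add: hd_conv_nth length_greater_0_conv[symmetric] del: length_greater_0_conv)

lemma transitive: "\<exists>g\<in>carrier S5. \<pi> g None = i"
proof -
  have "list_ex (\<lambda>x. carries (class5 r) \<alpha> 1 (mul5 x x) (hd Q) (Q ! pos6 i)) all_perms"
    using ok nth_mem_Q[of i] by (auto simp: six_ok_def list_all_iff)
  then obtain x where x: "x \<in> set all_perms" "carries (class5 r) \<alpha> 1 (mul5 x x) (hd Q) (Q ! pos6 i)"
    by (auto simp: list_ex_iff)
  then have "rel (perm_of (mul5 x x)) None i"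
    using square_sig[OF x(1)] by (simp add: rel_perm_of hd_Q)
  then show ?thesis using square_sig[OF x(1)] by (meson pi_eqI perm_of_carrier)
qed

lemma five_cycle:
  obtains c where "c \<in> carrier S5" "\<sigma> c = 1" "\<pi> c None = None" "\<And>z. \<pi> c (Some z) = Some (z + 1)"
proof -
  \<comment> \<open>A square root of (12345), the first generator in \<open>sylows\<close>;
    presenting that cycle as a square shows that its \<sigma> is 1.\<close>
  define x where "x = cyc5 [[L1, L4, L2, L5, L3]]"
  have "x \<in> set all_perms" unfolding x_def by code_simp
  note sq = square_sig[OF this]
  have Q_eq: "Q = [Q ! 0, Q ! 1, Q ! 2, Q ! 3, Q ! 4, Q ! 5]"
    using length_Q by (intro nth_equalityI) (auto simp: less_Suc_eq numeral_eq_Suc)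
  have "list_all2 (carries (class5 r) \<alpha> 1 (mul5 x x)) Q [Q ! 0, Q ! 2, Q ! 3, Q ! 4, Q ! 5, Q ! 1]"
    using ok by (simp add: six_ok_def x_def Let_def)
  then have "list_all2 (carries (class5 r) \<alpha> 1 (mul5 x x)) [Q ! 0, Q ! 1, Q ! 2, Q ! 3, Q ! 4, Q ! 5]
     [Q ! 0, Q ! 2, Q ! 3, Q ! 4, Q ! 5, Q ! 1]"
    by (subst (asm) Q_eq) simp
  then have rel: "rel (perm_of (mul5 x x)) None None" "rel (perm_of (mul5 x x)) (Some 0) (Some 1)"
    "rel (perm_of (mul5 x x)) (Some 1) (Some 2)" "rel (perm_of (mul5 x x)) (Some 2) (Some 3)"
    "rel (perm_of (mul5 x x)) (Some 3) (Some 4)" "rel (perm_of (mul5 x x)) (Some 4) (Some 0)"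
    using sq by (simp_all add: rel_perm_of)
  have car: "perm_of (mul5 x x) \<in> carrier S5" using sq by (simp add: perm_of_carrier)
  have "\<pi> (perm_of (mul5 x x)) (Some z) = Some (z + 1)" for z
  proof -
    have "0 + 1 = (1 :: 5)" "1 + 1 = (2 :: 5)" "2 + 1 = (3 :: 5)" "3 + 1 = (4 :: 5)" "4 + 1 = (0 :: 5)" by simp_all
    then show ?thesis using exhaust_5[of z] rel(2-6)[THEN pi_eqI[OF car]] by metis
  qed
  then show thesis using that[of "perm_of (mul5 x x)"] car sq pi_eqI[OF car rel(1)] by blast
qed

lemma irreducible: "irreducible_matrix_rep S5 (rho :: _ \<Rightarrow> 'k::field_char_0 ^ 5 ^ 5)"
proof -
  obtain c where "c \<in> carrier S5" "\<sigma> c = 1" "\<pi> c None = None" "\<And>z. \<pi> c (Some z) = Some (z + 1)"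
    by (rule five_cycle) blast
  then show ?thesis using transitive sig_square by (intro irreducible_rho) (auto, metis mult_zero_left zero_neq_one)
qed

text \<open>The normaliser of a Sylow 5-subgroup contains no transposition, so (12) moves all six
  points; the last clause of \<open>six_ok\<close> records this. Hence \<open>s = 1\<close> yields
  the representation with negative trace and \<open>s = - 1\<close> the other one.\<close>

lemma trace_12: "trace (rho (cyc [[1, 2]]) :: 'k::field_char_0 ^ 5 ^ 5) = of_int (- s)"
proof -
  have cyc: "cyc [[1, 2]] = perm_of (tr5 L1 L2)" by (simp add: perm_of_tr5 cyc_def)
  have sg: "\<sigma> (perm_of (tr5 L1 L2)) = s" by (simp add: perm_of_tr5 sig_transpose)
  have "\<pi> (perm_of (tr5 L1 L2)) i \<noteq> i" for i
  proof
    assume "\<pi> (perm_of (tr5 L1 L2)) i = i"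
    then have "rel (perm_of (tr5 L1 L2)) i i" using rel_pi perm_of_carrier tr5_all_perms by metis
    then have "carries (class5 r) \<alpha> s (tr5 L1 L2) (Q ! pos6 i) (Q ! pos6 i)"
      by (simp add: rel_perm_of tr5_all_perms sg)
    then show False using ok nth_mem_Q[of i] by (auto simp: six_ok_def list_all_iff)
  qed
  then show ?thesis unfolding cyc by (subst trace_rho) (simp_all add: perm_of_carrier tr5_all_perms sg)
qed

definition coords :: "(nat \<Rightarrow> nat, 'k::field_char_0) tensor \<Rightarrow> 'k ^ 5" where
  "coords p = (\<chi> z. pairing C (w (Some z)) p)"

lemma ext6_coords:
  assumes "(\<Sum>i\<in>UNIV. pairing C (w i) p) = 0" shows "ext6 (coords p) i = pairing C (w i) p"
  unfolding coords_def by (rule ext6_restrict[OF assms])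

lemma coords_act:
  assumes "g \<in> carrier S5" "(\<Sum>i\<in>UNIV. pairing C (w i) p) = 0"
  shows "coords (Lambda1_act S5 C g p) = rho g *v coords p"
proof -
  have "(rho g *v coords p) $ z = pairing C (w (Some z)) (Lambda1_act S5 C g p)" for z
    using ext6_rho[OF assms(1), of "coords p" "Some z"]
    unfolding ext6_coords[OF assms(2)] pairing_w_act[OF assms(1)] by (simp add: ext6_def)
  then show ?thesis by (simp add: coords_def vec_eq_iff)
qed

lemma bij_nth: "bij_betw (\<lambda>i. Q ! pos6 i) UNIV (set Q)"
proof (rule bij_betw_imageI)
  show "inj (\<lambda>i. Q ! pos6 i)"
    using distinct_Q pos6_less inj_pos6 by (auto simp: inj_def nth_eq_iff_index_eq length_Q)
  show "range (\<lambda>i. Q ! pos6 i) = set Q" using nth_mem_Q set_Q by blast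
qed

lemma sum_w: "(\<Sum>i\<in>UNIV. f (Q ! pos6 i)) = (\<Sum>S\<in>set Q. f S)"
  by (rule sum.reindex_bij_betw[OF bij_nth])

end

lemma (in six_weights) iso_rho:
  assumes Qn: "set Q = set (strata r n)" and cov: "covers (class5 r) Q R" "R > 0"
    and gram: "gram_ok \<alpha> Q K" "K \<noteq> 0"
  shows "theta C \<in> span_k (flat_stratum S5 C n :: (_, 'k::field_char_0) tensor set)"
    and "rep_iso S5 (stratum_rep S5 C n :: ('k, _, _) rep) (rep_of_matrices rho)"
proof -
  interpret S: simplex_forms C "set Q" "form_of :: _ \<Rightarrow> (_, 'k) tensor" "weight_fun \<alpha>" "of_int K" "of_nat R"
    using length_Q by (intro simplex_code[OF r Qn distinct_Q _ cov gram]) auto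
  have F: "flat_stratum S5 C n = (form_of ` set Q :: (_, 'k) tensor set)"
    unfolding flat_stratum_code(1)[OF r] Qn ..
  show th: "theta C \<in> span_k (flat_stratum S5 C n :: (_, 'k) tensor set)"
    unfolding F by (rule S.theta_span)
  have sum0: "(\<Sum>i\<in>UNIV. pairing C (w i) p) = 0" if "p \<in> span_k (flat_stratum S5 C n)" for p :: "(_, 'k) tensor"
    unfolding w_def sum_w[of "\<lambda>S. pairing C (weight_fun \<alpha> S) p"] using S.sum_pairing that unfolding F by blast
  show "rep_iso S5 (stratum_rep S5 C n :: ('k, _, _) rep) (rep_of_matrices rho)"
  proof (rule stratum_rep_iso[where T = coords, OF th])
    show "coords (x + y) = coords x \<oplus>\<^bsub>rep_of_matrices rho\<^esub> coords y" for x y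
      by (simp add: coords_def rep_of_matrices_def mk_rep_def pairing_add vec_eq_iff)
    show "coords (scale c x) = c \<odot>\<^bsub>rep_of_matrices rho\<^esub> coords x" for c x
      by (simp add: coords_def rep_of_matrices_def mk_rep_def pairing_scale vec_eq_iff)
    show "coords (Lambda1_act S5 C g x) = act (rep_of_matrices rho) g (coords x)"
      if "g \<in> carrier S5" "x \<in> span_k (flat_stratum S5 C n)" for g and x :: "(_, 'k) tensor"
      using coords_act[OF that(1) sum0[OF that(2)]] by (simp add: rep_of_matrices_def mk_rep_def)
  next
    fix x y :: "(_, 'k) tensor"
    assume xy: "x \<in> span_k (flat_stratum S5 C n)" "y \<in> span_k (flat_stratum S5 C n)"
    have "coords x = coords y \<longleftrightarrow> (\<forall>i. pairing C (w i) x = pairing C (w i) y)"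
      using ext6_eqI[of "coords x" "coords y"] ext6_coords[OF sum0[OF xy(1)]] ext6_coords[OF sum0[OF xy(2)]]
      by metis
    also have "\<dots> \<longleftrightarrow> (\<forall>S\<in>set Q. pairing C (weight_fun \<alpha> S) x = pairing C (weight_fun \<alpha> S) y)"
      unfolding w_def using nth_mem_Q set_Q by metis
    finally show "coords x = coords y \<longleftrightarrow> x - y \<in> span_k {theta C}"
      using S.kernel_diff xy unfolding F by blast
  next
    show "coords ` span_k (flat_stratum S5 C n) = carrier (rep_of_matrices (rho :: _ \<Rightarrow> 'k ^ 5 ^ 5))"
    proof (intro equalityI subsetI)
      fix y :: "'k ^ 5"
      let ?f = "\<lambda>S. ext6 y (inv_into UNIV (\<lambda>i. Q ! pos6 i) S)"
      have f: "?f (Q ! pos6 i) = ext6 y i" for i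
        using inv_f_f[OF bij_betw_imp_inj_on[OF bij_nth], of i] by simp
      have "(\<Sum>S\<in>set Q. ?f S) = 0" unfolding sum_w[symmetric] f by (rule sum_ext6)
      then obtain p where p: "p \<in> span_k (form_of ` set Q)" "\<And>S. S \<in> set Q \<Longrightarrow> pairing C (weight_fun \<alpha> S) p = ?f S"
        by (rule S.onto) blast
      have "coords p = y"
        using p(2)[OF nth_mem_Q] f by (simp add: coords_def w_def vec_eq_iff ext6_def)
      then show "y \<in> coords ` span_k (flat_stratum S5 C n)" using p(1) unfolding F by blast
    qed (simp add: rep_of_matrices_def mk_rep_def)
  qed
qed

section \<open>Elements of order six\<close>

lemma pairing_combination_code:
  assumes r: "r \<in> set all_perms" and E: "\<And>e. e \<in> I \<Longrightarrow> set e \<subseteq> set (class5 r) \<and> distinct e"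
  shows "pairing (class5_of r) (weight_fun \<alpha> S) (\<Sum>e\<in>I. scale (c e) (form_of e)) =
    (\<Sum>e\<in>I. c e * of_int (weight_sum \<alpha> S e))"
  unfolding pairing_sum pairing_scale using E by (intro sum.cong refl) (simp add: pairing_form_of[OF r])

text \<open>In matrix terms, applying the transpose of \<open>A\<close> after \<open>A\<close>. It
  turns vanishing pairings into a condition on the coefficients.\<close>

lemma weighted_double_sum:
  fixes c :: "'e \<Rightarrow> 'k::field_char_0" and A :: "'s \<Rightarrow> 'e \<Rightarrow> int"
  shows "(\<Sum>s\<in>P. of_int (A s e') * (\<Sum>e\<in>I. c e * of_int (A s e))) =
    (\<Sum>e\<in>I. c e * of_int (\<Sum>s\<in>P. A s e * A s e'))"
  unfolding sum_distrib_left of_int_sum by (subst sum.swap) (intro sum.cong refl, simp add: mult_ac)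

text \<open>The opposite order, \<open>B\<close> after the transpose of \<open>A\<close>: it
  computes the pairings of a form built from prescribed values.\<close>

lemma weighted_double_sum':
  fixes y :: "'s \<Rightarrow> 'k::field_char_0" and A :: "'s \<Rightarrow> 'e \<Rightarrow> int" and B :: "'t \<Rightarrow> 'e \<Rightarrow> int"
  shows "(\<Sum>e\<in>I. (\<Sum>s\<in>P. y s * of_int (A s e)) * of_int (B t e)) = (\<Sum>s\<in>P. y s * of_int (\<Sum>e\<in>I. A s e * B t e))"
  unfolding sum_distrib_left sum_distrib_right of_int_sum by (subst sum.swap) (intro sum.cong refl, simp add: mult_ac)

text \<open>The ten forms span the permutation module on 2-cycles, of dimension 1 + 4 + 5. The
  weights from \<open>P\<close> see the standard part and those from \<open>Q\<close> the
  five-dimensional part; the two families are orthogonal, and together they separate forms modulo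
  \<theta>.\<close>

lemma pentagon_iso:
  fixes r P Q E
  defines "r \<equiv> cyc5 [[L1,L2,L3],[L4,L5]]" and "P \<equiv> map (in_two_cycle r) letters"
    and "Q \<equiv> hexad pentagon_edge r" and "E \<equiv> strata r 2"
  shows "theta (class5_of r) \<in> span_k (flat_stratum S5 (class5_of r) 2 :: (_, 'k::field_char_0) tensor set)"
    and "\<exists>\<rho> :: _ \<Rightarrow> 'k ^ 5 ^ 5. is_rep5 \<rho> \<and>
      rep_iso S5 (stratum_rep S5 (class5_of r) 2 :: ('k, _, _) rep) (rep_sum fund_rep (rep_of_matrices \<rho>))"
proof -
  have r: "r \<in> set all_perms" unfolding r_def by code_simp
  interpret six_weights r "(1, -1)" "- 1" Q
  proof
    show "six_ok (class5 r) (1, -1) (- 1) Q" unfolding r_def Q_def by (rule pentagon_six)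
    show "sublist_of (class5 r) S = S" if "S \<in> set Q" for S
      using that by (auto simp: Q_def hexad_def Let_def sublist_of_def intro!: filter_cong)
  qed (simp_all add: r)
  have code: "distinct P" "covers (class5 r) E 1" "form_matrix_ok P Q E"
    using pentagon_code by (simp_all add: r_def P_def Q_def E_def Let_def)
  have dE: "distinct E" unfolding E_def by (rule distinct_strata)
  have E: "set e \<subseteq> set (class5 r) \<and> distinct e" if "e \<in> set E" for e
    using that stratum_member unfolding E_def by blast
  have F: "flat_stratum S5 C 2 = (form_of ` set E :: (_, 'k) tensor set)"
    unfolding flat_stratum_code(1)[OF r] E_def ..
  let ?A = "weight_sum (3, -2)" and ?H = "weight_sum (1, -1)"
  note M = code(3)[unfolded form_matrix_ok_def list_all_iff]
  have colA: "(\<Sum>S\<in>set P. ?A S e) = 0" and colH: "(\<Sum>S\<in>set Q. ?H S e) = 0" if "e \<in> set E" for e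
    using M that code(1) distinct_Q by (auto simp: sum_list_distinct_conv_sum_set)
  have rowA: "(\<Sum>e\<in>set E. ?A S e) = 0" if "S \<in> set P" for S
    using M that dE by (auto simp: sum_list_distinct_conv_sum_set)
  have rowH: "(\<Sum>e\<in>set E. ?H S e) = 0" if "S \<in> set Q" for S
    using M that dE by (auto simp: sum_list_distinct_conv_sum_set)
  have frame: "4 * (\<Sum>S\<in>set P. ?A S e * ?A S e') + 25 * (\<Sum>S\<in>set Q. ?H S e * ?H S e') + 120 =
      (if e = e' then 1200 else 0)" if "e \<in> set E" "e' \<in> set E" for e e'
    using M that code(1) distinct_Q by (simp add: sum_list_distinct_conv_sum_set)
  have AA: "(\<Sum>e\<in>set E. ?A S e * ?A S' e) = (if S = S' then 300 else 0) - 60" if "S \<in> set P" "S' \<in> set P" for S S'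
    using M that dE by (simp add: sum_list_distinct_conv_sum_set)
  have HH: "(\<Sum>e\<in>set E. ?H S e * ?H S' e) = (if S = S' then 48 else 0) - 8" if "S \<in> set Q" "S' \<in> set Q" for S S'
    using M that dE by (simp add: sum_list_distinct_conv_sum_set)
  have AH: "(\<Sum>e\<in>set E. ?A S e * ?H S' e) = 0" if "S \<in> set P" "S' \<in> set Q" for S S'
    using M that dE by (simp add: sum_list_distinct_conv_sum_set)
  have theta_sum: "theta C = (\<Sum>e\<in>set E. scale 1 (form_of e) :: (_, 'k) tensor)"
    using sum_form_of[OF r _ dE code(2), where 'k = 'k] E by simp
  show th: "theta C \<in> span_k (flat_stratum S5 C 2 :: (_, 'k) tensor set)"
    unfolding F theta_sum span_k_def by (intro tensor.span_sum tensor.span_scale tensor.span_base) simp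
  let ?p = "\<lambda>c. \<Sum>e\<in>set E. scale (c e) (form_of e) :: (_, 'k) tensor"
  have span_E: "?p c \<in> span_k (form_of ` set E)" for c :: "_ \<Rightarrow> 'k"
    unfolding span_k_def by (intro tensor.span_sum tensor.span_scale tensor.span_base) simp
  have f: "pairing C (weight_fun \<alpha> S) (?p c) = (\<Sum>e\<in>set E. c e * of_int (weight_sum \<alpha> S e))" for \<alpha> S c
    by (rule pairing_combination_code[OF r E])
  have inj: "inj (in_two_cycle r)" using code(1) by (simp add: P_def distinct_map set_letters)
  have P: "set P = range (in_two_cycle r)" by (simp add: P_def set_letters)
  have wP: "pairing C (point_weight 2 (3, -2) (num_of l)) p = pairing C (weight_fun (3, -2) (in_two_cycle r l)) p"
    for l and p :: "(_, 'k) tensor"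
    by (intro pairing_cong)
      (auto simp: C_code weight_fun_perm_of weight_def in_two_cycle_def point_weight_def numeral_2_eq_2)
  let ?T1 = "fund_coords C (point_weight 2 (3, -2)) :: (_, 'k) tensor \<Rightarrow> _"
  let ?T = "\<lambda>p. (?T1 p, coords p :: 'k ^ 5)"
  have sumP: "(\<Sum>S\<in>set P. pairing C (weight_fun (3, -2) S) p) = 0"
    and sumQ: "(\<Sum>S\<in>set Q. pairing C (weight_fun (1, -1) S) p) = 0" if mem: "p \<in> span_k (form_of ` set E)" for p :: "(_, 'k) tensor"
  proof -
    obtain c where p: "p = ?p c" using span_image_sum[OF finite_set mem] .
    show "(\<Sum>S\<in>set P. pairing C (weight_fun (3, -2) S) p) = 0" "(\<Sum>S\<in>set Q. pairing C (weight_fun (1, -1) S) p) = 0"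
      unfolding p f by (subst sum.swap, simp add: colA colH flip: sum_distrib_left of_int_sum)+
  qed
  have ker: "(\<forall>S\<in>set P. pairing C (weight_fun (3, -2) S) p = 0) \<and> (\<forall>S\<in>set Q. pairing C (weight_fun (1, -1) S) p = 0)
     \<longleftrightarrow> p \<in> span_k {theta C}" if mem: "p \<in> span_k (form_of ` set E)" for p :: "(_, 'k) tensor"
  proof
    obtain c where p: "p = ?p c" using span_image_sum[OF finite_set mem] .
    assume zero: "(\<forall>S\<in>set P. pairing C (weight_fun (3, -2) S) p = 0) \<and> (\<forall>S\<in>set Q. pairing C (weight_fun (1, -1) S) p = 0)"
    \<comment> \<open>The mean of the ten coefficients.\<close>
    define s where "s = sum c (set E) / 10"
    have "c e' = s" if e': "e' \<in> set E" for e'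
    proof -
      \<comment> \<open>Recombining the vanishing pairings through \<open>frame\<close> gives 1200
        c(e') - 120 times the coefficient sum, so each coefficient equals the mean.\<close>
      have "0 = 4 * (\<Sum>S\<in>set P. of_int (?A S e') * pairing C (weight_fun (3, -2) S) p)
          + 25 * (\<Sum>S\<in>set Q. of_int (?H S e') * pairing C (weight_fun (1, -1) S) p)"
        using zero by simp
      also have "\<dots> = (\<Sum>e\<in>set E. c e * of_int (4 * (\<Sum>S\<in>set P. ?A S e * ?A S e') + 25 * (\<Sum>S\<in>set Q. ?H S e * ?H S e')))"
        unfolding p f weighted_double_sum
        by (simp add: sum_distrib_left sum.distrib[symmetric] algebra_simps)
      also have "\<dots> = (\<Sum>e\<in>set E. c e * of_int ((if e = e' then 1200 else 0) - 120))"
        using frame[OF _ e'] by (intro sum.cong refl arg_cong2[of _ _ _ _ "(*)"] arg_cong[of _ _ of_int]) (auto simp: algebra_simps)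
      also have "\<dots> = (\<Sum>e\<in>set E. (if e = e' then 1200 * c e else 0) - 120 * c e)"
        by (intro sum.cong refl) (simp add: algebra_simps)
      also have "\<dots> = 1200 * c e' - 120 * sum c (set E)"
        using e' by (simp add: sum_subtractf sum_distrib_left)
      finally show ?thesis by (simp add: s_def field_simps)
    qed
    then have "p = scale s (theta C)" unfolding p theta_sum tensor.scale_sum_right
      by (intro sum.cong refl) simp
    then show "p \<in> span_k {theta C}" by (simp add: span_k_def tensor.span_scale tensor.span_base)
  next
    assume "p \<in> span_k {theta C}"
    then obtain k where k: "p = scale k (theta C)" by (auto simp: span_k_def tensor.span_singleton)
    show "(\<forall>S\<in>set P. pairing C (weight_fun (3, -2) S) p = 0) \<and> (\<forall>S\<in>set Q. pairing C (weight_fun (1, -1) S) p = 0)"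
      unfolding k pairing_scale theta_sum f using rowA rowH by (simp flip: of_int_sum)
  qed
  have onto: "\<exists>p \<in> span_k (form_of ` set E). (\<forall>S\<in>set P. pairing C (weight_fun (3, -2) S) p = y S) \<and> (\<forall>S\<in>set Q. pairing C (weight_fun (1, -1) S) p = z S)"
    if y: "(\<Sum>S\<in>set P. y S) = 0" and z: "(\<Sum>S\<in>set Q. z S) = 0" for y z :: "_ \<Rightarrow> 'k"
  proof -
    \<comment> \<open>The factors are 1/300 and 1/48, the inverses of the scalars by which the Gram
      matrices \<open>AA\<close> and \<open>HH\<close> act on sum-zero families. By
      \<open>AH\<close> the two summands do not disturb each other.\<close>
    define c where "c e = 4 / 1200 * (\<Sum>S\<in>set P. y S * of_int (?A S e)) + 25 / 1200 * (\<Sum>S\<in>set Q. z S * of_int (?H S e))" for e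
    have c: "(\<Sum>e\<in>set E. c e * of_int (B e)) = 4 / 1200 * (\<Sum>S\<in>set P. y S * of_int (\<Sum>e\<in>set E. ?A S e * B e))
       + 25 / 1200 * (\<Sum>S\<in>set Q. z S * of_int (\<Sum>e\<in>set E. ?H S e * B e))" for B :: "_ \<Rightarrow> int"
      unfolding weighted_double_sum'[of _ _ _ "\<lambda>_. B", symmetric] c_def
      by (simp add: sum.distrib sum_distrib_left algebra_simps)
    have "pairing C (weight_fun (3, -2) S') (?p c) = y S'" if S': "S' \<in> set P" for S'
    proof -
      have 1: "(\<Sum>S\<in>set P. y S * of_int (\<Sum>e\<in>set E. ?A S e * ?A S' e)) = (\<Sum>S\<in>set P. (if S = S' then 300 * y S else 0) - 60 * y S)"
        by (intro sum.cong refl) (simp add: AA[OF _ S'] algebra_simps)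
      have 2: "(\<Sum>S\<in>set Q. z S * of_int (\<Sum>e\<in>set E. ?H S e * ?A S' e)) = 0"
        using AH[OF S'] by (intro sum.neutral) (simp add: mult.commute)
      show ?thesis unfolding f c 1 2 using S' y by (simp add: sum_subtractf flip: sum_distrib_left)
    qed
    moreover have "pairing C (weight_fun (1, -1) S') (?p c) = z S'" if S': "S' \<in> set Q" for S'
    proof -
      have 1: "(\<Sum>S\<in>set Q. z S * of_int (\<Sum>e\<in>set E. ?H S e * ?H S' e)) = (\<Sum>S\<in>set Q. (if S = S' then 48 * z S else 0) - 8 * z S)"
        by (intro sum.cong refl) (simp add: HH[OF _ S'] algebra_simps)
      have 2: "(\<Sum>S\<in>set P. y S * of_int (\<Sum>e\<in>set E. ?A S e * ?H S' e)) = 0"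
        using AH[OF _ S'] by (intro sum.neutral) simp
      show ?thesis unfolding f c 1 2 using S' z by (simp add: sum_subtractf flip: sum_distrib_left)
    qed
    ultimately show ?thesis using span_E by blast
  qed
  have sum0: "(\<Sum>i\<in>UNIV. pairing C (w i) p) = 0" if "p \<in> span_k (form_of ` set E)" for p :: "(_, 'k) tensor"
    unfolding w_def sum_w[of "\<lambda>S. pairing C (weight_fun (1, -1) S) p"] by (rule sumQ[OF that])
  have "rep_iso S5 (stratum_rep S5 C 2 :: ('k, _, _) rep) (rep_sum fund_rep (rep_of_matrices rho))"
  proof (rule stratum_rep_iso[where T = ?T, OF th])
    show "?T (x + y) = ?T x \<oplus>\<^bsub>rep_sum fund_rep (rep_of_matrices rho)\<^esub> ?T y" for x y
      by (simp add: rep_sum_def mk_rep_def[of "_ \<times> _"] fund_coords_add)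
        (simp add: coords_def rep_of_matrices_def mk_rep_def pairing_add vec_eq_iff)
    show "?T (scale c x) = c \<odot>\<^bsub>rep_sum fund_rep (rep_of_matrices rho)\<^esub> ?T x" for c x
      by (simp add: rep_sum_def mk_rep_def[of "_ \<times> _"] fund_coords_scale)
        (simp add: coords_def rep_of_matrices_def mk_rep_def pairing_scale vec_eq_iff)
    show "?T (Lambda1_act S5 C g x) = act (rep_sum fund_rep (rep_of_matrices rho)) g (?T x)"
      if "g \<in> carrier S5" "x \<in> span_k (flat_stratum S5 C 2)" for g and x :: "(_, 'k) tensor"
    proof -
      have "coords (Lambda1_act S5 C g x) = rho g *v coords x"
        using that(2) unfolding F by (intro coords_act[OF that(1)] sum0)
      then show ?thesis
        by (simp add: rep_sum_def mk_rep_def[of "_ \<times> _"] fund_coords_act[OF finite_conj_class_axioms that(1)])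
          (simp add: rep_of_matrices_def mk_rep_def)
    qed
  next
    fix x y :: "(_, 'k) tensor"
    assume "x \<in> span_k (flat_stratum S5 C 2)" "y \<in> span_k (flat_stratum S5 C 2)"
    then have xy: "x \<in> span_k (form_of ` set E)" "y \<in> span_k (form_of ` set E)" by (simp_all add: F)
    have "coords x = coords y \<longleftrightarrow> (\<forall>i. pairing C (w i) x = pairing C (w i) y)"
      using ext6_eqI[of "coords x" "coords y"] ext6_coords[OF sum0[OF xy(1)]] ext6_coords[OF sum0[OF xy(2)]]
      by metis
    also have "\<dots> \<longleftrightarrow> (\<forall>S\<in>set Q. pairing C (weight_fun (1, -1) S) x = pairing C (weight_fun (1, -1) S) y)"
      unfolding w_def using nth_mem_Q set_Q by metis
    finally have 1: "coords x = coords y \<longleftrightarrow> (\<forall>S\<in>set Q. pairing C (weight_fun (1, -1) S) (x - y) = 0)"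
      by (simp add: pairing_diff)
    have 2: "?T1 x = ?T1 y \<longleftrightarrow> (\<forall>S\<in>set P. pairing C (weight_fun (3, -2) S) (x - y) = 0)"
      unfolding fund_coords_eq_coords_iff wP P by (simp add: pairing_diff)
    have "x - y \<in> span_k (form_of ` set E)" using xy by (simp add: span_k_def tensor.span_diff)
    from ker[OF this] show "?T x = ?T y \<longleftrightarrow> x - y \<in> span_k {theta C}"
      unfolding prod.inject 1 2 .
  next
    show "?T ` span_k (flat_stratum S5 C 2) = carrier (rep_sum fund_rep (rep_of_matrices (rho :: _ \<Rightarrow> 'k ^ 5 ^ 5)))"
    proof (intro equalityI subsetI)
      fix t assume "t \<in> ?T ` span_k (flat_stratum S5 C 2)"
      then obtain p where p: "t = ?T p" "p \<in> span_k (form_of ` set E)" unfolding F by auto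
      have "(\<Sum>l\<in>UNIV. pairing C (weight_fun (3, -2) (in_two_cycle r l)) p) = 0"
        using sumP[OF p(2)] unfolding P by (simp add: sum.reindex[OF inj])
      then have "?T1 p \<in> carrier fund_rep" by (simp only: fund_coords_carrier wP)
      then show "t \<in> carrier (rep_sum fund_rep (rep_of_matrices rho))"
        unfolding p(1) by (simp add: rep_sum_def rep_of_matrices_def mk_rep_def)
    next
      fix t :: "(nat \<Rightarrow> 'k) \<times> ('k ^ 5)" assume "t \<in> carrier (rep_sum fund_rep (rep_of_matrices rho))"
      then obtain u v where t: "t = (u, v)" "u \<in> carrier fund_rep"
        by (cases t) (simp add: rep_sum_def mk_rep_def[of "_ \<times> _"])
      let ?y = "\<lambda>S. u (num_of (inv_into UNIV (in_two_cycle r) S))"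
      let ?z = "\<lambda>S. ext6 v (inv_into UNIV (\<lambda>i. Q ! pos6 i) S)"
      have y: "(\<Sum>S\<in>set P. ?y S) = (\<Sum>i=1..5. u i)"
        unfolding P sum_range_num_of by (simp add: sum.reindex[OF inj] inv_f_f[OF inj])
      have "(\<Sum>S\<in>set P. ?y S) = 0" unfolding y using t(2) by (simp add: fund_rep_def mk_rep_def)
      moreover have zi: "?z (Q ! pos6 i) = ext6 v i" for i
        using inv_f_f[OF bij_betw_imp_inj_on[OF bij_nth], of i] by simp
      moreover have "(\<Sum>S\<in>set Q. ?z S) = 0" unfolding sum_w[symmetric] zi by (rule sum_ext6)
      ultimately obtain p where p: "p \<in> span_k (form_of ` set E)"
        "\<forall>S\<in>set P. pairing C (weight_fun (3, -2) S) p = ?y S" "\<forall>S\<in>set Q. pairing C (weight_fun (1, -1) S) p = ?z S"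
        using onto[of ?y ?z] by blast
      have "u i = 0" if "i \<notin> {1..5}" for i using t(2) that by (simp add: fund_rep_def mk_rep_def)
      moreover have "pairing C (weight_fun (3, -2) (in_two_cycle r l)) p = u (num_of l)" for l
        using p(2) by (simp add: P inv_f_f[OF inj])
      ultimately have "?T1 p = u" by (subst fund_coords_eq_iff) (simp_all only: wP simp_thms)
      moreover have "coords p = v"
        using bspec[OF p(3) nth_mem_Q] zi by (simp add: coords_def w_def vec_eq_iff ext6_def)
      ultimately have "t = ?T p" by (simp add: t)
      then show "t \<in> ?T ` span_k (flat_stratum S5 C 2)" using p(1) unfolding F by blast
    qed
  qed
  moreover have "is_rep5 (rho :: _ \<Rightarrow> 'k ^ 5 ^ 5)"
    unfolding is_rep5_def using irreducible trace_12 by (intro conjI exI[of _ 1]) simp_all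
  ultimately show "\<exists>\<rho> :: _ \<Rightarrow> 'k ^ 5 ^ 5. is_rep5 \<rho> \<and>
      rep_iso S5 (stratum_rep S5 C 2 :: ('k, _, _) rep) (rep_sum fund_rep (rep_of_matrices \<rho>))"
    by blast
qed

section \<open>Explicit strata\<close>

context finite_conj_class
begin

lemma subrack_C: "is_subrack G C"
  by (simp add: is_subrack_def conj_C)

lemma flat_stratum_top: "flat_stratum G C (card C) = {theta C :: ('g, 'k::field) tensor}"
proof -
  have "{S. S \<subseteq> C \<and> is_subrack G S \<and> card S = card C} = {C}"
    using finite_C subrack_C by (auto dest: card_subset_eq)
  then show ?thesis unfolding flat_stratum_eq by (simp add: theta_indicator)
qed

lemma flat_stratum_1: "(flat_stratum G C 1 :: ('g, 'k::field) tensor set) = basis_elt ` C"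
proof -
  have "is_subrack G {a}" if "a \<in> C" for a
    using that by (simp add: is_subrack_def m_assoc)
  then have "{S. S \<subseteq> C \<and> is_subrack G S \<and> card S = 1} = (\<lambda>a. {a}) ` C"
    by (auto simp: card_1_singleton_iff)
  then show ?thesis unfolding flat_stratum_eq by (simp add: image_image indicator_form_def)
qed

end

text \<open>A conjugate of a cycle is the cycle of the relabelled entries, so it is a cycle through
  \<open>i\<close> exactly when it moves \<open>i\<close>. Subtracting \<theta>_i therefore leaves
  the class elements fixing \<open>i\<close>.\<close>

lemma theta_minus_through:
  assumes cs: "cycle_of_list cs \<in> carrier S5" "cycle_of_list cs \<noteq> id" "cycle cs"
  defines "C \<equiv> conj_class S5 (cycle_of_list cs)"
  shows "theta C - theta_through C i = (indicator_form {a \<in> C. a i = i} :: (_, 'k::field) tensor)"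
proof -
  interpret finite_conj_class S5 C unfolding C_def by (rule finite_conj_class_S5[OF cs(1)])
  have moved: "(\<exists>ds. cycle ds \<and> i \<in> set ds \<and> a = cycle_of_list ds) \<longleftrightarrow> a i \<noteq> i" if a: "a \<in> C" for a
  proof
    assume "a i \<noteq> i"
    obtain g where g: "g \<in> carrier S5" "a = g \<otimes>\<^bsub>S5\<^esub> cycle_of_list cs \<otimes>\<^bsub>S5\<^esub> inv\<^bsub>S5\<^esub> g"
      using a unfolding C_def conj_class_def by blast
    have "bij g" using g(1) by (auto simp: sym_group_carrier permutes_bij)
    then have "a = cycle_of_list (map g cs)" "cycle (map g cs)"
      using g conjugation_of_cycle[OF cs(3)] cs(3)
      by (auto simp: mult_S5 distinct_map intro: inj_on_subset[OF bij_is_inj])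
    then show "\<exists>ds. cycle ds \<and> i \<in> set ds \<and> a = cycle_of_list ds"
      using id_outside_supp \<open>a i \<noteq> i\<close> by metis
  next
    assume "\<exists>ds. cycle ds \<and> i \<in> set ds \<and> a = cycle_of_list ds"
    then obtain ds where ds: "cycle ds" "i \<in> set ds" "a = cycle_of_list ds" by blast
    have "a \<noteq> id"
    proof
      assume "a = id"
      then obtain g where g: "g \<in> carrier S5" "g \<otimes>\<^bsub>S5\<^esub> cycle_of_list cs \<otimes>\<^bsub>S5\<^esub> inv\<^bsub>S5\<^esub> g = \<one>\<^bsub>S5\<^esub>"
        using a unfolding C_def conj_class_def sym_group_one by auto
      then have "cycle_of_list cs = inv\<^bsub>S5\<^esub> g \<otimes>\<^bsub>S5\<^esub> \<one>\<^bsub>S5\<^esub> \<otimes>\<^bsub>S5\<^esub> g"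
        using conj_eq_iff[OF g(1) cs(1) S5.one_closed] by blast
      then have "cycle_of_list cs = \<one>\<^bsub>S5\<^esub>" using g(1) by (simp del: sym_group_inv_equality)
      then show False using cs(2) by (simp add: sym_group_one)
    qed
    obtain k where k: "k < length ds" "i = ds ! k" using ds(2) by (metis in_set_conv_nth)
    \<comment> \<open>The predicate \<open>cycle\<close> asks only for distinct entries, so a
      one-letter list qualifies and stands for the identity; it is excluded here because
      \<open>a\<close> is not the identity.\<close>
    have "length ds \<noteq> 1"
    proof
      assume "length ds = 1"
      then obtain x where "ds = [x]" by (auto simp: length_Suc_conv)
      then show False using \<open>a \<noteq> id\<close> ds(3) by simp
    qed
    have "map a ds = rotate1 ds" using cyclic_rotation[OF ds(1), of 1] by (simp add: ds(3))
    then have "a i = rotate1 ds ! k" using k by (metis nth_map)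
    also have "\<dots> = ds ! (Suc k mod length ds)" using k(1) by (rule nth_rotate1)
    finally have "a i = ds ! (Suc k mod length ds)" .
    moreover have "Suc k mod length ds \<noteq> k" "Suc k mod length ds < length ds"
      using k(1) \<open>length ds \<noteq> 1\<close> by (auto simp: mod_Suc)
    ultimately show "a i \<noteq> i" using ds(1) k by (simp add: nth_eq_iff_index_eq)
  qed
  have "theta_through C i = (indicator_form {a \<in> C. a i \<noteq> i} :: (_, 'k) tensor)"
    unfolding theta_through_def indicator_form_def using moved by (intro sum.cong) auto
  moreover have "theta C = (indicator_form {a \<in> C. a i \<noteq> i} + indicator_form {a \<in> C. a i = i} :: (_, 'k) tensor)"
  proof -
    have "C = {a \<in> C. a i \<noteq> i} \<union> {a \<in> C. a i = i}" by auto
    then show ?thesis unfolding theta_def indicator_form_def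
      using sum.union_disjoint[of "{a \<in> C. a i \<noteq> i}" "{a \<in> C. a i = i}" basis_elt] finite_C by auto
  qed
  ultimately show ?thesis by simp
qed

lemma flat_stratum_fixing:
  assumes r: "r \<in> set all_perms" "perm_of r = cycle_of_list cs" "cycle cs" "perm_of r \<noteq> id"
    and Q: "set (map (fixing r) letters) = set (strata r n)"
  shows "flat_stratum S5 (class5_of r) n =
    (\<lambda>i. theta (class5_of r) - theta_through (class5_of r) i :: (_, 'k::field) tensor) ` {1..5}"
proof -
  let ?C = "class5_of r"
  have "form_of (fixing r l) = (theta ?C - theta_through ?C (num_of l) :: (_, 'k) tensor)" for l
  proof -
    have "perm_of ` set (fixing r l) = {a \<in> ?C. a (num_of l) = num_of l}"
      by (auto simp: conj_class_code[OF r(1)] fixing_def)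
    moreover have "theta ?C - theta_through ?C (num_of l) = (indicator_form {a \<in> ?C. a (num_of l) = num_of l} :: (_, 'k) tensor)"
      using r perm_of_carrier[OF r(1)] unfolding r(2) by (intro theta_minus_through) auto
    ultimately show ?thesis by simp
  qed
  then show ?thesis
    unfolding flat_stratum_code(1)[OF r(1)] Q[symmetric] range_num_of[symmetric]
    by (simp add: image_image set_letters)
qed

lemma strata_summary:
  fixes r :: perm5 and Ns :: "nat list"
  assumes r: "r \<in> set all_perms" and len: "length (class5 r) = N" and Ns: "list_all (\<lambda>l. List.member Ns (length l)) (subracks r)"
  defines "C \<equiv> class5_of r"
  shows "card C = N" and "flat_stratum S5 C N = {theta C :: (_, 'k::field) tensor}"
    and "(flat_stratum S5 C 1 :: (_, 'k) tensor set) = basis_elt ` C"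
    and "n \<notin> set Ns \<Longrightarrow> (flat_stratum S5 C n :: (_, 'k) tensor set) = {}"
proof -
  interpret finite_conj_class S5 C unfolding C_def using r by (intro finite_conj_class_S5 perm_of_carrier)
  have "distinct (class5 r)" by (simp add: class5_def)
  from distinct_card[OF this] have "card (set (class5 r)) = N" unfolding len .
  then show N: "card C = N"
    unfolding C_def conj_class_code[OF r] by (simp add: card_image inj_on_subset[OF inj_perm_of])
  show "flat_stratum S5 C N = {theta C :: (_, 'k::field) tensor}" unfolding N[symmetric] by (rule flat_stratum_top)
  show "(flat_stratum S5 C 1 :: (_, 'k) tensor set) = basis_elt ` C" by (rule flat_stratum_1)
  show "(flat_stratum S5 C n :: (_, 'k) tensor set) = {}" if "n \<notin> set Ns"
  proof -
    have "strata r n = []" using Ns that by (auto simp: strata_def filter_empty_conv list_all_iff)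
    then show ?thesis unfolding C_def flat_stratum_code(1)[OF r] by simp
  qed
qed

lemma form_of_sublist:
  assumes "r \<in> set all_perms" "set l \<subseteq> set (class5 r)" "distinct l"
  shows "form_of (sublist_of (class5 r) l) = (sum_list (map (\<lambda>p. basis_elt (perm_of p)) l) :: (_, 'k::field) tensor)"
proof -
  have "set (sublist_of (class5 r) l) = set l" using assms by (auto simp: sublist_of_def)
  then show ?thesis
    using assms(3) by (simp add: indicator_form_def sum.reindex inj_on_subset[OF inj_perm_of] sum_list_distinct_conv_sum_set)
qed

lemma flat_stratum_listed:
  assumes r: "r \<in> set all_perms" and Q: "set (strata r n) = set (map (sublist_of (class5 r)) (map (map cyc5) LL))"
    and LL: "list_all (\<lambda>l. distinct l \<and> list_all (List.member (class5 r)) l) (map (map cyc5) LL)"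
  shows "(flat_stratum S5 (class5_of r) n :: (_, 'k::field) tensor set) =
    set (map (\<lambda>l. sum_list (map (\<lambda>css. basis_elt (cyc (map (map num_of) css))) l)) LL)"
  unfolding flat_stratum_code(1)[OF r] Q set_map image_image
proof (intro image_cong refl)
  fix l assume "l \<in> set LL"
  then have "set (map cyc5 l) \<subseteq> set (class5 r)" "distinct (map cyc5 l)"
    using LL by (auto simp: list_all_iff)
  from form_of_sublist[OF r this]
  show "form_of (sublist_of (class5 r) (map cyc5 l)) =
      (sum_list (map (\<lambda>css. basis_elt (cyc (map (map num_of) css))) l) :: (_, 'k) tensor)"
    by (simp only: map_map o_def cyc_map)
qed

section \<open>Parity\<close>

lemma mul5_all_perms: "p \<in> set all_perms \<Longrightarrow> q \<in> set all_perms \<Longrightarrow> mul5 p q \<in> set all_perms"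
proof -
  assume "p \<in> set all_perms" "q \<in> set all_perms"
  moreover have "app (mul5 p q) = app p \<circ> app q" by (rule ext) (simp add: mul5_def)
  ultimately show ?thesis unfolding in_all_perms_iff by (auto intro: inj_compose)
qed

lemma evenperm_mul5:
  assumes "p \<in> set all_perms" "q \<in> set all_perms"
  shows "evenperm (perm_of (mul5 p q)) \<longleftrightarrow> (evenperm (perm_of p) \<longleftrightarrow> evenperm (perm_of q))"
  unfolding perm_of_mul5 using assms by (intro evenperm_comp sym_group_carrier'[of _ 5] perm_of_carrier)

text \<open>Each transposition flips both the flag and the parity of the current permutation, so
  whether the two agree is an invariant. In \<open>even5_iff\<close> the process ends at the
  identity, where the flag is then the parity of the input.\<close>

lemma clear_letter_parity:
  assumes "p \<in> set all_perms"
  shows "snd (clear_letter l (s, p)) \<in> set all_perms"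
    and "(fst (clear_letter l (s, p)) \<longleftrightarrow> evenperm (perm_of (snd (clear_letter l (s, p))))) \<longleftrightarrow> (s \<longleftrightarrow> evenperm (perm_of p))"
proof -
  have t: "tr5 a b \<in> set all_perms" for a b by (auto simp: in_all_perms_iff tr5_def inj_def)
  have "evenperm (perm_of (tr5 a b)) \<longleftrightarrow> a = b" for a b by (simp add: perm_of_tr5 evenperm_swap)
  then show "snd (clear_letter l (s, p)) \<in> set all_perms"
    "(fst (clear_letter l (s, p)) \<longleftrightarrow> evenperm (perm_of (snd (clear_letter l (s, p))))) \<longleftrightarrow> (s \<longleftrightarrow> evenperm (perm_of p))"
    using assms t by (auto simp: mul5_all_perms evenperm_mul5)
qed

lemma even5_iff: "p \<in> set all_perms \<Longrightarrow> even5 p \<longleftrightarrow> evenperm (perm_of p)"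
proof -
  assume p: "p \<in> set all_perms"
  define P where "P sp \<longleftrightarrow> snd sp \<in> set all_perms \<and> ((fst sp \<longleftrightarrow> evenperm (perm_of (snd sp))) \<longleftrightarrow> evenperm (perm_of p))" for sp
  have step: "P (clear_letter l sp)" if "P sp" for l sp
    using that clear_letter_parity[of "snd sp" l "fst sp"] unfolding P_def by auto
  let ?x = "clear_letter L2 (clear_letter L3 (clear_letter L4 (clear_letter L5 (True, p))))"
  have "P ?x" using p by (intro step) (simp add: P_def)
  moreover have "snd ?x = tabulate (\<lambda>l. l)" using clear_letter_all p by (simp add: list_all_iff)
  ultimately show ?thesis by (simp add: P_def even5_def perm_of_id evenperm_id)
qed

lemma perm_of_cycle_code: "perm_of (cycle_code p) = cyc [map (perm_of p) [1, 2, 3, 4, 5]]"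
proof -
  obtain a b c d e where p: "p = P5 a b c d e" by (cases p)
  have "map (perm_of p) [1, 2, 3, 4, 5] = map num_of [a, b, c, d, e]"
    by (simp add: p perm_of_def)
  then show ?thesis using cyc_map[of "[[a, b, c, d, e]]"] by (simp add: p)
qed

text \<open>Conjugation relabels a cycle, so the parity of its labelling changes by the parity of
  \<open>g\<close>. This is what produces the sign representation.\<close>

lemma conj5_cycle_code:
  assumes "g \<in> set all_perms" "p \<in> set all_perms"
  shows "conj5 g (cycle_code p) = cycle_code (mul5 g p)"
proof -
  have cyc: "cycle (map (perm_of p) [1, 2, 3, 4, 5])"
    using permutes_inj[OF perm_of_permutes[OF assms(2)]] by (simp add: inj_eq)
  have "bij (perm_of g)" using perm_of_permutes[OF assms(1)] by (rule permutes_bij)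
  note eq = conjugation_of_cycle[OF cyc this]
  have "cycle_code p \<in> set all_perms"
  proof -
    have "cycle_of_list (map (perm_of p) [1, 2, 3, 4, 5]) permutes {1..5}"
      using cycle_permutes[of "map (perm_of p) [1, 2, 3, 4, 5]"] permutes_in_image[OF perm_of_permutes[OF assms(2)]]
      by (auto intro: permutes_subset simp del: One_nat_def)
    then have "perm_of (cycle_code p) \<in> carrier S5" by (simp add: sym_group_carrier perm_of_cycle_code cyc_def)
    then show ?thesis by (auto simp: carrier_S5)
  qed
  then have "perm_of (conj5 g (cycle_code p)) = perm_of g \<circ> perm_of (cycle_code p) \<circ> inv' (perm_of g)"
    using perm_of_conj5(1)[OF assms(1)] assms(1) by (simp add: mult_S5 perm_of_carrier)
  also have "\<dots> = perm_of (cycle_code (mul5 g p))"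
    using eq unfolding perm_of_cycle_code perm_of_mul5 cyc_def by (simp add: o_assoc)
  finally show ?thesis by simp
qed

lemma five_cycles:
  fixes r E O' Q
  defines "r \<equiv> cyc5 [[L1,L2,L3,L4,L5]]"
    and "E \<equiv> sublist_of (class5 r) (map cycle_code (filter even5 all_perms))"
    and "O' \<equiv> sublist_of (class5 r) (map cycle_code (filter (\<lambda>p. \<not> even5 p) all_perms))"
  assumes inC: "list_all (List.member (class5 r)) (map cycle_code all_perms)"
  shows "theta (class5_of r) \<in> span_k (flat_stratum S5 (class5_of r) 12 :: (_, 'k::field_char_0) tensor set)"
    and "rep_iso S5 (stratum_rep S5 (class5_of r) 12 :: ('k, _, _) rep) sign_rep"
    and "(flat_stratum S5 (class5_of r) 12 :: (_, 'k) tensor set) =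
         {(\<Sum>a\<in>{cyc [map \<sigma> [1, 2, 3, 4, 5]] | \<sigma>. \<sigma> \<in> carrier S5 \<and> evenperm \<sigma>}. basis_elt a),
          (\<Sum>a\<in>{cyc [map \<sigma> [1, 2, 3, 4, 5]] | \<sigma>. \<sigma> \<in> carrier S5 \<and> \<not> evenperm \<sigma>}. basis_elt a)}"
proof -
  let ?C = "class5_of r" and ?\<alpha> = "(1, -1) :: int \<times> int"
  have r: "r \<in> set all_perms" unfolding r_def by code_simp
  interpret finite_conj_class S5 ?C using r by (intro finite_conj_class_S5 perm_of_carrier)
  have C: "?C = perm_of ` set (class5 r)" by (rule conj_class_code[OF r])
  have code: "distinct [E, O']" "covers (class5 r) [E, O'] 1" "gram_ok ?\<alpha> [E, O'] 12"
    using parity_code by (simp_all add: r_def E_def O'_def Let_def)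
  have Qn: "set [E, O'] = set (strata r 12)"
    using five_cycle_code by (simp add: r_def E_def O'_def Let_def strata_def)
  have setE: "set E = cycle_code ` {p \<in> set all_perms. even5 p}" and setO: "set O' = cycle_code ` {p \<in> set all_perms. \<not> even5 p}"
    using inC by (auto simp: E_def O'_def sublist_of_def list_all_iff)
  \<comment> \<open>A 5-cycle has five labellings, which differ by even rotations and so share one
    parity. Here this is drawn from \<open>covers\<close> with count 1: no class element lies in
    both lists.\<close>
  have excl: "a \<in> set E \<longleftrightarrow> a \<notin> set O'" if "a \<in> set (class5 r)" for a
    using code(2) that by (auto simp: covers_def list_all_iff split: if_splits)
  have memE: "cycle_code p \<in> set E \<longleftrightarrow> even5 p" if p: "p \<in> set all_perms" for p
  proof -
    have "cycle_code p \<in> set (class5 r)" using inC p by (simp add: list_all_iff)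
    then show ?thesis using excl[of "cycle_code p"] p unfolding setE setO by auto
  qed
  have F: "flat_stratum S5 ?C 12 = (form_of ` set [E, O'] :: (_, 'k) tensor set)"
    unfolding flat_stratum_code(1)[OF r] Qn ..
  have coll: "{cyc [map \<sigma> [1, 2, 3, 4, 5]] | \<sigma>. \<sigma> \<in> carrier S5 \<and> X \<sigma>} = perm_of ` cycle_code ` {p \<in> set all_perms. X (perm_of p)}" for X
    unfolding carrier_S5 image_image perm_of_cycle_code by auto
  show "(flat_stratum S5 ?C 12 :: (_, 'k) tensor set) =
         {(\<Sum>a\<in>{cyc [map \<sigma> [1, 2, 3, 4, 5]] | \<sigma>. \<sigma> \<in> carrier S5 \<and> evenperm \<sigma>}. basis_elt a),
          (\<Sum>a\<in>{cyc [map \<sigma> [1, 2, 3, 4, 5]] | \<sigma>. \<sigma> \<in> carrier S5 \<and> \<not> evenperm \<sigma>}. basis_elt a)}"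
    unfolding F coll by (simp add: setE setO indicator_form_def even5_iff cong: conj_cong)
  interpret S: simplex_forms ?C "set [E, O']" "form_of :: _ \<Rightarrow> (_, 'k) tensor" "weight_fun ?\<alpha>" "of_int 12" "of_nat 1"
    by (rule simplex_code[OF r Qn code(1) _ code(2) _ code(3)]) simp_all
  show th: "theta ?C \<in> span_k (flat_stratum S5 ?C 12 :: (_, 'k) tensor set)"
    unfolding F by (rule S.theta_span)
  let ?T = "pairing ?C (weight_fun ?\<alpha> E) :: (_, 'k) tensor \<Rightarrow> 'k"
  \<comment> \<open>The two sets are complementary in the class, so their weights are negatives of
    each other and a single pairing serves as coordinate.\<close>
  have opp: "pairing ?C (weight_fun ?\<alpha> O') p = - ?T p" for p :: "(_, 'k) tensor"
  proof -
    have "pairing ?C (weight_fun ?\<alpha> O') p = pairing ?C (\<lambda>a. - 1 * weight_fun ?\<alpha> E a) p"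
      using excl by (intro pairing_cong) (auto simp: C weight_fun_perm_of weight_def)
    then show ?thesis unfolding pairing_mult by simp
  qed
  have sgn: "weight_fun ?\<alpha> E (conj_by g a) = sign g * weight_fun ?\<alpha> E a"
    if g: "g \<in> carrier S5" and a: "a \<in> ?C" for g a
  proof -
    obtain h where h: "h \<in> set all_perms" "g = perm_of h" using g by (auto simp: carrier_S5)
    obtain b where b: "b \<in> set (class5 r)" "a = perm_of b" using a by (auto simp: C)
    then obtain p where p: "p \<in> set all_perms" "b = cycle_code p" using excl[OF b(1)] unfolding setE setO by auto
    have "b \<in> set all_perms" using b(1) class5_sub[OF r] by auto
    then have "conj_by g a = perm_of (conj5 h b)"
      unfolding h(2) b(2) by (rule perm_of_conj5(1)[OF h(1)])
    also have "conj5 h b = cycle_code (mul5 h p)" unfolding p(2) by (rule conj5_cycle_code[OF h(1) p(1)])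
    finally show ?thesis
      unfolding b(2) p(2) h(2) using memE h(1) p(1)
      by (simp add: weight_fun_perm_of weight_def mul5_all_perms even5_iff evenperm_mul5 sign_def)
  qed
  show "rep_iso S5 (stratum_rep S5 ?C 12 :: ('k, _, _) rep) sign_rep"
  proof (rule stratum_rep_iso[where T = ?T, OF th])
    show "?T (x + y) = ?T x \<oplus>\<^bsub>sign_rep\<^esub> ?T y" for x y by (simp add: sign_rep_def mk_rep_def pairing_add)
    show "?T (scale c x) = c \<odot>\<^bsub>sign_rep\<^esub> ?T x" for c x by (simp add: sign_rep_def mk_rep_def pairing_scale)
    show "?T x = ?T y \<longleftrightarrow> x - y \<in> span_k {theta ?C}"
      if "x \<in> span_k (flat_stratum S5 ?C 12)" "y \<in> span_k (flat_stratum S5 ?C 12)" for x y :: "(_, 'k) tensor"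
      using S.kernel_diff that unfolding F by (simp add: opp)
    show "?T (Lambda1_act S5 ?C g x) = act sign_rep g (?T x)" if g: "g \<in> carrier S5" for g and x :: "(_, 'k) tensor"
    proof -
      have "?T (Lambda1_act S5 ?C g x) = pairing ?C (\<lambda>a. sign g * weight_fun ?\<alpha> E a) x"
        unfolding pairing_act[OF g] using sgn[OF g] by (intro pairing_cong)
      then show ?thesis by (simp add: pairing_mult sign_rep_def mk_rep_def)
    qed
    show "?T ` span_k (flat_stratum S5 ?C 12) = carrier sign_rep"
    proof (intro equalityI subsetI)
      fix t :: 'k
      have "E \<noteq> O'" using code(1) by simp
      then have "(\<Sum>S\<in>set [E, O']. if S = E then t else - t) = 0" by simp
      then obtain p where "p \<in> span_k (form_of ` set [E, O'])"
        "\<And>S. S \<in> set [E, O'] \<Longrightarrow> pairing ?C (weight_fun ?\<alpha> S) p = (if S = E then t else - t)"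
        by (rule S.onto) blast
      moreover from this(2)[of E] have "t = ?T p" by simp
      ultimately show "t \<in> ?T ` span_k (flat_stratum S5 ?C 12)" unfolding F by blast
    qed (simp add: sign_rep_def mk_rep_def)
  qed
qed

section \<open>The conjugacy classes\<close>

lemma cyc_reps:
  "cyc [[1,2]] = perm_of (cyc5 [[L1,L2]])" "cyc [[1,2],[3,4]] = perm_of (cyc5 [[L1,L2],[L3,L4]])"
  "cyc [[1,2,3]] = perm_of (cyc5 [[L1,L2,L3]])" "cyc [[1,2,3],[4,5]] = perm_of (cyc5 [[L1,L2,L3],[L4,L5]])"
  "cyc [[1,2,3,4]] = perm_of (cyc5 [[L1,L2,L3,L4]])" "cyc [[1,2,3,4,5]] = perm_of (cyc5 [[L1,L2,L3,L4,L5]])"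
  unfolding cyc_map[symmetric] by (simp_all only: list.map num_of.simps)

lemma conj_class_eqI:
  assumes "r \<in> set all_perms" "p \<in> set (class5 r)"
  shows "conj_class S5 (perm_of p) = class5_of r"
proof -
  have x: "perm_of r \<in> carrier S5" using assms(1) by (rule perm_of_carrier)
  have "perm_of p \<in> class5_of r" using assms by (simp add: conj_class_code)
  then obtain h where h: "h \<in> carrier S5" "perm_of p = h \<otimes>\<^bsub>S5\<^esub> perm_of r \<otimes>\<^bsub>S5\<^esub> inv\<^bsub>S5\<^esub> h"
    by (auto simp: conj_class_def)
  have y: "perm_of p \<in> carrier S5" unfolding h(2) using h(1) x by (simp del: sym_group_inv_equality)
  have r: "perm_of r = inv\<^bsub>S5\<^esub> h \<otimes>\<^bsub>S5\<^esub> perm_of p \<otimes>\<^bsub>S5\<^esub> inv\<^bsub>S5\<^esub> (inv\<^bsub>S5\<^esub> h)"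
    unfolding h(2) using h(1) x by (simp add: S5.m_assoc S5.inv_solve_left del: sym_group_inv_equality)
  show ?thesis
  proof
    show "conj_class S5 (perm_of p) \<subseteq> class5_of r"
      using finite_conj_class.conj_C[OF finite_conj_class_S5[OF x]] \<open>perm_of p \<in> class5_of r\<close>
      by (auto simp: conj_class_def[of S5 "perm_of p"])
    have "perm_of r \<in> conj_class S5 (perm_of p)"
      unfolding conj_class_def using r h(1) S5.inv_closed by blast
    then show "class5_of r \<subseteq> conj_class S5 (perm_of p)"
      using finite_conj_class.conj_C[OF finite_conj_class_S5[OF y]]
      by (auto simp: conj_class_def[of S5 "perm_of r"])
  qed
qed

lemma reps_all_perms: "list_all (\<lambda>css. List.member all_perms (cyc5 css) \<and> cyc5 css \<noteq> tabulate (\<lambda>l. l))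
    [[[L1,L2]], [[L1,L2],[L3,L4]], [[L1,L2,L3]], [[L1,L2,L3],[L4,L5]], [[L1,L2,L3,L4]], [[L1,L2,L3,L4,L5]]]"
  by code_simp

lemma rep_mem:
  "cyc5 [[L1,L2]] \<in> set all_perms" "cyc5 [[L1,L2],[L3,L4]] \<in> set all_perms" "cyc5 [[L1,L2,L3]] \<in> set all_perms"
  "cyc5 [[L1,L2,L3],[L4,L5]] \<in> set all_perms" "cyc5 [[L1,L2,L3,L4]] \<in> set all_perms" "cyc5 [[L1,L2,L3,L4,L5]] \<in> set all_perms"
  using reps_all_perms by simp_all

lemma rep_ne_id:
  "perm_of (cyc5 [[L1,L2]]) \<noteq> id" "perm_of (cyc5 [[L1,L2],[L3,L4]]) \<noteq> id" "perm_of (cyc5 [[L1,L2,L3]]) \<noteq> id"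
  "perm_of (cyc5 [[L1,L2,L3],[L4,L5]]) \<noteq> id" "perm_of (cyc5 [[L1,L2,L3,L4]]) \<noteq> id" "perm_of (cyc5 [[L1,L2,L3,L4,L5]]) \<noteq> id"
  using reps_all_perms unfolding perm_of_id[symmetric] perm_of_eq_iff by simp_all

text \<open>Exhaustion is the evaluated fact \<open>classes_cover\<close>: with the identity, the
  six classes account for all 1 + 10 + 15 + 20 + 20 + 30 + 24 = 120 permutations.\<close>

lemma nontrivial_classes:
  "{conj_class S5 x | x. x \<in> carrier S5 \<and> x \<noteq> \<one>\<^bsub>S5\<^esub>} =
      (\<lambda>css. conj_class S5 (cyc css)) `
        {[[1,2]], [[1,2],[3,4]], [[1,2,3]], [[1,2,3],[4,5]], [[1,2,3,4]], [[1,2,3,4,5]]}" (is "?L = ?R")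
proof -
  let ?reps = "[cyc5 [[L1,L2]], cyc5 [[L1,L2],[L3,L4]], cyc5 [[L1,L2,L3]], cyc5 [[L1,L2,L3],[L4,L5]],
    cyc5 [[L1,L2,L3,L4]], cyc5 [[L1,L2,L3,L4,L5]]]"
  have R: "?R = (\<lambda>r. class5_of r) ` set ?reps"
    by (simp only: image_insert image_empty cyc_reps list.set)
  have mem: "r \<in> set all_perms \<and> perm_of r \<noteq> id" if "r \<in> set ?reps" for r
    using that rep_mem rep_ne_id by auto
  show ?thesis unfolding R
  proof (intro equalityI subsetI)
    fix X assume "X \<in> ?L"
    then obtain x where x: "x \<in> carrier S5" "x \<noteq> id" "X = conj_class S5 x" by (auto simp: sym_group_one)
    then obtain p where p: "p \<in> set all_perms" "x = perm_of p" by (auto simp: carrier_S5)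
    then have "p \<noteq> tabulate (\<lambda>l. l)" using x(2) by (auto simp: perm_of_id)
    then obtain r where r: "r \<in> set ?reps" "p \<in> set (class5 r)" using p(1) classes_cover by auto
    then have "X = class5_of r" using conj_class_eqI[of r p] mem x(3) p(2) by auto
    then show "X \<in> (\<lambda>r. class5_of r) ` set ?reps" using r(1) by blast
  next
    fix X assume "X \<in> (\<lambda>r. class5_of r) ` set ?reps"
    then obtain r where r: "r \<in> set ?reps" "X = class5_of r" by blast
    then show "X \<in> ?L" using mem[OF r(1)] perm_of_carrier[of r] by (auto simp: sym_group_one)
  qed
qed

lemma strata_filter:
  "filter (\<lambda>l. length l = n) (subracks r) = strata r n"
  by (simp add: strata_def)

lemmas strata_codes =
  transposition_code[unfolded Let_def strata_filter list.map list.inject]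
  double_transposition_code[unfolded Let_def strata_filter list.map list.inject]
  three_cycle_code[unfolded Let_def strata_filter list.map list.inject]
  order_six_code[unfolded Let_def strata_filter list.map list.inject]
  four_cycle_code[unfolded Let_def strata_filter list.map list.inject]
  five_cycle_code[unfolded Let_def strata_filter list.map list.inject]

section \<open>The strata and the submaximal representation of each class\<close>

lemma transposition_class:
  fixes C and F :: "nat \<Rightarrow> (nat \<Rightarrow> nat, 'k::field_char_0) tensor set"
  defines "F \<equiv> flat_stratum S5 C" and "C \<equiv> conj_class S5 (cyc [[1,2]])"
  shows "card C = 10" "F 10 = {theta C}"
    "F 6 = (\<lambda>i. theta C - theta_through C i) ` {1..5}"
    "card (F 4) = 10"
    "card (F 3) = 10"
    "card (F 2) = 15"
    "F 1 = basis_elt ` C"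
    "\<forall>n\<ge>1. n \<notin> {1, 2, 3, 4, 6, 10} \<longrightarrow> F n = {}"
    "theta C \<in> span_k (F 6)"
    "rep_iso S5 (stratum_rep S5 C 6 :: ('k, _, _) rep) fund_rep"
proof -
  let ?r = "cyc5 [[L1,L2]]"
  have C: "C = conj_class S5 (perm_of ?r)" unfolding C_def cyc_reps ..
  note r = rep_mem(1) and code = strata_codes(1)
  note sum = strata_summary[OF r code[THEN conjunct1] code[THEN conjunct2, THEN conjunct2, THEN conjunct1], folded C]
  show "card C = 10" "F 10 = {theta C}"
    "F 1 = basis_elt ` C"
    unfolding F_def by (fact sum(1), fact sum(2), fact sum(3))
  show "\<forall>n\<ge>1. n \<notin> {1, 2, 3, 4, 6, 10} \<longrightarrow> F n = {}"
    unfolding F_def by (intro allI impI sum(4)) auto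
  show "card (F 4) = 10" "card (F 3) = 10"
    "card (F 2) = 15"
    unfolding F_def C flat_stratum_code(2)[OF r] using code by simp_all
  have Q: "set (map (fixing ?r) letters) = set (strata ?r 6)" using code by simp
  have "perm_of ?r = cycle_of_list [1, 2]" unfolding cyc_reps(1)[symmetric] by (simp add: cyc_def)
  from flat_stratum_fixing[OF r this _ _ Q]
  show "F 6 = (\<lambda>i. theta C - theta_through C i) ` {1..5}"
    using rep_ne_id unfolding F_def C by simp
  have fixed: "distinct (map (fixing ?r) letters)" "covers (class5 ?r) (map (fixing ?r) letters) 3"
    "gram_ok (2, -3) (map (fixing ?r) letters) 3"
    using transposition_fixing_code by (simp_all only: Let_def)
  show "theta C \<in> span_k (F 6)"
    "rep_iso S5 (stratum_rep S5 C 6 :: ('k, _, _) rep) fund_rep"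
    unfolding F_def C by (rule fund_iso[OF r Q fixed(1,2) _ fixed(3)], simp, simp)+
qed

lemma three_cycle_class:
  fixes C and F :: "nat \<Rightarrow> (nat \<Rightarrow> nat, 'k::field_char_0) tensor set"
  defines "F \<equiv> flat_stratum S5 C" and "C \<equiv> conj_class S5 (cyc [[1,2,3]])"
  shows "card C = 20" "F 20 = {theta C}"
    "F 8 = (\<lambda>i. theta C - theta_through C i) ` {1..5}"
    "card (F 4) = 10"
    "card (F 2) = 10"
    "F 1 = basis_elt ` C"
    "\<forall>n\<ge>1. n \<notin> {1, 2, 4, 8, 20} \<longrightarrow> F n = {}"
    "theta C \<in> span_k (F 8)"
    "rep_iso S5 (stratum_rep S5 C 8 :: ('k, _, _) rep) fund_rep"
proof -
  let ?r = "cyc5 [[L1,L2,L3]]"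
  have C: "C = conj_class S5 (perm_of ?r)" unfolding C_def cyc_reps ..
  note r = rep_mem(3) and code = strata_codes(3)
  note sum = strata_summary[OF r code[THEN conjunct1] code[THEN conjunct2, THEN conjunct2, THEN conjunct1], folded C]
  show "card C = 20" "F 20 = {theta C}"
    "F 1 = basis_elt ` C"
    unfolding F_def by (fact sum(1), fact sum(2), fact sum(3))
  show "\<forall>n\<ge>1. n \<notin> {1, 2, 4, 8, 20} \<longrightarrow> F n = {}"
    unfolding F_def by (intro allI impI sum(4)) auto
  show "card (F 4) = 10" "card (F 2) = 10"
    unfolding F_def C flat_stratum_code(2)[OF r] using code by simp_all
  have Q: "set (map (fixing ?r) letters) = set (strata ?r 8)" using code by simp
  have "perm_of ?r = cycle_of_list [1, 2, 3]" unfolding cyc_reps(3)[symmetric] by (simp add: cyc_def)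
  from flat_stratum_fixing[OF r this _ _ Q]
  show "F 8 = (\<lambda>i. theta C - theta_through C i) ` {1..5}"
    using rep_ne_id unfolding F_def C by simp
  have fixed: "distinct (map (fixing ?r) letters)" "covers (class5 ?r) (map (fixing ?r) letters) 2"
    "gram_ok (3, -2) (map (fixing ?r) letters) 6"
    using three_cycle_fixing_code by (simp_all only: Let_def)
  show "theta C \<in> span_k (F 8)"
    "rep_iso S5 (stratum_rep S5 C 8 :: ('k, _, _) rep) fund_rep"
    unfolding F_def C by (rule fund_iso[OF r Q fixed(1,2) _ fixed(3)], simp, simp)+
qed

lemma six_weights_hexad:
  assumes "r \<in> set all_perms" "s = 1 \<or> s = - 1" "fst \<alpha> \<noteq> snd \<alpha>" "six_ok (class5 r) \<alpha> s (hexad sel r)"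
  shows "six_weights r \<alpha> s (hexad sel r)"
  using assms
  by unfold_locales (auto simp: hexad_def Let_def sublist_of_def intro!: filter_cong)

lemma rep5bar_of_hexad:
  assumes r: "r \<in> set all_perms" and ok: "six_ok (class5 r) \<alpha> 1 (hexad sel r)" "fst \<alpha> \<noteq> snd \<alpha>"
    and hex: "set (hexad sel r) = set (strata r n)" "covers (class5 r) (hexad sel r) R" "R > 0"
      "gram_ok \<alpha> (hexad sel r) K" "K \<noteq> 0"
  shows "theta (class5_of r) \<in> span_k (flat_stratum S5 (class5_of r) n :: (_, 'k::field_char_0) tensor set)"
    and "\<exists>\<rho> :: (nat \<Rightarrow> nat) \<Rightarrow> 'k ^ 5 ^ 5. is_rep5bar \<rho> \<and>
      rep_iso S5 (stratum_rep S5 (class5_of r) n) (rep_of_matrices \<rho>)"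
proof -
  interpret six_weights r \<alpha> 1 "hexad sel r"
    using r ok by (intro six_weights_hexad) simp_all
  show "theta C \<in> span_k (flat_stratum S5 C n :: (_, 'k) tensor set)" by (rule iso_rho(1)[OF hex])
  have "is_rep5bar (rho :: _ \<Rightarrow> 'k ^ 5 ^ 5)"
    unfolding is_rep5bar_def using irreducible trace_12 by (intro conjI exI[of _ "- 1"]) simp_all
  then show "\<exists>\<rho> :: (nat \<Rightarrow> nat) \<Rightarrow> 'k ^ 5 ^ 5. is_rep5bar \<rho> \<and>
      rep_iso S5 (stratum_rep S5 C n) (rep_of_matrices \<rho>)"
    using iso_rho(2)[OF hex] by blast
qed

lemma dihedral_table_listed: "list_all (\<lambda>l. distinct l \<and> list_all (List.member (class5 (cyc5 [[L1,L2],[L3,L4]]))) l) (map (map cyc5) dihedral_table)"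
  by code_simp

lemma frobenius_table_listed: "list_all (\<lambda>l. distinct l \<and> list_all (List.member (class5 (cyc5 [[L1,L2,L3,L4]]))) l) (map (map cyc5) frobenius_table)"
  by code_simp

lemma double_transposition_class:
  fixes C and F :: "nat \<Rightarrow> (nat \<Rightarrow> nat, 'k::field_char_0) tensor set"
    and e :: "nat list list \<Rightarrow> (nat \<Rightarrow> nat, 'k) tensor"
  defines "F \<equiv> flat_stratum S5 C" and "C \<equiv> conj_class S5 (cyc [[1,2],[3,4]])" and "e \<equiv> (\<lambda>css. basis_elt (cyc css))"
  shows "card C = 15" "F 15 = {theta C}"
    "F 5 =
         {e [[1,4],[2,3]] + e [[1,2],[3,5]] + e [[1,3],[4,5]] + e [[2,5],[3,4]] + e [[1,5],[2,4]],
          e [[1,4],[2,3]] + e [[1,3],[2,5]] + e [[2,4],[3,5]] + e [[1,5],[3,4]] + e [[1,2],[4,5]],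
          e [[1,3],[2,4]] + e [[1,2],[3,5]] + e [[2,3],[4,5]] + e [[1,5],[3,4]] + e [[1,4],[2,5]],
          e [[1,3],[2,4]] + e [[1,5],[2,3]] + e [[2,5],[3,4]] + e [[1,2],[4,5]] + e [[1,4],[3,5]],
          e [[1,2],[3,4]] + e [[1,3],[2,5]] + e [[2,3],[4,5]] + e [[1,5],[2,4]] + e [[1,4],[3,5]],
          e [[1,2],[3,4]] + e [[1,5],[2,3]] + e [[2,4],[3,5]] + e [[1,4],[2,5]] + e [[1,3],[4,5]]}" (is "_ = ?table")
    "card (F 5) = 6"
    "card (F 3) = 15"
    "card (F 2) = 15"
    "F 1 = basis_elt ` C"
    "\<forall>n\<ge>1. n \<notin> {1, 2, 3, 5, 15} \<longrightarrow> F n = {}"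
    "theta C \<in> span_k (F 5)"
    "\<exists>\<rho> :: (nat \<Rightarrow> nat) \<Rightarrow> 'k ^ 5 ^ 5. is_rep5bar \<rho> \<and> rep_iso S5 (stratum_rep S5 C 5) (rep_of_matrices \<rho>)"
proof -
  let ?r = "cyc5 [[L1,L2],[L3,L4]]"
  have C: "C = conj_class S5 (perm_of ?r)" unfolding C_def cyc_reps ..
  note r = rep_mem(2) and code = strata_codes(2)
  note sum = strata_summary[OF r code[THEN conjunct1] code[THEN conjunct2, THEN conjunct2, THEN conjunct1], folded C]
  show "card C = 15" "F 15 = {theta C}"
    "F 1 = basis_elt ` C"
    unfolding F_def by (fact sum(1), fact sum(2), fact sum(3))
  show "\<forall>n\<ge>1. n \<notin> {1, 2, 3, 5, 15} \<longrightarrow> F n = {}"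
    unfolding F_def by (intro allI impI sum(4)) auto
  show "card (F 5) = 6" "card (F 3) = 15"
    "card (F 2) = 15"
    unfolding F_def C flat_stratum_code(2)[OF r] using code by simp_all
  have "set (strata ?r 5) = set (map (sublist_of (class5 ?r)) (map (map cyc5) dihedral_table))" using code by simp
  from flat_stratum_listed[OF r this dihedral_table_listed, where 'k = 'k]
  show "F 5 = ?table"
    unfolding F_def C e_def dihedral_table_def
    \<comment> \<open>\<open>sum_list\<close> nests its sums to the right and ends in 0, while the
      sums of the table nest to the left; \<open>add_0_right\<close> and \<open>add.assoc\<close>
      reconcile the two.\<close>
    by (simp only: list.map list.set num_of.simps sum_list.Cons sum_list.Nil add_0_right add.assoc)
  have "set (hexad dihedral ?r) = set (strata ?r 5)" "covers (class5 ?r) (hexad dihedral ?r) 2"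
    "gram_ok (2, -1) (hexad dihedral ?r) 2"
    using dihedral_code by (simp_all only: Let_def)
  note hexad = rep5bar_of_hexad[OF r dihedral_six _ this(1,2) _ this(3), where 'k = 'k]
  show "theta C \<in> span_k (F 5)"
    "\<exists>\<rho> :: (nat \<Rightarrow> nat) \<Rightarrow> 'k ^ 5 ^ 5. is_rep5bar \<rho> \<and> rep_iso S5 (stratum_rep S5 C 5) (rep_of_matrices \<rho>)"
    unfolding F_def C by (rule hexad; simp)+
qed

lemma four_cycle_class:
  fixes C and F :: "nat \<Rightarrow> (nat \<Rightarrow> nat, 'k::field_char_0) tensor set"
    and e :: "nat list list \<Rightarrow> (nat \<Rightarrow> nat, 'k) tensor"
  defines "F \<equiv> flat_stratum S5 C" and "C \<equiv> conj_class S5 (cyc [[1,2,3,4]])" and "e \<equiv> (\<lambda>css. basis_elt (cyc css))"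
  shows "card C = 30" "F 30 = {theta C}"
    "F 10 =
         {e [[1,2,3,4]] + e [[1,5,2,3]] + e [[2,4,3,5]] + e [[2,5,3,4]] + e [[1,2,4,5]]
            + e [[1,5,4,2]] + e [[1,3,5,4]] + e [[1,4,5,3]] + e [[1,4,3,2]] + e [[1,3,2,5]],
          e [[1,2,3,4]] + e [[1,2,5,3]] + e [[2,4,5,3]] + e [[2,3,5,4]] + e [[1,5,2,4]]
            + e [[1,4,2,5]] + e [[1,3,4,5]] + e [[1,5,4,3]] + e [[1,4,3,2]] + e [[1,3,5,2]],
          e [[1,2,4,3]] + e [[1,3,4,2]] + e [[1,5,3,2]] + e [[1,2,3,5]] + e [[2,3,4,5]]
            + e [[2,5,4,3]] + e [[1,5,2,4]] + e [[1,4,2,5]] + e [[1,3,5,4]] + e [[1,4,5,3]],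
          e [[1,5,2,3]] + e [[2,4,5,3]] + e [[2,3,5,4]] + e [[1,2,4,3]] + e [[1,4,5,2]]
            + e [[1,2,5,4]] + e [[1,5,3,4]] + e [[1,4,3,5]] + e [[1,3,4,2]] + e [[1,3,2,5]],
          e [[1,5,3,2]] + e [[2,4,3,5]] + e [[2,5,3,4]] + e [[1,4,5,2]] + e [[1,2,5,4]]
            + e [[1,3,4,5]] + e [[1,3,2,4]] + e [[1,5,4,3]] + e [[1,4,2,3]] + e [[1,2,3,5]],
          e [[1,2,5,3]] + e [[2,3,4,5]] + e [[2,5,4,3]] + e [[1,2,4,5]] + e [[1,5,4,2]]
            + e [[1,5,3,4]] + e [[1,4,3,5]] + e [[1,3,2,4]] + e [[1,4,2,3]] + e [[1,3,5,2]]}" (is "_ = ?table")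
    "card (F 10) = 6"
    "F 6 = (\<lambda>i. theta C - theta_through C i) ` {1..5}"
    "card (F 5) = 12"
    "card (F 2) = 15"
    "F 1 = basis_elt ` C"
    "\<forall>n\<ge>1. n \<notin> {1, 2, 5, 6, 10, 30} \<longrightarrow> F n = {}"
    "theta C \<in> span_k (F 10)"
    "\<exists>\<rho> :: (nat \<Rightarrow> nat) \<Rightarrow> 'k ^ 5 ^ 5. is_rep5bar \<rho> \<and> rep_iso S5 (stratum_rep S5 C 10) (rep_of_matrices \<rho>)"
proof -
  let ?r = "cyc5 [[L1,L2,L3,L4]]"
  have C: "C = conj_class S5 (perm_of ?r)" unfolding C_def cyc_reps ..
  note r = rep_mem(5) and code = strata_codes(5)
  note sum = strata_summary[OF r code[THEN conjunct1] code[THEN conjunct2, THEN conjunct2, THEN conjunct1], folded C]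
  show "card C = 30" "F 30 = {theta C}"
    "F 1 = basis_elt ` C"
    unfolding F_def by (fact sum(1), fact sum(2), fact sum(3))
  show "\<forall>n\<ge>1. n \<notin> {1, 2, 5, 6, 10, 30} \<longrightarrow> F n = {}"
    unfolding F_def by (intro allI impI sum(4)) auto
  show "card (F 10) = 6" "card (F 5) = 12"
    "card (F 2) = 15"
    unfolding F_def C flat_stratum_code(2)[OF r] using code by simp_all
  have Q: "set (map (fixing ?r) letters) = set (strata ?r 6)" using code by simp
  have "perm_of ?r = cycle_of_list [1, 2, 3, 4]" unfolding cyc_reps(5)[symmetric] by (simp add: cyc_def)
  from flat_stratum_fixing[OF r this _ _ Q]
  show "F 6 = (\<lambda>i. theta C - theta_through C i) ` {1..5}"
    using rep_ne_id unfolding F_def C by simp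
  have "set (strata ?r 10) = set (map (sublist_of (class5 ?r)) (map (map cyc5) frobenius_table))" using code by simp
  from flat_stratum_listed[OF r this frobenius_table_listed, where 'k = 'k]
  show "F 10 = ?table"
    unfolding F_def C e_def frobenius_table_def
    by (simp only: list.map list.set num_of.simps sum_list.Cons sum_list.Nil add_0_right add.assoc)
  have "set (hexad frobenius ?r) = set (strata ?r 10)" "covers (class5 ?r) (hexad frobenius ?r) 2"
    "gram_ok (2, -1) (hexad frobenius ?r) 4"
    using frobenius_code by (simp_all only: Let_def)
  note hexad = rep5bar_of_hexad[OF r frobenius_six _ this(1,2) _ this(3), where 'k = 'k]
  show "theta C \<in> span_k (F 10)"
    "\<exists>\<rho> :: (nat \<Rightarrow> nat) \<Rightarrow> 'k ^ 5 ^ 5. is_rep5bar \<rho> \<and> rep_iso S5 (stratum_rep S5 C 10) (rep_of_matrices \<rho>)"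
    unfolding F_def C by (rule hexad; simp)+
qed

lemma pair_code_listed: "list_all distinct (map pair_code all_perms)"
  "list_all (List.member (class5 (cyc5 [[L1,L2,L3],[L4,L5]]))) (concat (map pair_code all_perms))"
  by code_simp+

lemma cycle_code_listed: "list_all (List.member (class5 (cyc5 [[L1,L2,L3,L4,L5]]))) (map cycle_code all_perms)"
  by code_simp

lemma order_six_class:
  fixes C and F :: "nat \<Rightarrow> (nat \<Rightarrow> nat, 'k::field_char_0) tensor set"
    and e :: "nat list list \<Rightarrow> (nat \<Rightarrow> nat, 'k) tensor"
  defines "F \<equiv> flat_stratum S5 C" and "C \<equiv> conj_class S5 (cyc [[1,2,3],[4,5]])" and "e \<equiv> (\<lambda>css. basis_elt (cyc css))"
  shows "card C = 20" "F 20 = {theta C}"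
    "F 2 = {e [[x,y,z],[i,j]] + e [[x,z,y],[i,j]] | x y z i j.
           distinct [x, y, z, i, j] \<and> {x, y, z, i, j} = {1..5}}" (is "_ = ?table")
    "card (F 2) = 10"
    "F 1 = basis_elt ` C"
    "\<forall>n\<ge>1. n \<notin> {1, 2, 20} \<longrightarrow> F n = {}"
    "theta C \<in> span_k (F 2)"
    "\<exists>\<rho> :: (nat \<Rightarrow> nat) \<Rightarrow> 'k ^ 5 ^ 5. is_rep5 \<rho>
       \<and> rep_iso S5 (stratum_rep S5 C 2) (rep_sum fund_rep (rep_of_matrices \<rho>))"
proof -
  let ?r = "cyc5 [[L1,L2,L3],[L4,L5]]"
  have C: "C = conj_class S5 (perm_of ?r)" unfolding C_def cyc_reps ..
  note r = rep_mem(4) and code = strata_codes(4)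
  note sum = strata_summary[OF r code[THEN conjunct1] code[THEN conjunct2, THEN conjunct2, THEN conjunct1], folded C]
  show "card C = 20" "F 20 = {theta C}"
    "F 1 = basis_elt ` C"
    unfolding F_def by (fact sum(1), fact sum(2), fact sum(3))
  show "\<forall>n\<ge>1. n \<notin> {1, 2, 20} \<longrightarrow> F n = {}"
    unfolding F_def by (intro allI impI sum(4)) auto
  show "card (F 2) = 10"
    unfolding F_def C flat_stratum_code(2)[OF r] using code by simp
  have "set (strata ?r 2) = set (map (sublist_of (class5 ?r)) (map pair_code all_perms))" using code by simp
  then have F2: "F 2 = (\<lambda>p. form_of (sublist_of (class5 ?r) (pair_code p)) :: (_, 'k) tensor) ` set all_perms"
    unfolding F_def C flat_stratum_code(1)[OF r] by (simp add: image_image)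
  have form: "form_of (sublist_of (class5 ?r) (pair_code (P5 a b c d f))) =
      e [[num_of a, num_of b, num_of c], [num_of d, num_of f]] + e [[num_of a, num_of c, num_of b], [num_of d, num_of f]]"
    if "P5 a b c d f \<in> set all_perms" for a b c d f
  proof -
    have "set (pair_code (P5 a b c d f)) \<subseteq> set (class5 ?r)" "distinct (pair_code (P5 a b c d f))"
      using pair_code_listed that by (auto simp: list_all_iff simp del: pair_code.simps)
    from form_of_sublist[OF r this] show ?thesis
      using cyc_map[of "[[a, b, c], [d, f]]"] cyc_map[of "[[a, c, b], [d, f]]"] by (simp add: e_def)
  qed
  show "F 2 = ?table"
  proof (intro equalityI subsetI)
    fix t assume "t \<in> F 2"
    then obtain q where q: "q \<in> set all_perms" "t = form_of (sublist_of (class5 ?r) (pair_code q))"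
      unfolding F2 by blast
    obtain a b c d f where "q = P5 a b c d f" by (cases q)
    note p = q[unfolded this]
    have inj: "inj (app (P5 a b c d f))" using p(1) by (simp add: in_all_perms_iff)
    then have dist: "distinct [num_of a, num_of b, num_of c, num_of d, num_of f]"
      by (auto dest: injD[of _ L1 L2] injD[of _ L1 L3] injD[of _ L1 L4] injD[of _ L1 L5] injD[of _ L2 L3]
        injD[of _ L2 L4] injD[of _ L2 L5] injD[of _ L3 L4] injD[of _ L3 L5] injD[of _ L4 L5])
    have "{num_of a, num_of b, num_of c, num_of d, num_of f} \<subseteq> {1..5}" using num_of_range by auto
    moreover have "card {num_of a, num_of b, num_of c, num_of d, num_of f} = card {1..5 :: nat}"
      using distinct_card[OF dist] by simp
    ultimately have "{num_of a, num_of b, num_of c, num_of d, num_of f} = {1..5}"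
      by (intro card_subset_eq) simp_all
    then show "t \<in> ?table" using p(2) form[OF p(1)] dist by blast
  next
    fix t assume "t \<in> ?table"
    then obtain x y z i j where t: "t = e [[x,y,z],[i,j]] + e [[x,z,y],[i,j]]"
      and dist: "distinct [x, y, z, i, j]" and xs: "{x, y, z, i, j} = {1..5}" by blast
    have "x \<in> range num_of" "y \<in> range num_of" "z \<in> range num_of" "i \<in> range num_of" "j \<in> range num_of"
      unfolding range_num_of xs[symmetric] by simp_all
    then obtain a b c d f where n: "x = num_of a" "y = num_of b" "z = num_of c" "i = num_of d" "j = num_of f" by blast
    have "distinct (map (app (P5 a b c d f)) [L1, L2, L3, L4, L5])" using dist by (simp add: n)
    then have mem: "P5 a b c d f \<in> set all_perms" unfolding in_all_perms_iff UNIV_letter distinct_map by simp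
    show "t \<in> F 2" unfolding F2 t n by (rule image_eqI[OF _ mem]) (rule form[OF mem, symmetric])
  qed
  show "theta C \<in> span_k (F 2)"
    "\<exists>\<rho> :: (nat \<Rightarrow> nat) \<Rightarrow> 'k ^ 5 ^ 5. is_rep5 \<rho>
       \<and> rep_iso S5 (stratum_rep S5 C 2) (rep_sum fund_rep (rep_of_matrices \<rho>))"
    unfolding F_def C by (rule pentagon_iso)+
qed

lemma five_cycle_class:
  fixes C and F :: "nat \<Rightarrow> (nat \<Rightarrow> nat, 'k::field_char_0) tensor set"
  defines "F \<equiv> flat_stratum S5 C" and "C \<equiv> conj_class S5 (cyc [[1,2,3,4,5]])"
  shows "card C = 24" "F 24 = {theta C}"
    "F 12 =
         {(\<Sum>a\<in>{cyc [map \<sigma> [1, 2, 3, 4, 5]] | \<sigma>. \<sigma> \<in> carrier S5 \<and> evenperm \<sigma>}. basis_elt a),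
          (\<Sum>a\<in>{cyc [map \<sigma> [1, 2, 3, 4, 5]] | \<sigma>. \<sigma> \<in> carrier S5 \<and> \<not> evenperm \<sigma>}. basis_elt a)}" (is "_ = ?table")
    "card (F 12) = 2"
    "card (F 4) = 6"
    "card (F 3) = 24"
    "card (F 2) = 36"
    "F 1 = basis_elt ` C"
    "\<forall>n\<ge>1. n \<notin> {1, 2, 3, 4, 12, 24} \<longrightarrow> F n = {}"
    "theta C \<in> span_k (F 12)"
    "rep_iso S5 (stratum_rep S5 C 12 :: ('k, _, _) rep) sign_rep"
proof -
  let ?r = "cyc5 [[L1,L2,L3,L4,L5]]"
  have C: "C = conj_class S5 (perm_of ?r)" unfolding C_def cyc_reps ..
  note r = rep_mem(6) and code = strata_codes(6)
  note sum = strata_summary[OF r code[THEN conjunct1] code[THEN conjunct2, THEN conjunct2, THEN conjunct1], folded C]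
  show "card C = 24" "F 24 = {theta C}"
    "F 1 = basis_elt ` C"
    unfolding F_def by (fact sum(1), fact sum(2), fact sum(3))
  show "\<forall>n\<ge>1. n \<notin> {1, 2, 3, 4, 12, 24} \<longrightarrow> F n = {}"
    unfolding F_def by (intro allI impI sum(4)) auto
  show "card (F 12) = 2" "card (F 4) = 6"
    "card (F 3) = 24" "card (F 2) = 36"
    unfolding F_def C flat_stratum_code(2)[OF r] using code by simp_all
  note five = five_cycles[OF cycle_code_listed, where 'k = 'k]
  show "theta C \<in> span_k (F 12)" unfolding F_def C by (rule five(1))
  show "rep_iso S5 (stratum_rep S5 C 12 :: ('k, _, _) rep) sign_rep" unfolding F_def C by (rule five(2))
  show "F 12 = ?table"
    unfolding F_def C by (rule five(3))
qed

theorem proposition4p4: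
  fixes F :: "(nat \<Rightarrow> nat) set \<Rightarrow> nat \<Rightarrow> (nat \<Rightarrow> nat, 'k::field_char_0) tensor set"
    and V :: "(nat \<Rightarrow> nat) set \<Rightarrow> nat \<Rightarrow> ('k, (nat \<Rightarrow> nat, 'k) tensor set, nat \<Rightarrow> nat) rep"
    and e :: "nat list list \<Rightarrow> (nat \<Rightarrow> nat, 'k) tensor"
    and fund :: "('k, nat \<Rightarrow> 'k, nat \<Rightarrow> nat) rep"
  defines "F \<equiv> flat_stratum S5"
    and "V \<equiv> stratum_rep S5"
    and "e \<equiv> (\<lambda>css. basis_elt (cyc css))"
    and "fund \<equiv> fund_rep"
  shows "{conj_class S5 x | x. x \<in> carrier S5 \<and> x \<noteq> \<one>\<^bsub>S5\<^esub>} =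
      (\<lambda>css. conj_class S5 (cyc css)) `
        {[[1,2]], [[1,2],[3,4]], [[1,2,3]], [[1,2,3],[4,5]], [[1,2,3,4]], [[1,2,3,4,5]]}
    \<and> (let C = conj_class S5 (cyc [[1,2]]) in
        card C = 10
      \<and> F C 10 = {theta C}
      \<and> F C 6 = (\<lambda>i. theta C - theta_through C i) ` {1..5}
      \<and> card (F C 4) = 10
      \<and> card (F C 3) = 10
      \<and> card (F C 2) = 15
      \<and> F C 1 = basis_elt ` C
      \<and> (\<forall>n\<ge>1. n \<notin> {1, 2, 3, 4, 6, 10} \<longrightarrow> F C n = {})
      \<and> theta C \<in> span_k (F C 6)
      \<and> rep_iso S5 (V C 6) fund)
    \<and> (let C = conj_class S5 (cyc [[1,2],[3,4]]) in
        card C = 15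
      \<and> F C 15 = {theta C}
      \<and> F C 5 =
         {e [[1,4],[2,3]] + e [[1,2],[3,5]] + e [[1,3],[4,5]] + e [[2,5],[3,4]] + e [[1,5],[2,4]],
          e [[1,4],[2,3]] + e [[1,3],[2,5]] + e [[2,4],[3,5]] + e [[1,5],[3,4]] + e [[1,2],[4,5]],
          e [[1,3],[2,4]] + e [[1,2],[3,5]] + e [[2,3],[4,5]] + e [[1,5],[3,4]] + e [[1,4],[2,5]],
          e [[1,3],[2,4]] + e [[1,5],[2,3]] + e [[2,5],[3,4]] + e [[1,2],[4,5]] + e [[1,4],[3,5]],
          e [[1,2],[3,4]] + e [[1,3],[2,5]] + e [[2,3],[4,5]] + e [[1,5],[2,4]] + e [[1,4],[3,5]],
          e [[1,2],[3,4]] + e [[1,5],[2,3]] + e [[2,4],[3,5]] + e [[1,4],[2,5]] + e [[1,3],[4,5]]}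
      \<and> card (F C 5) = 6
      \<and> card (F C 3) = 15
      \<and> card (F C 2) = 15
      \<and> F C 1 = basis_elt ` C
      \<and> (\<forall>n\<ge>1. n \<notin> {1, 2, 3, 5, 15} \<longrightarrow> F C n = {})
      \<and> theta C \<in> span_k (F C 5)
      \<and> (\<exists>\<rho> :: (nat \<Rightarrow> nat) \<Rightarrow> 'k ^ 5 ^ 5. is_rep5bar \<rho> \<and> rep_iso S5 (V C 5) (rep_of_matrices \<rho>)))
    \<and> (let C = conj_class S5 (cyc [[1,2,3]]) in
        card C = 20
      \<and> F C 20 = {theta C}
      \<and> F C 8 = (\<lambda>i. theta C - theta_through C i) ` {1..5}
      \<and> card (F C 4) = 10
      \<and> card (F C 2) = 10
      \<and> F C 1 = basis_elt ` C
      \<and> (\<forall>n\<ge>1. n \<notin> {1, 2, 4, 8, 20} \<longrightarrow> F C n = {})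
      \<and> theta C \<in> span_k (F C 8)
      \<and> rep_iso S5 (V C 8) fund)
    \<and> (let C = conj_class S5 (cyc [[1,2,3],[4,5]]) in
        card C = 20
      \<and> F C 20 = {theta C}
      \<and> F C 2 = {e [[x,y,z],[i,j]] + e [[x,z,y],[i,j]] | x y z i j.
           distinct [x, y, z, i, j] \<and> {x, y, z, i, j} = {1..5}}
      \<and> card (F C 2) = 10
      \<and> F C 1 = basis_elt ` C
      \<and> (\<forall>n\<ge>1. n \<notin> {1, 2, 20} \<longrightarrow> F C n = {})
      \<and> theta C \<in> span_k (F C 2)
      \<and> (\<exists>\<rho> :: (nat \<Rightarrow> nat) \<Rightarrow> 'k ^ 5 ^ 5. is_rep5 \<rho>
           \<and> rep_iso S5 (V C 2) (rep_sum fund (rep_of_matrices \<rho>))))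
    \<and> (let C = conj_class S5 (cyc [[1,2,3,4]]) in
        card C = 30
      \<and> F C 30 = {theta C}
      \<and> F C 10 =
         {e [[1,2,3,4]] + e [[1,5,2,3]] + e [[2,4,3,5]] + e [[2,5,3,4]] + e [[1,2,4,5]]
            + e [[1,5,4,2]] + e [[1,3,5,4]] + e [[1,4,5,3]] + e [[1,4,3,2]] + e [[1,3,2,5]],
          e [[1,2,3,4]] + e [[1,2,5,3]] + e [[2,4,5,3]] + e [[2,3,5,4]] + e [[1,5,2,4]]
            + e [[1,4,2,5]] + e [[1,3,4,5]] + e [[1,5,4,3]] + e [[1,4,3,2]] + e [[1,3,5,2]],
          e [[1,2,4,3]] + e [[1,3,4,2]] + e [[1,5,3,2]] + e [[1,2,3,5]] + e [[2,3,4,5]]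
            + e [[2,5,4,3]] + e [[1,5,2,4]] + e [[1,4,2,5]] + e [[1,3,5,4]] + e [[1,4,5,3]],
          e [[1,5,2,3]] + e [[2,4,5,3]] + e [[2,3,5,4]] + e [[1,2,4,3]] + e [[1,4,5,2]]
            + e [[1,2,5,4]] + e [[1,5,3,4]] + e [[1,4,3,5]] + e [[1,3,4,2]] + e [[1,3,2,5]],
          e [[1,5,3,2]] + e [[2,4,3,5]] + e [[2,5,3,4]] + e [[1,4,5,2]] + e [[1,2,5,4]]
            + e [[1,3,4,5]] + e [[1,3,2,4]] + e [[1,5,4,3]] + e [[1,4,2,3]] + e [[1,2,3,5]],
          e [[1,2,5,3]] + e [[2,3,4,5]] + e [[2,5,4,3]] + e [[1,2,4,5]] + e [[1,5,4,2]]
            + e [[1,5,3,4]] + e [[1,4,3,5]] + e [[1,3,2,4]] + e [[1,4,2,3]] + e [[1,3,5,2]]}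
      \<and> card (F C 10) = 6
      \<and> F C 6 = (\<lambda>i. theta C - theta_through C i) ` {1..5}
      \<and> card (F C 5) = 12
      \<and> card (F C 2) = 15
      \<and> F C 1 = basis_elt ` C
      \<and> (\<forall>n\<ge>1. n \<notin> {1, 2, 5, 6, 10, 30} \<longrightarrow> F C n = {})
      \<and> theta C \<in> span_k (F C 10)
      \<and> (\<exists>\<rho> :: (nat \<Rightarrow> nat) \<Rightarrow> 'k ^ 5 ^ 5. is_rep5bar \<rho> \<and> rep_iso S5 (V C 10) (rep_of_matrices \<rho>)))
    \<and> (let C = conj_class S5 (cyc [[1,2,3,4,5]]) in
        card C = 24
      \<and> F C 24 = {theta C}
      \<and> F C 12 =
         {(\<Sum>a\<in>{cyc [map \<sigma> [1, 2, 3, 4, 5]] | \<sigma>. \<sigma> \<in> carrier S5 \<and> evenperm \<sigma>}. basis_elt a),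
          (\<Sum>a\<in>{cyc [map \<sigma> [1, 2, 3, 4, 5]] | \<sigma>. \<sigma> \<in> carrier S5 \<and> \<not> evenperm \<sigma>}. basis_elt a)}
      \<and> card (F C 12) = 2
      \<and> card (F C 4) = 6
      \<and> card (F C 3) = 24
      \<and> card (F C 2) = 36
      \<and> F C 1 = basis_elt ` C
      \<and> (\<forall>n\<ge>1. n \<notin> {1, 2, 3, 4, 12, 24} \<longrightarrow> F C n = {})
      \<and> theta C \<in> span_k (F C 12)
      \<and> rep_iso S5 (V C 12) sign_rep)"
  unfolding Let_def F_def V_def e_def fund_def
  by (intro conjI nontrivial_classes transposition_class double_transposition_class three_cycle_class
    order_six_class four_cycle_class five_cycle_class)

end
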